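(* Let $f\in\Lambda_p$, $1<p<\infty$, $\alpha_1>0$, $\alpha_2>0$, $n_i\in\{0,1,2,\ldots\}$, $i=1,2$, and let $\lambda_{\mu_1,\mu_2}$ be the coefficients of the lacunary Fourier series of $f$. Then $$\begin{aligned}\omega_{\alpha_1,\alpha_2}\Big(f,\frac1{2^{n_1}},\frac1{2^{n_2}}\Big)_{L_p(\mathbb{T}^2)}\asymp\;&\frac1{2^{n_1\alpha_1+n_2\alpha_2}}\Big\{\sum_{\mu_1=0}^{n_1}\sum_{\mu_2=0}^{n_2}\lambda_{\mu_1,\mu_2}^2\,2^{2(\mu_1\alpha_1+\mu_2\alpha_2)}\Big\}^{1/2}+\frac1{2^{n_1\alpha_1}}\Big\{\sum_{\mu_1=0}^{n_1}\sum_{\mu_2=n_2+1}^{\infty}\lambda_{\mu_1,\mu_2}^2\,2^{2\mu_1\alpha_1}\Big\}^{1/2}\\&+\frac1{2^{n_2\alpha_2}}\Big\{\sum_{\mu_1=n_1+1}^{\infty}\sum_{\mu_2=0}^{n_2}\lambda_{\mu_1,\mu_2}^2\,2^{2\mu_2\alpha_2}\Big\}^{1/2}+\Big\{\sum_{\mu_1=n_1+1}^{\infty}\sum_{\mu_2=n_2+1}^{\infty}\lambda_{\mu_1,\mu_2}^2\Big\}^{1/2}.\end{aligned}$$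
   Context: $L_p(\mathbb{T}^2)$, $1<p<\infty$, is the space of measurable functions $f(x,y)$ that are $2\pi$-periodic in each variable with $\|f\|_{L_p(\mathbb{T}^2)}=\big(\int_0^{2\pi}\int_0^{2\pi}|f(x,y)|^p\,dx\,dy\big)^{1/p}<\infty$; $L_p^0(\mathbb{T}^2)$ is the set of $f\in L_p(\mathbb{T}^2)$ with $\int_0^{2\pi}f(x,y)\,dy=0$ for a.e. $x$ and $\int_0^{2\pi}f(x,y)\,dx=0$ for a.e. $y$. The class $\Lambda_p$, $1<p<\infty$, is the set of $f\in L_p^0(\mathbb{T}^2)$ whose Fourier series is $\sum_{\mu_1=0}^\infty\sum_{\mu_2=0}^\infty\lambda_{\mu_1,\mu_2}\cos2^{\mu_1}x\cos2^{\mu_2}y$ with $\lambda_{\mu_1,\mu_2}\in\mathbb{R}$. For $\alpha_1,\alpha_2>0$ the (fractional) differences are $\Delta_{h_1}^{\alpha_1}(f)=\sum_{\nu=0}^\infty(-1)^\nu\binom{\alpha_1}{\nu}f(x+(\alpha_1-\nu)h_1,y)$ and $\Delta_{h_2}^{\alpha_2}(f)=\sum_{\nu=0}^\infty(-1)^\nu\binom{\alpha_2}{\nu}f(x,y+(\alpha_2-\nu)h_2)$, where $\binom{\alpha}{0}=1$, $\binom{\alpha}{\nu}=\frac{\alpha(\alpha-1)\cdots(\alpha-\nu+1)}{\nu!}$ for $\nu\ge1$. The mixed modulus of smoothness is $\omega_{\alpha_1,\alpha_2}(f,\delta_1,\delta_2)_{L_p(\mathbb{T}^2)}=\sup_{|h_i|\le\delta_i,\,i=1,2}\|\Delta_{h_1}^{\alpha_1}(\Delta_{h_2}^{\alpha_2}(f))\|_{L_p(\mathbb{T}^2)}$.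 $A\asymp B$ means $C^{-1}B\le A\le CB$ with a constant $C>0$ independent of $f,n_1,n_2$ ($C$ may depend on $p,\alpha_1,\alpha_2$). *)

theory Defs
  imports "HOL-Analysis.Analysis"
begin

text \<open>
  Real powers on \<open>[0,\<infinity>]\<close>, with \<open>\<infinity>\<close> raised to a positive power being \<open>\<infinity>\<close>.  Norms, the modulus
  of smoothness and the sums over coefficients are all valued in \<open>[0,\<infinity>]\<close>, so that no
  integral, supremum or series below needs a finiteness side condition to have its usual meaning.
\<close>
definition ennpowr :: "ennreal \<Rightarrow> real \<Rightarrow> ennreal" where
  "ennpowr x a = (if x = \<infinity> then \<infinity> else ennreal (enn2real x powr a))"

definition torus_square :: "(real \<times> real) set" where
  "torus_square = {0..2*pi} \<times> {0..2*pi}"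

definition Lp_norm :: "real \<Rightarrow> (real \<times> real \<Rightarrow> real) \<Rightarrow> ennreal" where
  "Lp_norm p f =
     ennpowr (\<integral>\<^sup>+ z \<in> torus_square. ennreal (\<bar>f z\<bar> powr p) \<partial>lebesgue) (1 / p)"

text \<open>Measurable means Lebesgue measurable; elements are functions, not classes modulo null sets.\<close>
definition Lp_torus :: "real \<Rightarrow> (real \<times> real \<Rightarrow> real) set" where
  "Lp_torus p = {f. f \<in> borel_measurable lebesgue \<and>
     (\<forall>x y. f (x + 2*pi, y) = f (x, y) \<and> f (x, y + 2*pi) = f (x, y)) \<and>
     Lp_norm p f < \<infinity>}"

definition Lp0_torus :: "real \<Rightarrow> (real \<times> real \<Rightarrow> real) set" where
  "Lp0_torus p = {f \<in> Lp_torus p.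
     (AE x in lebesgue. (LINT y:{0..2*pi}|lebesgue. f (x, y)) = 0) \<and>
     (AE y in lebesgue. (LINT x:{0..2*pi}|lebesgue. f (x, y)) = 0)}"

text \<open>
  Coefficient of \<open>u (m x) v (n y)\<close>, for \<open>u, v \<in> {cos, sin}\<close>, in the real double trigonometric
  Fourier series of \<open>f\<close>.  The factors \<open>1/2\<close> account for the constant functions \<open>cos (0 x)\<close> and
  \<open>cos (0 y)\<close>.
\<close>
definition fourier_coeff ::
    "(real \<Rightarrow> real) \<Rightarrow> (real \<Rightarrow> real) \<Rightarrow> (real \<times> real \<Rightarrow> real) \<Rightarrow> nat \<Rightarrow> nat \<Rightarrow> real" where
  "fourier_coeff u v f m n =
     (if m = 0 then 1/2 else 1) * (if n = 0 then 1/2 else 1) / pi\<^sup>2 *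
     (LINT z:torus_square|lebesgue. f z * u (real m * fst z) * v (real n * snd z))"

text \<open>
  The Fourier series of \<open>f\<close> is, as a formal trigonometric series,
  \<open>\<Sum>\<mu>\<^sub>1 \<mu>\<^sub>2. c \<mu>\<^sub>1 \<mu>\<^sub>2 cos (2^\<mu>\<^sub>1 x) cos (2^\<mu>\<^sub>2 y)\<close>; nothing is said about convergence.
\<close>
definition has_lacunary_series :: "(real \<times> real \<Rightarrow> real) \<Rightarrow> (nat \<Rightarrow> nat \<Rightarrow> real) \<Rightarrow> bool" where
  "has_lacunary_series f c \<longleftrightarrow>
     (\<forall>\<mu>1 \<mu>2. fourier_coeff cos cos f (2 ^ \<mu>1) (2 ^ \<mu>2) = c \<mu>1 \<mu>2) \<and>
     (\<forall>m n. \<not> (m \<in> range (\<lambda>\<mu>. 2 ^ \<mu>) \<and> n \<in> range (\<lambda>\<mu>. 2 ^ \<mu>)) \<longrightarrow>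
        fourier_coeff cos cos f m n = 0) \<and>
     (\<forall>m n. fourier_coeff cos sin f m n = 0 \<and>
            fourier_coeff sin cos f m n = 0 \<and>
            fourier_coeff sin sin f m n = 0)"

definition Lambda_class :: "real \<Rightarrow> (real \<times> real \<Rightarrow> real) set" where
  "Lambda_class p = {f \<in> Lp0_torus p. \<exists>c. has_lacunary_series f c}"

text \<open>
  Differences of fractional order, as pointwise series.  For \<open>\<alpha> > 0\<close> the coefficients are absolutely
  summable, so for \<open>f\<close> in \<open>Lp_torus p\<close> with \<open>p \<ge> 1\<close> the series converges almost everywhere;
  the value on the exceptional null set is irrelevant.
\<close>
definition frac_diff1 :: "real \<Rightarrow> real \<Rightarrow> (real \<times> real \<Rightarrow> real) \<Rightarrow> (real \<times> real \<Rightarrow> real)" where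
  "frac_diff1 \<alpha> h f = (\<lambda>(x, y). \<Sum>\<nu>. (-1) ^ \<nu> * (\<alpha> gchoose \<nu>) * f (x + (\<alpha> - real \<nu>) * h, y))"

definition frac_diff2 :: "real \<Rightarrow> real \<Rightarrow> (real \<times> real \<Rightarrow> real) \<Rightarrow> (real \<times> real \<Rightarrow> real)" where
  "frac_diff2 \<alpha> h f = (\<lambda>(x, y). \<Sum>\<nu>. (-1) ^ \<nu> * (\<alpha> gchoose \<nu>) * f (x, y + (\<alpha> - real \<nu>) * h))"

definition mixed_modulus ::
    "real \<Rightarrow> real \<Rightarrow> real \<Rightarrow> (real \<times> real \<Rightarrow> real) \<Rightarrow> real \<Rightarrow> real \<Rightarrow> ennreal" where
  "mixed_modulus p \<alpha>1 \<alpha>2 f \<delta>1 \<delta>2 =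
     (SUP (h1, h2) \<in> {(h1, h2). \<bar>h1\<bar> \<le> \<delta>1 \<and> \<bar>h2\<bar> \<le> \<delta>2}.
        Lp_norm p (frac_diff1 \<alpha>1 h1 (frac_diff2 \<alpha>2 h2 f)))"

definition lacunary_expression ::
    "real \<Rightarrow> real \<Rightarrow> (nat \<Rightarrow> nat \<Rightarrow> real) \<Rightarrow> nat \<Rightarrow> nat \<Rightarrow> ennreal" where
  "lacunary_expression \<alpha>1 \<alpha>2 c n1 n2 =
     ennreal (1 / 2 powr (n1 * \<alpha>1 + n2 * \<alpha>2)) *
       ennpowr (\<Sum>\<mu>1=0..n1. \<Sum>\<mu>2=0..n2.
         ennreal ((c \<mu>1 \<mu>2)\<^sup>2 * 2 powr (2 * (\<mu>1 * \<alpha>1 + \<mu>2 * \<alpha>2)))) (1/2)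
   + ennreal (1 / 2 powr (n1 * \<alpha>1)) *
       ennpowr (\<Sum>\<mu>1=0..n1. \<Sum>\<^sub>\<infinity>\<mu>2\<in>{n2+1..}.
         ennreal ((c \<mu>1 \<mu>2)\<^sup>2 * 2 powr (2 * \<mu>1 * \<alpha>1))) (1/2)
   + ennreal (1 / 2 powr (n2 * \<alpha>2)) *
       ennpowr (\<Sum>\<^sub>\<infinity>\<mu>1\<in>{n1+1..}. \<Sum>\<mu>2=0..n2.
         ennreal ((c \<mu>1 \<mu>2)\<^sup>2 * 2 powr (2 * \<mu>2 * \<alpha>2))) (1/2)
   + ennpowr (\<Sum>\<^sub>\<infinity>\<mu>1\<in>{n1+1..}. \<Sum>\<^sub>\<infinity>\<mu>2\<in>{n2+1..}. ennreal ((c \<mu>1 \<mu>2)\<^sup>2)) (1/2)"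

end

theory Submission
  imports Defs
begin

text \<open>
  The difference operator acts on \<open>cos (2^\<mu> x)\<close> as a Fourier multiplier: it multiplies the term by
  \<open>\<bar>2 sin (2^\<mu> h / 2)\<bar> powr \<alpha>\<close> and shifts its phase.  Hence the mixed difference of \<open>f\<close> is again a
  double lacunary series, with coefficients \<open>c \<mu> \<nu>\<close> times two such factors, and two things have to be
  shown: that the \<open>L\<^sub>p\<close> norm of a double lacunary series with arbitrary phases is comparable with the
  \<open>\<ell>\<^sub>2\<close> norm of its coefficients, and that the factors have the right size.

  The size of the factors is elementary.  For \<open>\<bar>h\<bar> \<le> 1 / 2^n\<close> the factor is at most \<open>2 powr \<alpha>\<close> times
  \<open>weight \<alpha> n \<mu>\<close>, which is \<open>2 powr ((\<mu> - n) \<alpha>)\<close> for \<open>\<mu> \<le> n\<close> and \<open>1\<close> beyond (\<open>symbol_le_weight\<close>).  A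
  single step also gives the reverse estimate for all \<open>\<mu>\<close> at once, namely \<open>h = \<pi> / (6 \<cdot> 2^n)\<close>: doubling
  \<open>\<pi> / 3\<close> repeatedly keeps \<open>\<bar>sin\<bar>\<close> equal to \<open>sqrt 3 / 2\<close>, so the factor does not degenerate at high
  frequencies (\<open>weight_le_symbol\<close>).  The four-term expression of the theorem is equivalent to the
  \<open>\<ell>\<^sub>2\<close> norm of the weighted coefficients (\<open>lacunary_expression_equivalence\<close>).

  The norm equivalence is \<open>lacunary_Lp_norm_equivalence\<close>.  Its core is a Khintchine inequality for
  polynomials, valid for every exponent \<open>q > 0\<close>.  In one variable, \<open>exp x \<le> (1 + x) exp (2 x\<^sup>2)\<close> for
  \<open>\<bar>x\<bar> \<le> 1/2\<close> bounds the exponential moment of a normalised polynomial by the integral of the Riesz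
  product \<open>\<Prod>(1 + b\<^sub>j cos (2^j x + \<theta>\<^sub>j))\<close>, which is exactly \<open>2 \<pi>\<close>, since each frequency \<open>2^j\<close> exceeds the sum of
  the smaller ones.  The inequality in two variables follows by applying this
  one variable at a time, with Jensen's inequality in between.
  The lower bound for \<open>\<parallel>G\<parallel>\<^sub>p\<close> is then duality: \<open>G\<close> is paired with its own partial sum \<open>S\<close>, and \<open>\<parallel>S\<parallel>\<^sub>q\<close>
  with the conjugate exponent \<open>q\<close> is controlled by Khintchine.  For the upper bound, the partial sums
  are Cauchy in \<open>L\<^sub>1\<close>, a subsequence converges almost everywhere, Fatou's lemma bounds the limit, and
  the limit is \<open>G\<close> because integrable functions on the torus are determined by their Fourier
  coefficients (\<open>torus_Fourier_uniqueness\<close>).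
\<close>

section \<open>The circle and the torus as finite measure spaces\<close>

text \<open>
  The circle is the closed interval of length \<open>2 \<pi>\<close> with Lebesgue measure on Borel sets, which suffices
  for the continuous integrands in one variable.  The torus carries the complete measure, since
  elements of \<open>L\<^sub>p\<close> are Lebesgue measurable functions.
\<close>
definition circle :: "real measure" where
  "circle = restrict_space lborel {0..2*pi}"

definition torus :: "(real \<times> real) measure" where
  "torus = restrict_space lebesgue torus_square"

lemma torus_square_cbox: "torus_square = cbox (0, 0) (2*pi, 2*pi)"
  by (simp add: torus_square_def cbox_Pair_eq)

lemma torus_square_sets [simp]: "torus_square \<in> sets lebesgue" "torus_square \<in> sets borel"
  by (auto simp: torus_square_cbox)

lemma space_circle: "space circle = {0..2*pi}"
  by (simp add: circle_def space_restrict_space)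

lemma space_torus: "space torus = torus_square"
  by (simp add: torus_def space_restrict_space)

lemma measurable_circle: "f \<in> borel_measurable borel \<Longrightarrow> f \<in> borel_measurable circle"
  unfolding circle_def by (rule measurable_restrict_space1) simp

lemma measurable_torus: "f \<in> borel_measurable lebesgue \<Longrightarrow> f \<in> borel_measurable torus"
  unfolding torus_def by (rule measurable_restrict_space1)

lemma borel_measurable_torus: "f \<in> borel_measurable borel \<Longrightarrow> f \<in> borel_measurable torus"
  by (rule measurable_torus) (simp add: borel_measurable_if_D measurable_completion)

lemma emeasure_circle: "emeasure circle (space circle) = ennreal (2*pi)"
  by (simp add: space_circle) (simp add: circle_def emeasure_restrict_space)

interpretation circle: finite_measure circle
  by (rule finite_measureI) (simp add: emeasure_circle)

lemma integrable_circle: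
  assumes "continuous_on UNIV f" shows "integrable circle (f :: real \<Rightarrow> real)"
proof -
  have "compact (f ` {0..2*pi})"
    by (intro compact_continuous_image continuous_on_subset[OF assms]) auto
  then obtain B where B: "\<And>x. x \<in> {0..2*pi} \<Longrightarrow> norm (f x) \<le> B"
    using compact_imp_bounded bounded_iff by (metis image_eqI)
  show ?thesis
    by (rule circle.integrable_const_bound[where B=B])
       (auto simp: space_circle B[simplified] intro!: AE_I2 measurable_circle borel_measurable_continuous_onI assms)
qed

lemma nn_integral_torus:
  assumes [measurable]: "F \<in> borel_measurable borel"
  shows "(\<integral>\<^sup>+z. F z \<partial>torus) = (\<integral>\<^sup>+x. (\<integral>\<^sup>+y. F (x, y) \<partial>circle) \<partial>circle)"
proof -
  have [measurable]: "F \<in> borel_measurable (borel \<Otimes>\<^sub>M borel)"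
    by (simp add: borel_prod)
  have "(\<integral>\<^sup>+z. F z \<partial>torus) = (\<integral>\<^sup>+z. F z * indicator torus_square z \<partial>lborel)"
    unfolding torus_def by (subst nn_integral_restrict_space) (auto intro!: nn_integral_completion)
  also have "\<dots> = (\<integral>\<^sup>+z. F z * indicator torus_square z \<partial>(lborel \<Otimes>\<^sub>M lborel))"
    by (simp add: lborel_prod)
  also have "\<dots> = (\<integral>\<^sup>+x. (\<integral>\<^sup>+y. F (x, y) * indicator torus_square (x, y) \<partial>lborel) \<partial>lborel)"
    by (subst lborel.nn_integral_fst[symmetric]) (auto simp: torus_square_def)
  also have "\<dots> = (\<integral>\<^sup>+x. (\<integral>\<^sup>+y. F (x, y) * indicator {0..2*pi} y \<partial>lborel) * indicator {0..2*pi} x \<partial>lborel)"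
    by (intro nn_integral_cong) (auto simp: torus_square_def indicator_def)
  also have "\<dots> = (\<integral>\<^sup>+x. (\<integral>\<^sup>+y. F (x, y) \<partial>circle) \<partial>circle)"
    unfolding circle_def by (simp add: nn_integral_restrict_space)
  finally show ?thesis .
qed

lemma emeasure_torus: "emeasure torus (space torus) = ennreal (4*pi\<^sup>2)"
proof -
  have "emeasure torus (space torus) = (\<integral>\<^sup>+z. 1 \<partial>torus)" by simp
  also have "\<dots> = ennreal (2*pi) * ennreal (2*pi)"
    by (subst nn_integral_torus) (auto simp: emeasure_circle)
  finally show ?thesis by (simp add: ennreal_mult[symmetric] power2_eq_square)
qed

interpretation torus: finite_measure torus
  by (rule finite_measureI) (simp add: emeasure_torus)

lemma integrable_torus:
  assumes "continuous_on UNIV f" shows "integrable torus (f :: real \<times> real \<Rightarrow> real)"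
proof -
  have "compact (f ` torus_square)" unfolding torus_square_cbox
    by (intro compact_continuous_image continuous_on_subset[OF assms]) auto
  then obtain B where B: "\<And>x. x \<in> torus_square \<Longrightarrow> norm (f x) \<le> B"
    using compact_imp_bounded bounded_iff by (metis image_eqI)
  show ?thesis
    by (rule torus.integrable_const_bound[where B=B])
       (auto simp: space_torus B[simplified] intro!: AE_I2 borel_measurable_torus borel_measurable_continuous_onI assms)
qed

lemma integral_torus_product:
  assumes "continuous_on UNIV u" "continuous_on UNIV v"
  shows "(\<integral>z. u (fst z) * v (snd z) \<partial>torus) = (\<integral>x. u x \<partial>circle) * (\<integral>y. (v y :: real) \<partial>circle)"
proof -
  have cont: "continuous_on UNIV (\<lambda>z. u (fst z) * v (snd z))"
    by (intro continuous_intros continuous_on_compose2[OF assms(1)] continuous_on_compose2[OF assms(2)]; simp)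
  note I = integrable_torus[OF cont]
  have meas: "(\<lambda>z. indicator torus_square z *\<^sub>R (u (fst z) * v (snd z))) \<in> borel_measurable lborel"
    using borel_measurable_continuous_onI[OF cont] by (intro borel_measurable_scaleR borel_measurable_indicator) auto
  let ?F = "\<lambda>z. indicator torus_square z *\<^sub>R (u (fst z) * v (snd z))"
  have I2: "integrable (lborel \<Otimes>\<^sub>M lborel) ?F"
  proof -
    note meas
    moreover have "integrable lebesgue ?F"
      using I unfolding torus_def by (subst (asm) integrable_restrict_space) auto
    ultimately show ?thesis
      unfolding lborel_prod using integrable_completion by blast
  qed
  have "(\<integral>z. u (fst z) * v (snd z) \<partial>torus) = (\<integral>z. ?F z \<partial>(lborel \<Otimes>\<^sub>M lborel))"
    unfolding torus_def lborel_prod by (subst integral_restrict_space) (auto intro!: integral_completion meas[simplified])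
  also have "\<dots> = (\<integral>x. (\<integral>y. ?F (x, y) \<partial>lborel) \<partial>lborel)"
    by (rule lborel_pair.integral_fst'[OF I2, symmetric])
  also have "\<dots> = (\<integral>x. (\<integral>y. (indicator {0..2*pi} x *\<^sub>R u x) * (indicator {0..2*pi} y *\<^sub>R v y) \<partial>lborel) \<partial>lborel)"
    by (intro Bochner_Integration.integral_cong) (auto simp: torus_square_def indicator_def)
  also have "\<dots> = (\<integral>x. (indicator {0..2*pi} x *\<^sub>R u x) \<partial>lborel) * (\<integral>y. (indicator {0..2*pi} y *\<^sub>R v y) \<partial>lborel)"
    by simp
  also have "\<dots> = (\<integral>x. u x \<partial>circle) * (\<integral>y. v y \<partial>circle)"
    unfolding circle_def by (simp add: integral_restrict_space)
  finally show ?thesis .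
qed

lemma integral_circle_cos:
  "(\<integral>x. cos (real m * x + s) \<partial>circle) = (if m = 0 then 2 * pi * cos s else 0)"
proof (cases "m = 0")
  case True
  have "measure circle (space circle) = 2*pi" using emeasure_circle by (simp add: measure_def)
  then show ?thesis using True by simp
next
  case False
  have "(\<integral>x. cos (real m * x + s) * indicator {0..2*pi} x \<partial>lborel) = sin (real m * (2*pi) + s) / m - sin (real m * 0 + s) / m"
    by (rule integral_FTC_Icc_real) (use False in \<open>auto intro!: derivative_eq_intros continuous_intros\<close>)
  also have "sin (real m * (2*pi) + s) = sin s"
    using sin_npi[of "2*m"] cos_npi[of "2*m"] by (simp add: sin_add mult_ac)
  finally show ?thesis using False
    unfolding circle_def by (simp add: integral_restrict_space mult.commute)
qed

section \<open>Khintchine inequality for lacunary polynomials\<close>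

text \<open>
  Peeling off the factor of highest frequency \<open>2^N\<close> leaves a product that is orthogonal to
  every \<open>cos (k x + s)\<close> with \<open>k \<ge> 2^N\<close>; this is what the inner induction shows.  The ratio \<open>2\<close> is just
  large enough.
\<close>
lemma integral_riesz_product:
  fixes b \<theta> :: "nat \<Rightarrow> real"
  shows "(\<integral>x. (\<Prod>j<N. 1 + b j * cos (2^j * x + \<theta> j)) \<partial>circle) = 2 * pi"
proof -
  define P where "P N x = (\<Prod>j<N. 1 + b j * cos (2^j * x + \<theta> j))" for N and x :: real
  have cont: "continuous_on UNIV (P N)" for N unfolding P_def by (intro continuous_intros)
  have PS: "P (Suc N) x = P N x + b N * (P N x * cos (2^N * x + \<theta> N))" for N x
    by (simp add: P_def algebra_simps)
  have vanish: "(\<integral>x. P N x * cos (real k * x + s) \<partial>circle) = 0" if "2^N \<le> k" for N k s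
    using that
  proof (induction N arbitrary: k s)
    case 0 then show ?case by (simp add: P_def integral_circle_cos)
  next
    case (Suc N)
    have k: "2^N \<le> k" "2^N \<le> k + 2^N" "2^N \<le> k - 2^N" using Suc.prems by auto
    have r: "real (k - 2^N) = real k - 2^N" using k by (simp add: of_nat_diff)
    have eq: "P (Suc N) x * cos (real k * x + s) = P N x * cos (real k * x + s)
        + b N / 2 * (P N x * cos (real (k + 2^N) * x + (s + \<theta> N)))
        + b N / 2 * (P N x * cos (real (k - 2^N) * x + (s - \<theta> N)))" for x
    proof -
      have "cos (2^N * x + \<theta> N) * cos (real k * x + s) =
        (cos (real (k + 2^N) * x + (s + \<theta> N)) + cos (real (k - 2^N) * x + (s - \<theta> N))) / 2"
        unfolding r by (subst mult.commute, subst cos_times_cos) (simp add: algebra_simps)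
      then show ?thesis unfolding PS by (simp add: algebra_simps add_divide_distrib)
    qed
    have I: "integrable circle (\<lambda>x. P N x * cos (real k * x + s))" for k s
      by (intro integrable_circle continuous_intros cont)
    show ?case unfolding eq
      by (simp add: I Suc.IH[OF k(1)] Suc.IH[OF k(2)] Suc.IH[OF k(3)] del: of_nat_add of_nat_diff)
  qed
  have "(\<integral>x. P N x \<partial>circle) = 2 * pi" for N
  proof (induction N)
    case 0 then show ?case using integral_circle_cos[of 0 0] by (simp add: P_def)
  next
    case (Suc N)
    have "integrable circle (\<lambda>x. P N x * cos (2^N * x + \<theta> N))" "integrable circle (P N)"
      by (intro integrable_circle continuous_intros cont)+
    then show ?case unfolding PS using Suc vanish[of N "2^N" "\<theta> N"] by simp
  qed
  then show ?thesis by (simp add: P_def)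
qed

lemma exp_le_one_plus:
  fixes x :: real assumes "\<bar>x\<bar> \<le> 1/2" shows "exp x \<le> (1 + x) * exp (2 * x\<^sup>2)"
proof -
  have "x \<le> ln (1 + x) + 2 * x\<^sup>2" using abs_ln_one_plus_x_minus_x_bound[OF assms] by linarith
  then have "exp x \<le> exp (ln (1 + x) + 2 * x\<^sup>2)" by simp
  also have "\<dots> = (1 + x) * exp (2 * x\<^sup>2)" using assms by (subst exp_add) (simp add: exp_ln)
  finally show ?thesis .
qed

text \<open>
  Exponential integrability of a lacunary polynomial with \<open>\<ell>\<^sub>2\<close> norm at most \<open>1\<close>, with a bound that does
  not depend on the number of terms.
\<close>
lemma lacunary_exp_moment:
  fixes e \<theta> :: "nat \<Rightarrow> real"
  assumes "(\<Sum>j<N. (e j)\<^sup>2) \<le> 1"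
  shows "(\<integral>\<^sup>+x. ennreal (exp ((\<Sum>j<N. e j * cos (2^j * x + \<theta> j)) / 2)) \<partial>circle) \<le> ennreal (2 * pi * exp (1/2))"
proof -
  have e: "\<bar>e j\<bar> \<le> 1" if "j < N" for j
  proof -
    have "(e j)\<^sup>2 \<le> (\<Sum>j<N. (e j)\<^sup>2)" using that by (intro member_le_sum) auto
    then show ?thesis using assms by (simp add: abs_square_le_1[symmetric])
  qed
  let ?P = "\<lambda>x. \<Prod>j<N. 1 + e j / 2 * cos (2^j * x + \<theta> j)"
  have small: "\<bar>e j / 2 * cos (2^j * x + \<theta> j)\<bar> \<le> 1/2" if "j < N" for j x
    using mult_mono[OF e[OF that] abs_cos_le_one[of "2^j * x + \<theta> j"]] by (simp add: abs_mult)
  have pos: "0 \<le> ?P x" for x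
  proof (rule prod_nonneg)
    fix j assume "j \<in> {..<N}"
    then show "0 \<le> 1 + e j / 2 * cos (2^j * x + \<theta> j)" using small[of j x] by (simp only: abs_le_iff) force
  qed
  have bound: "exp ((\<Sum>j<N. e j * cos (2^j * x + \<theta> j)) / 2) \<le> exp (1/2) * ?P x" for x
  proof -
    have "exp ((\<Sum>j<N. e j * cos (2^j * x + \<theta> j)) / 2) = (\<Prod>j<N. exp (e j / 2 * cos (2^j * x + \<theta> j)))"
      by (simp add: exp_sum sum_divide_distrib)
    also have "\<dots> \<le> (\<Prod>j<N. (1 + e j / 2 * cos (2^j * x + \<theta> j)) * exp ((e j)\<^sup>2 / 2))"
    proof (intro prod_mono conjI)
      fix j assume j: "j \<in> {..<N}"
      let ?y = "e j / 2 * cos (2^j * x + \<theta> j)"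
      have "(cos (2^j * x + \<theta> j))\<^sup>2 \<le> 1" by (simp add: abs_square_le_1)
      then have "(e j)\<^sup>2 * (cos (2^j * x + \<theta> j))\<^sup>2 \<le> (e j)\<^sup>2 * 1" by (intro mult_left_mono) auto
      then have "2 * ?y\<^sup>2 \<le> (e j)\<^sup>2 / 2" by (simp add: power_mult_distrib power_divide)
      moreover have "0 \<le> 1 + ?y" using small[of j x] j by (auto simp: abs_le_iff)
      ultimately have "(1 + ?y) * exp (2 * ?y\<^sup>2) \<le> (1 + ?y) * exp ((e j)\<^sup>2 / 2)"
        by (intro mult_left_mono) auto
      then show "exp ?y \<le> (1 + ?y) * exp ((e j)\<^sup>2 / 2)"
        using exp_le_one_plus[OF small, of j x] j by force
    qed auto
    also have "\<dots> = ?P x * exp ((\<Sum>j<N. (e j)\<^sup>2) / 2)"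
      by (simp add: prod.distrib exp_sum sum_divide_distrib)
    also have "\<dots> \<le> ?P x * exp (1/2)"
      using assms by (intro mult_left_mono pos) auto
    finally show ?thesis by (simp add: mult.commute)
  qed
  have "(\<integral>\<^sup>+x. ennreal (exp ((\<Sum>j<N. e j * cos (2^j * x + \<theta> j)) / 2)) \<partial>circle)
      \<le> (\<integral>\<^sup>+x. ennreal (exp (1/2) * ?P x) \<partial>circle)"
    by (intro nn_integral_mono ennreal_leI bound)
  also have "\<dots> = ennreal (\<integral>x. exp (1/2) * ?P x \<partial>circle)"
    by (intro nn_integral_eq_integral integrable_circle continuous_intros) (use pos in auto)
  also have "(\<integral>x. exp (1/2) * ?P x \<partial>circle) = 2 * pi * exp (1/2)"
    using integral_riesz_product[of "\<lambda>j. e j / 2" \<theta> N] by simp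
  finally show ?thesis .
qed

lemma powr_le_exp_half:
  fixes q x :: real assumes "0 < q" shows "\<bar>x\<bar> powr q \<le> (2*q) powr q * (exp (x/2) + exp (-(x/2)))"
proof -
  define u where "u = \<bar>x\<bar> / (2*q)"
  have u: "0 \<le> u" "\<bar>x\<bar> = 2*q*u" using assms by (auto simp: u_def)
  have "u powr q \<le> exp u powr q" using u assms by (intro powr_mono2) (auto intro: order_trans[OF _ exp_ge_add_one_self])
  also have "\<dots> = exp (\<bar>x\<bar>/2)" by (simp add: exp_powr_real u(2) mult.commute)
  also have "\<dots> \<le> exp (x/2) + exp (-(x/2))" by (cases "0 \<le> x") auto
  finally have "(2*q) powr q * u powr q \<le> (2*q) powr q * (exp (x/2) + exp (-(x/2)))"
    by (intro mult_left_mono) auto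
  then show ?thesis using u assms by (simp add: powr_mult)
qed

lemma lacunary_Khintchine_circle:
  fixes q :: real assumes q: "0 < q"
  obtains K where "K > 0" "\<And>b \<theta> N. (\<integral>\<^sup>+x. ennreal (\<bar>\<Sum>j<N. b j * cos (2^j * x + \<theta> j)\<bar> powr q) \<partial>circle)
       \<le> ennreal (K * (\<Sum>j<N. (b j)\<^sup>2) powr (q/2))"
proof -
  define K where "K = (2*q) powr q * (4 * pi * exp (1/2))"
  have *: "(\<integral>\<^sup>+x. ennreal (\<bar>\<Sum>j<N. b j * cos (2^j * x + \<theta> j)\<bar> powr q) \<partial>circle)
       \<le> ennreal (K * (\<Sum>j<N. (b j)\<^sup>2) powr (q/2))" for b \<theta> N
  proof -
    define S where "S = (\<Sum>j<N. (b j)\<^sup>2)"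
    have S0: "0 \<le> S" unfolding S_def by (intro sum_nonneg) auto
    show ?thesis
    proof (cases "S = 0")
      case True
      then have "\<forall>j<N. b j = 0" unfolding S_def by (subst (asm) sum_nonneg_eq_0_iff) auto
      then show ?thesis by simp
    next
      case False
      then have S: "0 < S" using S0 by simp
      define e where "e j = b j / sqrt S" for j
      define T where "T x = (\<Sum>j<N. e j * cos (2^j * x + \<theta> j))" for x
      have e1: "(\<Sum>j<N. (e j)\<^sup>2) \<le> 1"
        using S by (simp add: e_def power_divide flip: sum_divide_distrib) (simp add: S_def)
      have contT: "continuous_on UNIV T" unfolding T_def by (intro continuous_intros)
      note [measurable] = measurable_circle[OF borel_measurable_continuous_onI[OF contT]]
      have bT: "(\<Sum>j<N. b j * cos (2^j * x + \<theta> j)) = sqrt S * T x" for x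
        using S by (simp add: T_def e_def sum_distrib_left)
      have eq: "\<bar>\<Sum>j<N. b j * cos (2^j * x + \<theta> j)\<bar> powr q = S powr (q/2) * \<bar>T x\<bar> powr q" for x
        unfolding bT using S by (simp add: abs_mult powr_mult powr_half_sqrt[symmetric] powr_powr)
      have m1: "(\<integral>\<^sup>+x. ennreal (exp (T x / 2)) \<partial>circle) \<le> ennreal (2 * pi * exp (1/2))"
        using lacunary_exp_moment[OF e1] by (simp add: T_def)
      have m2: "(\<integral>\<^sup>+x. ennreal (exp (- (T x / 2))) \<partial>circle) \<le> ennreal (2 * pi * exp (1/2))"
        using lacunary_exp_moment[of "\<lambda>j. - e j" N \<theta>] e1 by (simp add: T_def sum_negf)
      have "(\<integral>\<^sup>+x. ennreal (\<bar>T x\<bar> powr q) \<partial>circle)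
          \<le> (\<integral>\<^sup>+x. ennreal ((2*q) powr q) * (ennreal (exp (T x / 2)) + ennreal (exp (- (T x / 2)))) \<partial>circle)"
        using powr_le_exp_half[OF q]
        by (intro nn_integral_mono) (simp add: ennreal_mult[symmetric] ennreal_plus[symmetric] ennreal_leI del: ennreal_plus)
      also have "\<dots> = ennreal ((2*q) powr q) * ((\<integral>\<^sup>+x. ennreal (exp (T x / 2)) \<partial>circle) + (\<integral>\<^sup>+x. ennreal (exp (- (T x / 2))) \<partial>circle))"
        by (simp add: nn_integral_cmult nn_integral_add)
      also have "\<dots> \<le> ennreal ((2*q) powr q) * (ennreal (2 * pi * exp (1/2)) + ennreal (2 * pi * exp (1/2)))"
        by (intro mult_left_mono add_mono m1 m2) auto
      also have "\<dots> = ennreal K"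
        by (simp add: K_def ennreal_mult[symmetric] ennreal_plus[symmetric] del: ennreal_plus)
      finally have T: "(\<integral>\<^sup>+x. ennreal (\<bar>T x\<bar> powr q) \<partial>circle) \<le> ennreal K" .
      have "(\<integral>\<^sup>+x. ennreal (\<bar>\<Sum>j<N. b j * cos (2^j * x + \<theta> j)\<bar> powr q) \<partial>circle)
         = ennreal (S powr (q/2)) * (\<integral>\<^sup>+x. ennreal (\<bar>T x\<bar> powr q) \<partial>circle)"
        unfolding eq by (subst nn_integral_cmult[symmetric]) (auto simp: ennreal_mult)
      also have "\<dots> \<le> ennreal (S powr (q/2)) * ennreal K"
        by (intro mult_left_mono T) auto
      also have "\<dots> = ennreal (K * S powr (q/2))"
        by (subst ennreal_mult[symmetric]) (auto simp: K_def mult.commute)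
      finally show ?thesis by (simp add: S_def)
    qed
  qed
  show thesis by (rule that[of K, OF _ *]) (use q in \<open>auto simp: K_def\<close>)
qed

text \<open>
  The square partial sum, over \<open>\<mu>, \<nu> < N\<close>, of a double lacunary series with phases \<open>\<theta>\<close> in the first
  variable and \<open>\<eta>\<close> in the second.
\<close>
definition lac_poly :: "(nat \<Rightarrow> nat \<Rightarrow> real) \<Rightarrow> (nat \<Rightarrow> real) \<Rightarrow> (nat \<Rightarrow> real) \<Rightarrow> nat \<Rightarrow> real \<times> real \<Rightarrow> real" where
  "lac_poly a \<theta> \<eta> N z = (\<Sum>\<mu><N. \<Sum>\<nu><N. a \<mu> \<nu> * (cos (2^\<mu> * fst z + \<theta> \<mu>) * cos (2^\<nu> * snd z + \<eta> \<nu>)))"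

lemma continuous_lac_poly: "continuous_on A (lac_poly a \<theta> \<eta> N)"
  unfolding lac_poly_def by (intro continuous_intros)

text \<open>
  Jensen's inequality for \<open>x powr k\<close> applied to \<open>G i / s i\<close> with weights proportional to \<open>s i\<close>; indices
  with \<open>G i = 0\<close> are discarded, because convexity is only available on the open half-line.
\<close>
lemma powr_sum_le_weighted:
  fixes G s :: "'i \<Rightarrow> real"
  assumes fin: "finite I" and k: "1 \<le> k"
    and G: "\<And>i. i \<in> I \<Longrightarrow> 0 \<le> G i" and s: "\<And>i. i \<in> I \<Longrightarrow> 0 \<le> s i"
    and z: "\<And>i. i \<in> I \<Longrightarrow> s i = 0 \<Longrightarrow> G i = 0"
  shows "(\<Sum>i\<in>I. G i) powr k \<le> (\<Sum>i\<in>I. s i) powr (k - 1) * (\<Sum>i\<in>I. s i powr (1 - k) * G i powr k)"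
proof -
  define J where "J = {i\<in>I. 0 < G i}"
  have J: "finite J" "J \<subseteq> I" using fin by (auto simp: J_def)
  have pos: "0 < G i" "0 < s i" if "i \<in> J" for i
    using that z s unfolding J_def by (auto simp: less_le)
  have GJ: "(\<Sum>i\<in>I. G i) = (\<Sum>i\<in>J. G i)"
    using G by (intro sum.mono_neutral_right fin J) (auto simp: J_def less_le)
  show ?thesis
  proof (cases "J = {}")
    case True
    have "0 \<le> (\<Sum>i\<in>I. s i powr (1 - k) * G i powr k)" by (intro sum_nonneg) auto
    then show ?thesis unfolding GJ using True k by simp
  next
    case False
    define \<sigma> where "\<sigma> = (\<Sum>i\<in>J. s i)"
    have \<sigma>: "0 < \<sigma>" unfolding \<sigma>_def by (intro sum_pos J False pos)
    have "(\<Sum>i\<in>J. (s i / \<sigma>) *\<^sub>R (G i / s i)) powr k \<le> (\<Sum>i\<in>J. s i / \<sigma> * (G i / s i) powr k)"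
    proof (rule convex_on_sum[OF J(1) False powr_convex[OF k]])
      show "(\<Sum>i\<in>J. s i / \<sigma>) = 1" using \<sigma> by (simp add: \<sigma>_def flip: sum_divide_distrib)
    qed (use pos \<sigma> in \<open>auto intro!: less_imp_le divide_pos_pos\<close>)
    also have "(\<Sum>i\<in>J. (s i / \<sigma>) *\<^sub>R (G i / s i)) = (\<Sum>i\<in>J. G i) / \<sigma>"
      unfolding sum_divide_distrib by (intro sum.cong) (use pos in \<open>auto simp: less_le\<close>)
    also have "(\<Sum>i\<in>J. s i / \<sigma> * (G i / s i) powr k) = (\<Sum>i\<in>J. s i powr (1 - k) * G i powr k) / \<sigma>"
      unfolding sum_divide_distrib
    proof (intro sum.cong refl)
      fix i assume "i \<in> J"
      from pos[OF this] show "s i / \<sigma> * (G i / s i) powr k = s i powr (1 - k) * G i powr k / \<sigma>"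
        using k by (simp add: powr_divide powr_diff)
    qed
    finally have "((\<Sum>i\<in>J. G i) / \<sigma>) powr k * \<sigma> powr k \<le> (\<Sum>i\<in>J. s i powr (1 - k) * G i powr k) / \<sigma> * \<sigma> powr k"
      by (intro mult_right_mono) auto
    also have "((\<Sum>i\<in>J. G i) / \<sigma>) powr k * \<sigma> powr k = (\<Sum>i\<in>J. G i) powr k"
      using \<sigma> by (subst powr_mult[symmetric]) (auto intro!: sum_nonneg less_imp_le pos divide_nonneg_pos)
    also have "(\<Sum>i\<in>J. s i powr (1 - k) * G i powr k) / \<sigma> * \<sigma> powr k
        = \<sigma> powr (k - 1) * (\<Sum>i\<in>J. s i powr (1 - k) * G i powr k)"
      using \<sigma> by (simp add: powr_diff)
    also have "\<dots> \<le> (\<Sum>i\<in>I. s i) powr (k - 1) * (\<Sum>i\<in>I. s i powr (1 - k) * G i powr k)"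
      unfolding \<sigma>_def using k s pos J
      by (intro mult_mono powr_mono2 sum_mono2 fin sum_nonneg) (auto intro: less_imp_le)
    finally show ?thesis unfolding GJ .
  qed
qed

text \<open>
  For fixed \<open>x\<close> the polynomial is lacunary in \<open>y\<close> with coefficients \<open>F \<nu> x\<close>, so the circle inequality gives
  \<open>(\<Sum>\<nu>. (F \<nu> x)\<^sup>2) powr (q/2)\<close>.  Jensen's inequality, which needs \<open>q \<ge> 2\<close>, reduces this to
  the powers \<open>\<bar>F \<nu> x\<bar> powr q\<close>, and each \<open>F \<nu>\<close> is a lacunary polynomial in \<open>x\<close>.
\<close>
lemma lacunary_Khintchine_torus_ge2:
  fixes q :: real assumes q: "2 \<le> q"
  obtains K where "K > 0" "\<And>a \<theta> \<eta> N. (\<integral>\<^sup>+z. ennreal (\<bar>lac_poly a \<theta> \<eta> N z\<bar> powr q) \<partial>torus)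
       \<le> ennreal (K * (\<Sum>\<mu><N. \<Sum>\<nu><N. (a \<mu> \<nu>)\<^sup>2) powr (q/2))"
proof -
  obtain K where K: "K > 0" and Kh: "\<And>b \<theta> N. (\<integral>\<^sup>+x. ennreal (\<bar>\<Sum>j<N. b j * cos (2^j * x + \<theta> j)\<bar> powr q) \<partial>circle)
       \<le> ennreal (K * (\<Sum>j<N. (b j)\<^sup>2) powr (q/2))"
    using lacunary_Khintchine_circle[of q] q by auto
  define k where "k = q / 2"
  have k: "1 \<le> k" "q = 2 * k" using q by (auto simp: k_def)
  have sq: "(u\<^sup>2) powr k = \<bar>u\<bar> powr q" for u :: real
    unfolding k(2) by (subst powr_powr[symmetric]) (simp add: powr_numeral)
  have "(\<integral>\<^sup>+z. ennreal (\<bar>lac_poly a \<theta> \<eta> N z\<bar> powr q) \<partial>torus)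
       \<le> ennreal (K * K * (\<Sum>\<mu><N. \<Sum>\<nu><N. (a \<mu> \<nu>)\<^sup>2) powr (q/2))" for a \<theta> \<eta> N
  proof -
    define F where "F \<nu> x = (\<Sum>\<mu><N. a \<mu> \<nu> * cos (2^\<mu> * x + \<theta> \<mu>))" for \<nu> and x :: real
    define s where "s \<nu> = (\<Sum>\<mu><N. (a \<mu> \<nu>)\<^sup>2)" for \<nu>
    define \<sigma> where "\<sigma> = (\<Sum>\<nu><N. s \<nu>)"
    have s0: "0 \<le> s \<nu>" for \<nu> unfolding s_def by (intro sum_nonneg) auto
    have \<sigma>0: "0 \<le> \<sigma>" unfolding \<sigma>_def by (intro sum_nonneg s0)
    have contF: "continuous_on UNIV (F \<nu>)" for \<nu> unfolding F_def by (intro continuous_intros)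
    note [measurable] = measurable_circle[OF borel_measurable_continuous_onI[OF contF]]
    have "(\<lambda>z. ennreal (\<bar>lac_poly a \<theta> \<eta> N z\<bar> powr q)) \<in> borel_measurable borel"
      using borel_measurable_continuous_onI[OF continuous_lac_poly] by measurable
    then have "(\<integral>\<^sup>+z. ennreal (\<bar>lac_poly a \<theta> \<eta> N z\<bar> powr q) \<partial>torus)
      = (\<integral>\<^sup>+x. (\<integral>\<^sup>+y. ennreal (\<bar>lac_poly a \<theta> \<eta> N (x, y)\<bar> powr q) \<partial>circle) \<partial>circle)"
      by (rule nn_integral_torus)
    also have "\<dots> \<le> (\<integral>\<^sup>+x. ennreal (K * \<sigma> powr (k - 1)) * (\<Sum>\<nu><N. ennreal (s \<nu> powr (1 - k)) * ennreal (\<bar>F \<nu> x\<bar> powr q)) \<partial>circle)"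
    proof (intro nn_integral_mono)
      fix x
      have eq: "lac_poly a \<theta> \<eta> N (x, y) = (\<Sum>\<nu><N. F \<nu> x * cos (2^\<nu> * y + \<eta> \<nu>))" for y
        unfolding lac_poly_def F_def by (subst sum.swap) (simp add: sum_distrib_right mult.assoc)
      have Fz: "(F \<nu> x)\<^sup>2 = 0" if "s \<nu> = 0" for \<nu>
      proof -
        have "\<forall>\<mu><N. a \<mu> \<nu> = 0" using that unfolding s_def by (subst (asm) sum_nonneg_eq_0_iff) auto
        then show ?thesis by (simp add: F_def)
      qed
      have "(\<integral>\<^sup>+y. ennreal (\<bar>lac_poly a \<theta> \<eta> N (x, y)\<bar> powr q) \<partial>circle) \<le> ennreal (K * (\<Sum>\<nu><N. (F \<nu> x)\<^sup>2) powr k)"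
        unfolding eq using Kh[of "\<lambda>\<nu>. F \<nu> x" \<eta> N] by (simp add: k_def)
      also have "(\<Sum>\<nu><N. (F \<nu> x)\<^sup>2) powr k \<le> \<sigma> powr (k - 1) * (\<Sum>\<nu><N. s \<nu> powr (1 - k) * ((F \<nu> x)\<^sup>2) powr k)"
        unfolding \<sigma>_def by (rule powr_sum_le_weighted) (use k s0 Fz in auto)
      also have "\<dots> = \<sigma> powr (k - 1) * (\<Sum>\<nu><N. s \<nu> powr (1 - k) * \<bar>F \<nu> x\<bar> powr q)"
        by (simp add: sq)
      finally show "(\<integral>\<^sup>+y. ennreal (\<bar>lac_poly a \<theta> \<eta> N (x, y)\<bar> powr q) \<partial>circle) \<le>
         ennreal (K * \<sigma> powr (k - 1)) * (\<Sum>\<nu><N. ennreal (s \<nu> powr (1 - k)) * ennreal (\<bar>F \<nu> x\<bar> powr q))"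
        using K by (simp add: ennreal_mult[symmetric] sum_nonneg ennreal_leI mult_left_mono mult.assoc)
    qed
    also have "\<dots> = ennreal (K * \<sigma> powr (k - 1)) * (\<Sum>\<nu><N. ennreal (s \<nu> powr (1 - k)) * (\<integral>\<^sup>+x. ennreal (\<bar>F \<nu> x\<bar> powr q) \<partial>circle))"
      by (simp add: nn_integral_cmult nn_integral_sum)
    also have "\<dots> \<le> ennreal (K * \<sigma> powr (k - 1)) * (\<Sum>\<nu><N. ennreal (s \<nu> powr (1 - k)) * ennreal (K * s \<nu> powr k))"
      unfolding F_def using Kh[of "\<lambda>\<mu>. a \<mu> \<nu>" \<theta> N for \<nu>]
      by (intro mult_left_mono sum_mono) (auto simp: s_def k_def)
    also have "\<dots> = ennreal (K * \<sigma> powr (k - 1) * (\<Sum>\<nu><N. s \<nu> powr (1 - k) * (K * s \<nu> powr k)))"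
      using K by (simp add: ennreal_mult[symmetric] sum_nonneg)
    also have "(\<Sum>\<nu><N. s \<nu> powr (1 - k) * (K * s \<nu> powr k)) = K * \<sigma>"
      unfolding \<sigma>_def sum_distrib_left
    proof (intro sum.cong refl)
      fix \<nu> show "s \<nu> powr (1 - k) * (K * s \<nu> powr k) = K * s \<nu>"
        using s0[of \<nu>] by (cases "s \<nu> = 0") (auto simp: powr_diff)
    qed
    also have "K * \<sigma> powr (k - 1) * (K * \<sigma>) = K * K * \<sigma> powr k"
      using \<sigma>0 by (cases "\<sigma> = 0") (auto simp: powr_diff)
    also have "\<sigma> = (\<Sum>\<mu><N. \<Sum>\<nu><N. (a \<mu> \<nu>)\<^sup>2)"
      unfolding \<sigma>_def s_def by (rule sum.swap)
    finally show ?thesis by (simp add: k_def)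
  qed
  then show thesis using that[of "K * K"] K by auto
qed

lemma lacunary_Khintchine_torus:
  fixes q :: real assumes q: "0 < q"
  obtains K where "K > 0" "\<And>a \<theta> \<eta> N. (\<integral>\<^sup>+z. ennreal (\<bar>lac_poly a \<theta> \<eta> N z\<bar> powr q) \<partial>torus)
       \<le> ennreal (K * (\<Sum>\<mu><N. \<Sum>\<nu><N. (a \<mu> \<nu>)\<^sup>2) powr (q/2))"
proof -
  define r where "r = max q 2"
  have r: "2 \<le> r" "q \<le> r" by (auto simp: r_def)
  obtain K where K: "K > 0" and Kh: "\<And>a \<theta> \<eta> N. (\<integral>\<^sup>+z. ennreal (\<bar>lac_poly a \<theta> \<eta> N z\<bar> powr r) \<partial>torus)
       \<le> ennreal (K * (\<Sum>\<mu><N. \<Sum>\<nu><N. (a \<mu> \<nu>)\<^sup>2) powr (r/2))"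
    using lacunary_Khintchine_torus_ge2[OF r(1)] by blast
  have "(\<integral>\<^sup>+z. ennreal (\<bar>lac_poly a \<theta> \<eta> N z\<bar> powr q) \<partial>torus)
       \<le> ennreal ((4 * pi\<^sup>2 + K) * (\<Sum>\<mu><N. \<Sum>\<nu><N. (a \<mu> \<nu>)\<^sup>2) powr (q/2))" for a \<theta> \<eta> N
  proof -
    define \<sigma> where "\<sigma> = (\<Sum>\<mu><N. \<Sum>\<nu><N. (a \<mu> \<nu>)\<^sup>2)"
    have \<sigma>0: "0 \<le> \<sigma>" unfolding \<sigma>_def by (intro sum_nonneg) auto
    show ?thesis
    proof (cases "\<sigma> = 0")
      case True
      then have "\<forall>\<mu><N. \<forall>\<nu><N. a \<mu> \<nu> = 0"
        unfolding \<sigma>_def by (simp add: sum_nonneg_eq_0_iff sum_nonneg)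
      then show ?thesis by (simp add: lac_poly_def)
    next
      case False
      then have \<sigma>: "0 < \<sigma>" using \<sigma>0 by simp
      define e where "e \<mu> \<nu> = a \<mu> \<nu> / sqrt \<sigma>" for \<mu> \<nu>
      have e1: "(\<Sum>\<mu><N. \<Sum>\<nu><N. (e \<mu> \<nu>)\<^sup>2) = 1"
        using \<sigma> by (simp add: e_def power_divide flip: sum_divide_distrib) (simp add: \<sigma>_def)
      have [measurable]: "lac_poly e \<theta> \<eta> N \<in> borel_measurable torus"
        by (intro borel_measurable_torus borel_measurable_continuous_onI continuous_lac_poly)
      have "lac_poly a \<theta> \<eta> N z = sqrt \<sigma> * lac_poly e \<theta> \<eta> N z" for z
        using \<sigma> by (simp add: lac_poly_def e_def sum_distrib_left)
      then have eq: "\<bar>lac_poly a \<theta> \<eta> N z\<bar> powr q = \<sigma> powr (q/2) * \<bar>lac_poly e \<theta> \<eta> N z\<bar> powr q" for z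
        using \<sigma> by (simp add: abs_mult powr_mult powr_half_sqrt[symmetric] powr_powr)
      \<comment> \<open>After normalisation, a small exponent is dominated by the exponent \<open>r \<ge> 2\<close>.\<close>
      have le: "u powr q \<le> 1 + u powr r" if "0 \<le> u" for u :: real
      proof (cases "u \<le> 1")
        case True
        then have "u powr q \<le> 1" using powr_mono2[of q u 1] that q by simp
        then show ?thesis by (simp add: add_increasing2)
      next
        case False
        then have "u powr q \<le> u powr r" using r by (intro powr_mono) auto
        then show ?thesis by simp
      qed
      have "(\<integral>\<^sup>+z. ennreal (\<bar>lac_poly e \<theta> \<eta> N z\<bar> powr q) \<partial>torus)
          \<le> (\<integral>\<^sup>+z. 1 + ennreal (\<bar>lac_poly e \<theta> \<eta> N z\<bar> powr r) \<partial>torus)"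
        using le by (intro nn_integral_mono) (simp add: ennreal_leI flip: ennreal_1 ennreal_plus)
      also have "\<dots> = ennreal (4*pi\<^sup>2) + (\<integral>\<^sup>+z. ennreal (\<bar>lac_poly e \<theta> \<eta> N z\<bar> powr r) \<partial>torus)"
        by (subst nn_integral_add) (auto simp: emeasure_torus)
      also have "\<dots> \<le> ennreal (4*pi\<^sup>2) + ennreal K"
        using Kh[of e \<theta> \<eta> N] by (intro add_left_mono) (simp add: e1)
      finally have E: "(\<integral>\<^sup>+z. ennreal (\<bar>lac_poly e \<theta> \<eta> N z\<bar> powr q) \<partial>torus) \<le> ennreal (4*pi\<^sup>2 + K)"
        using K by simp
      have "(\<integral>\<^sup>+z. ennreal (\<bar>lac_poly a \<theta> \<eta> N z\<bar> powr q) \<partial>torus)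
        = ennreal (\<sigma> powr (q/2)) * (\<integral>\<^sup>+z. ennreal (\<bar>lac_poly e \<theta> \<eta> N z\<bar> powr q) \<partial>torus)"
        unfolding eq by (subst nn_integral_cmult[symmetric]) (auto simp: ennreal_mult)
      also have "\<dots> \<le> ennreal (\<sigma> powr (q/2)) * ennreal (4*pi\<^sup>2 + K)"
        by (intro mult_left_mono E) auto
      also have "\<dots> = ennreal ((4 * pi\<^sup>2 + K) * \<sigma> powr (q/2))"
        using K by (subst ennreal_mult[symmetric]) (auto simp: mult.commute)
      finally show ?thesis by (simp add: \<sigma>_def)
    qed
  qed
  then show thesis using that[of "4 * pi\<^sup>2 + K"] K by (auto simp: add_pos_pos)
qed

section \<open>Uniqueness of Fourier coefficients on the torus\<close>

text \<open>
  Real trigonometric polynomials in two variables.  Phases make sines superfluous, and the span is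
  closed under multiplication.
\<close>
inductive trig_poly :: "(real \<times> real \<Rightarrow> real) \<Rightarrow> bool" where
  base: "trig_poly (\<lambda>z. c * (cos (real m * fst z + s) * cos (real n * snd z + t)))"
| add: "trig_poly f \<Longrightarrow> trig_poly g \<Longrightarrow> trig_poly (\<lambda>z. f z + g z)"

lemma cos_frequency_diff:
  obtains k w' where "\<And>x. cos ((real m - real m') * x + w) = cos (real k * x + w')"
proof (cases "m' \<le> m")
  case True
  then show thesis by (intro that[of "m - m'" w]) (simp add: of_nat_diff)
next
  case False
  have "cos ((real m - real m') * x + w) = cos (real (m' - m) * x + (- w))" for x
    using False by (subst cos_minus[symmetric]) (simp add: of_nat_diff algebra_simps)
  then show thesis by (rule that)
qed

lemma trig_poly_mult:
  assumes "trig_poly f" "trig_poly g" shows "trig_poly (\<lambda>z. f z * g z)"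
  using assms(1)
proof induction
  case (add f1 f2)
  then show ?case by (simp add: distrib_right trig_poly.add)
next
  case (base c m s n t)
  from assms(2) show ?case
  proof induction
    case (add g1 g2)
    then show ?case by (simp add: distrib_left trig_poly.add)
  next
    case (base c' m' s' n' t')
    obtain k w where k: "\<And>x. cos ((real m - real m') * x + (s - s')) = cos (real k * x + w)"
      using cos_frequency_diff by blast
    obtain l v where l: "\<And>x. cos ((real n - real n') * x + (t - t')) = cos (real l * x + v)"
      using cos_frequency_diff by blast
    have prod: "cos (real a * x + u) * cos (real b * x + u')
      = (cos ((real a - real b) * x + (u - u')) + cos (real (a + b) * x + (u + u'))) / 2" for a b u u' x
      by (subst cos_times_cos) (simp add: algebra_simps)
    have "c * (cos (real m * fst z + s) * cos (real n * snd z + t)) *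
            (c' * (cos (real m' * fst z + s') * cos (real n' * snd z + t')))
        = c * c' * ((cos (real m * fst z + s) * cos (real m' * fst z + s')) * (cos (real n * snd z + t) * cos (real n' * snd z + t')))" for z
      by (simp add: mult_ac)
    also have "\<dots> z = c * c' / 4 * (cos (real k * fst z + w) * cos (real l * snd z + v))
      + c * c' / 4 * (cos (real k * fst z + w) * cos (real (n + n') * snd z + (t + t')))
      + c * c' / 4 * (cos (real (m + m') * fst z + (s + s')) * cos (real l * snd z + v))
      + c * c' / 4 * (cos (real (m + m') * fst z + (s + s')) * cos (real (n + n') * snd z + (t + t')))" for z
      unfolding prod k l by (simp add: field_simps)
    finally show ?case by (simp only:) (intro trig_poly.intros)
  qed
qed

text \<open>
  Polynomials on the plane pair \<open>(cis x, cis y)\<close> are trigonometric polynomials; this lets the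
  Stone--Weierstrass theorem on the product of two unit circles be used for periodic functions.
\<close>
lemma trig_poly_polynomial:
  assumes "real_polynomial_function (P :: complex \<times> complex \<Rightarrow> real)"
  shows "trig_poly (\<lambda>z. P (cis (fst z), cis (snd z)))"
  using assms
proof induction
  case (linear f)
  interpret f: bounded_linear f by fact
  have dec: "(cis x, cis y) = cos x *\<^sub>R (1, 0) + sin x *\<^sub>R (\<i>, 0) + cos y *\<^sub>R (0, 1) + sin y *\<^sub>R (0, \<i>)" for x y
    by (auto simp: complex_eq_iff)
  have s: "sin x = cos (real 1 * x + (- (pi/2)))" for x by (simp add: cos_diff)
  have "f (cis (fst z), cis (snd z)) =
      f (1, 0) * (cos (real 1 * fst z + 0) * cos (real 0 * snd z + 0))
    + f (\<i>, 0) * (cos (real 1 * fst z + (- (pi/2))) * cos (real 0 * snd z + 0))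
    + f (0, 1) * (cos (real 0 * fst z + 0) * cos (real 1 * snd z + 0))
    + f (0, \<i>) * (cos (real 0 * fst z + 0) * cos (real 1 * snd z + (- (pi/2))))" for z
    unfolding dec f.add f.scaleR s[symmetric] by simp
  then show ?case by (simp only:) (intro trig_poly.intros)
next
  case (const c)
  show ?case using trig_poly.base[of c 0 0 0 0] by simp
qed (auto intro: trig_poly.add trig_poly_mult)

lemma cis_eq_imp_eq:
  assumes "cis x = cis y" "0 \<le> x" "x \<le> 2 * pi" "0 < y" "y < 2 * pi" shows "x = y"
proof -
  have "cos (x - y) = (cos y)\<^sup>2 + (sin y)\<^sup>2"
    using assms(1) by (simp add: cos_diff complex_eq_iff power2_eq_square)
  then have "cos (x - y) = 1" by simp
  then obtain n :: int where n: "x - y = n * 2 * pi" by (auto simp: cos_one_2pi_int)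
  then have "x - y = real_of_int n * (2 * pi)" by simp
  then have "-1 * (2 * pi) < real_of_int n * (2 * pi)" "real_of_int n * (2 * pi) < 1 * (2 * pi)"
    using assms by linarith+
  from this[THEN mult_right_less_imp_less] have "-1 < real_of_int n" "real_of_int n < 1" by simp_all
  then have "n = 0" by linarith
  then show ?thesis using n by simp
qed

lemma integrable_torus_mult_bounded:
  assumes H: "integrable torus (H :: real \<times> real \<Rightarrow> real)" and f: "f \<in> borel_measurable borel"
    and B: "\<And>z. \<bar>f z\<bar> \<le> B"
  shows "integrable torus (\<lambda>z. H z * f z)"
proof -
  note [measurable] = borel_measurable_torus[OF f]
  have "0 \<le> B" using B[of undefined] by linarith
  then show ?thesis
    using H by (intro Bochner_Integration.integrable_bound[OF integrable_mult_left[OF H, of B]])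
     (auto intro!: AE_I2 mult_left_mono B simp: abs_mult)
qed

text \<open>
  An integrable function all of whose Fourier coefficients vanish.  The integral against it is shown to
  vanish for trigonometric polynomials, for continuous functions, for indicators of closed sets of
  the product of circles, and for indicators of compact sets inside the open square; inner
  regularity then forces the function to be nonpositive, hence (by symmetry) zero.
\<close>
locale torus_annihilator =
  fixes H :: "real \<times> real \<Rightarrow> real"
  assumes int: "integrable torus H"
    and zero: "\<And>m n s t. (\<integral>z. H z * (cos (real m * fst z + s) * cos (real n * snd z + t)) \<partial>torus) = 0"
begin

lemma trig_poly_integral:
  assumes "trig_poly f" shows "integrable torus (\<lambda>z. H z * f z) \<and> (\<integral>z. H z * f z \<partial>torus) = 0"
  using assms
proof induction
  case (base c m s n t)
  have "integrable torus (\<lambda>z. H z * (c * (cos (real m * fst z + s) * cos (real n * snd z + t))))"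
    by (rule integrable_torus_mult_bounded[OF int, where B="\<bar>c\<bar>"])
       (auto intro!: borel_measurable_continuous_onI continuous_intros
          simp: abs_mult mult_le_one intro!: mult_left_le)
  moreover have "(\<integral>z. H z * (c * (cos (real m * fst z + s) * cos (real n * snd z + t))) \<partial>torus) = 0"
    using zero[of m s n t] by (simp add: mult.left_commute[of _ c])
  ultimately show ?case by simp
qed (simp add: distrib_left)

lemma continuous_integral:
  assumes "continuous_on UNIV (\<psi> :: complex \<times> complex \<Rightarrow> real)"
  shows "(\<integral>z. H z * \<psi> (cis (fst z), cis (snd z)) \<partial>torus) = 0"
proof -
  let ?e = "\<lambda>z::real \<times> real. (cis (fst z), cis (snd z))"
  let ?S = "sphere 0 1 \<times> sphere 0 1 :: (complex \<times> complex) set"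
  have S: "compact ?S" by (intro compact_Times) auto
  have eS: "?e z \<in> ?S" for z by simp
  have conte: "continuous_on UNIV (\<lambda>z. \<psi> (?e z))"
    by (rule continuous_on_compose2[OF assms]) (auto intro!: continuous_intros)
  have small: "\<bar>\<integral>z. H z * \<psi> (?e z) \<partial>torus\<bar> \<le> \<epsilon> * (\<integral>z. \<bar>H z\<bar> \<partial>torus)" if \<epsilon>: "\<epsilon> > 0" for \<epsilon>
  proof -
    obtain P where P: "real_polynomial_function P" "\<And>w. w \<in> ?S \<Longrightarrow> \<bar>\<psi> w - P w\<bar> < \<epsilon>"
      using Stone_Weierstrass_real_polynomial_function[OF S continuous_on_subset[OF assms subset_UNIV] \<epsilon>] by auto
    note tp = trig_poly_integral[OF trig_poly_polynomial[OF P(1)]]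
    have contP: "continuous_on UNIV (\<lambda>z. P (?e z))"
      by (rule continuous_on_compose2[OF continuous_on_polymonial_function])
        (use P(1) in \<open>auto intro!: continuous_intros simp: real_polynomial_function_eq\<close>)
    have "integrable torus (\<lambda>z. H z * (\<psi> (?e z) - P (?e z)))"
    proof (rule integrable_torus_mult_bounded[OF int])
      show "(\<lambda>z. \<psi> (?e z) - P (?e z)) \<in> borel_measurable borel"
        by (intro borel_measurable_continuous_onI continuous_intros conte contP)
      show "\<bar>\<psi> (?e z) - P (?e z)\<bar> \<le> \<epsilon>" for z using P(2)[OF eS, of z] by simp
    qed
    note i1 = this
    have "(\<integral>z. H z * \<psi> (?e z) \<partial>torus) = (\<integral>z. H z * (\<psi> (?e z) - P (?e z)) + H z * P (?e z) \<partial>torus)"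
      by (simp add: algebra_simps)
    also have "\<dots> = (\<integral>z. H z * (\<psi> (?e z) - P (?e z)) \<partial>torus)"
      using i1 tp by simp
    finally have "\<bar>\<integral>z. H z * \<psi> (?e z) \<partial>torus\<bar> \<le> (\<integral>z. \<bar>H z * (\<psi> (?e z) - P (?e z))\<bar> \<partial>torus)"
      using integral_norm_bound[of torus "\<lambda>z. H z * (\<psi> (?e z) - P (?e z))"] by simp
    also have "\<dots> \<le> (\<integral>z. \<epsilon> * \<bar>H z\<bar> \<partial>torus)"
    proof (rule integral_mono)
      show "\<bar>H z * (\<psi> (?e z) - P (?e z))\<bar> \<le> \<epsilon> * \<bar>H z\<bar>" for z
        unfolding abs_mult using P(2)[OF eS, of z] by (subst mult.commute) (intro mult_right_mono, auto)
    qed (use int i1 in auto)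
    finally show ?thesis by simp
  qed
  have "\<bar>\<integral>z. H z * \<psi> (?e z) \<partial>torus\<bar> \<le> 0 + \<epsilon>" if "\<epsilon> > 0" for \<epsilon>
  proof -
    define I where "I = (\<integral>z. \<bar>H z\<bar> \<partial>torus)"
    have "0 \<le> I" unfolding I_def by simp
    then have "\<epsilon> / (I + 1) > 0" "\<epsilon> / (I + 1) * I \<le> \<epsilon>" using that by (auto simp: field_simps)
    then show ?thesis using small[of "\<epsilon> / (I + 1)"] unfolding I_def[symmetric] by linarith
  qed
  then show ?thesis using field_le_epsilon[of "\<bar>\<integral>z. H z * \<psi> (?e z) \<partial>torus\<bar>" 0] by simp
qed

lemma closed_integral:
  assumes F: "closed F" "F \<noteq> {}"
  shows "(\<integral>z. H z * indicator F (cis (fst z), cis (snd z)) \<partial>torus) = 0"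
proof -
  let ?e = "\<lambda>z::real \<times> real. (cis (fst z), cis (snd z))"
  \<comment> \<open>Continuous functions decreasing pointwise to the indicator of \<open>F\<close>.\<close>
  define \<psi> where "\<psi> k w = max 0 (1 - real k * infdist w F)" for k w
  have cont: "continuous_on UNIV (\<psi> k)" for k unfolding \<psi>_def by (intro continuous_intros)
  have lim: "(\<lambda>k. \<psi> k w) \<longlonglongrightarrow> indicator F w" for w
  proof (cases "w \<in> F")
    case True then show ?thesis by (simp add: \<psi>_def)
  next
    case False
    then have d: "0 < infdist w F" using F infdist_pos_not_in_closed by blast
    obtain k0 :: nat where k0: "1 / infdist w F < k0" using reals_Archimedean2 by blast
    have "\<psi> k w = 0" if "k \<ge> k0" for k
    proof -
      have "1 < real k0 * infdist w F" using k0 d by (simp add: divide_less_eq)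
      also have "\<dots> \<le> real k * infdist w F" using that d by (intro mult_right_mono) auto
      finally show ?thesis by (simp add: \<psi>_def)
    qed
    then have "eventually (\<lambda>k. \<psi> k w = indicator F w) sequentially"
      using False by (auto simp: eventually_sequentially)
    then show ?thesis by (simp add: tendsto_eventually)
  qed
  have m: "(\<lambda>z. \<psi> k (?e z)) \<in> borel_measurable borel" for k
    by (intro borel_measurable_continuous_onI continuous_on_compose2[OF cont]) (auto intro!: continuous_intros)
  have "(\<lambda>k. \<integral>z. H z * \<psi> k (?e z) \<partial>torus) \<longlonglongrightarrow> (\<integral>z. H z * indicator F (?e z) \<partial>torus)"
  proof (rule integral_dominated_convergence[where w="\<lambda>z. \<bar>H z\<bar>"])
    have [measurable]: "H \<in> borel_measurable torus" using int by auto
    have "?e \<in> borel_measurable borel" by (intro borel_measurable_continuous_onI continuous_intros)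
    then have "(\<lambda>z. indicator F (?e z) :: real) \<in> borel_measurable borel"
      by (rule measurable_compose) (use F in \<open>auto intro: borel_measurable_indicator\<close>)
    note [measurable] = borel_measurable_torus[OF this] borel_measurable_torus[OF m]
    show "(\<lambda>z. H z * indicator F (?e z)) \<in> borel_measurable torus"
      "\<And>k. (\<lambda>z. H z * \<psi> k (?e z)) \<in> borel_measurable torus" by measurable
    show "AE z in torus. (\<lambda>k. H z * \<psi> k (?e z)) \<longlonglongrightarrow> H z * indicator F (?e z)"
      by (intro AE_I2 tendsto_intros lim)
    have "\<bar>\<psi> k w\<bar> \<le> 1" for k w by (auto simp: \<psi>_def infdist_nonneg)
    then show "\<And>k. AE z in torus. norm (H z * \<psi> k (?e z)) \<le> \<bar>H z\<bar>"
      by (intro AE_I2) (simp add: abs_mult mult_left_le)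
  qed (use int in auto)
  then show ?thesis using continuous_integral[OF cont] by (simp add: LIMSEQ_const_iff)
qed

text \<open>
  Inside the open square the map \<open>z \<mapsto> (cis (fst z), cis (snd z))\<close> is injective, and no boundary point of
  the closed square shares its image with an interior point.  So the indicator of \<open>K\<close> is the
  pullback of the indicator of the compact image of \<open>K\<close>.
\<close>
lemma compact_integral:
  assumes K: "compact K" "K \<subseteq> box (0, 0) (2*pi, 2*pi)"
  shows "(\<integral>z. H z * indicator K z \<partial>torus) = 0"
proof (cases "K = {}")
  case False
  let ?e = "\<lambda>z::real \<times> real. (cis (fst z), cis (snd z))"
  have "compact (?e ` K)" by (intro compact_continuous_image K continuous_intros)
  then have "(\<integral>z. H z * indicator (?e ` K) (?e z) \<partial>torus) = 0"
    using False by (intro closed_integral) (auto intro: compact_imp_closed)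
  moreover have "indicator (?e ` K) (?e z) = (indicator K z :: real)" if "z \<in> space torus" for z
  proof -
    have "z = z'" if "z' \<in> K" "?e z = ?e z'" for z'
    proof -
      have "z' \<in> box (0, 0) (2*pi, 2*pi)" using K that by auto
      then show ?thesis using that(2) \<open>z \<in> space torus\<close> cis_eq_imp_eq[of "fst z" "fst z'"] cis_eq_imp_eq[of "snd z" "snd z'"]
        by (cases z; cases z') (auto simp: space_torus torus_square_def mem_box Basis_prod_def)
    qed
    then show ?thesis by (auto simp: indicator_def)
  qed
  ultimately show ?thesis by (simp cong: Bochner_Integration.integral_cong)
qed simp

lemma nonpos: "AE z in torus. H z \<le> 0"
proof -
  have Hm: "H \<in> borel_measurable torus" using int by auto
  define P where "P = {z \<in> box (0, 0) (2*pi, 2*pi). 0 < H z}"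
  have box_sub: "box (0, 0) (2*pi, 2*pi) \<subseteq> torus_square" unfolding torus_square_cbox by (rule box_subset_cbox)
  have "P = {z \<in> space torus. 0 < H z} \<inter> box (0, 0) (2*pi, 2*pi)" using box_sub by (auto simp: P_def space_torus)
  moreover have "{z \<in> space torus. 0 < H z} \<in> sets torus" using Hm by measurable
  then have "{z \<in> space torus. 0 < H z} \<in> sets lebesgue"
    unfolding torus_def by (subst (asm) sets_restrict_space_iff) auto
  ultimately have P: "P \<in> sets lebesgue" by auto
  have "emeasure lebesgue P \<le> 0 + ennreal e" if e: "0 < e" for e
  proof -
    obtain T where T: "closed T" "T \<subseteq> P" "emeasure lebesgue (P - T) < ennreal e"
      using sets_lebesgue_inner_closed[OF P e] by metis
    have Tb: "T \<subseteq> box (0, 0) (2*pi, 2*pi)" using T P_def by auto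
    then have Tc: "compact T" using T(1) bounded_subset[OF bounded_box] by (auto simp: compact_eq_bounded_closed)
    have Tm: "T \<in> sets lebesgue" using T(1) by auto
    have i: "integrable torus (\<lambda>z. H z * indicator T z)"
      by (rule integrable_torus_mult_bounded[OF int, where B=1]) (use T(1) in \<open>auto simp: indicator_le_1 intro: borel_measurable_indicator\<close>)
    have "AE z in torus. H z * indicator T z = 0"
      using compact_integral[OF Tc Tb] T(2)
      by (subst (asm) integral_nonneg_eq_0_iff_AE[OF i]) (auto simp: P_def indicator_def intro!: AE_I2)
    then have "AE z in lebesgue. z \<in> torus_square \<longrightarrow> H z * indicator T z = 0"
      unfolding torus_def by (subst (asm) AE_restrict_space_iff) auto
    then have "AE z in lebesgue. z \<notin> T"
      by eventually_elim (use T(2) box_sub in \<open>auto simp: P_def indicator_def split: if_splits\<close>)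
    then have "emeasure lebesgue T = 0"
      using Tm by (subst (asm) AE_iff_measurable[of T]) auto
    have "emeasure lebesgue P \<le> emeasure lebesgue T + emeasure lebesgue (P - T)"
      using emeasure_subadditive[of T lebesgue "P - T"] Tm P T(2) by (simp add: Un_absorb1)
    then show ?thesis using T(3) \<open>emeasure lebesgue T = 0\<close> by simp
  qed
  then have "emeasure lebesgue P \<le> 0" by (rule ennreal_le_epsilon)
  then have "P \<in> null_sets lebesgue" using P by auto
  moreover have "torus_square - box (0, 0) (2*pi, 2*pi) \<in> null_sets lebesgue"
    unfolding torus_square_cbox using negligible_frontier_interval by (simp add: negligible_iff_null_sets)
  ultimately have "AE z in lebesgue. z \<notin> P \<and> z \<notin> torus_square - box (0, 0) (2*pi, 2*pi)"
    by (intro AE_conjI AE_not_in)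
  then have "AE z in lebesgue. z \<in> torus_square \<longrightarrow> H z \<le> 0"
    by eventually_elim (auto simp: P_def)
  then show ?thesis unfolding torus_def by (subst AE_restrict_space_iff) auto
qed

end

theorem torus_Fourier_uniqueness:
  fixes H :: "real \<times> real \<Rightarrow> real"
  assumes "integrable torus H"
    and "\<And>m n s t. (\<integral>z. H z * (cos (real m * fst z + s) * cos (real n * snd z + t)) \<partial>torus) = 0"
  shows "AE z in torus. H z = 0"
proof -
  interpret H: torus_annihilator H by standard (use assms in auto)
  interpret M: torus_annihilator "\<lambda>z. - H z" by standard (use assms in auto)
  show ?thesis using H.nonpos M.nonpos by eventually_elim auto
qed

section \<open>Translation invariance and sums of translates\<close>

lemma lebesgue_translation:
  fixes v :: "'a::euclidean_space"
  shows "(\<lambda>z. z + v) \<in> lebesgue \<rightarrow>\<^sub>M lebesgue" and "distr lebesgue lebesgue (\<lambda>z. z + v) = lebesgue"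
proof -
  have T: "(\<lambda>x. v + (\<Sum>j\<in>Basis. (1 * (x \<bullet> j)) *\<^sub>R j)) = (\<lambda>z::'a. z + v)"
    by (auto simp: euclidean_representation add.commute)
  show "(\<lambda>z. z + v) \<in> lebesgue \<rightarrow>\<^sub>M lebesgue"
    using lebesgue_affine_measurable[of "\<lambda>_. 1" v] unfolding T by simp
  show "distr lebesgue lebesgue (\<lambda>z. z + v) = lebesgue"
    using lebesgue_affine_euclidean[of "\<lambda>_. 1" v] unfolding T by (simp add: density_1)
qed

lemma nn_integral_lebesgue_translation:
  fixes v :: "'a::euclidean_space"
  assumes "G \<in> borel_measurable lebesgue"
  shows "(\<integral>\<^sup>+z. G (z + v) \<partial>lebesgue) = (\<integral>\<^sup>+z. G z \<partial>lebesgue)"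
  using nn_integral_distr[OF lebesgue_translation(1)[of v], of G] assms
  by (simp add: lebesgue_translation(2))

text \<open>
  Period \<open>2 \<pi>\<close> in each variable.
\<close>
definition biperiodic :: "(real \<times> real \<Rightarrow> 'a) \<Rightarrow> bool" where
  "biperiodic f \<longleftrightarrow> (\<forall>x y. f (x + 2*pi, y) = f (x, y) \<and> f (x, y + 2*pi) = f (x, y))"

text \<open>
  The element of the period lattice with integer coordinates \<open>k\<close>.
\<close>
definition period :: "int \<times> int \<Rightarrow> real \<times> real" where
  "period k = (real_of_int (fst k) * (2*pi), real_of_int (snd k) * (2*pi))"

lemma biperiodic_period:
  assumes "biperiodic f" shows "f (z + period k) = f z"
proof -
  have 1: "f (x + of_int i * (2*pi), y) = f (x, y)" for x y i
  proof (induction i rule: int_induct[where k=0])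
    case (step1 i)
    then show ?case using assms[unfolded biperiodic_def, rule_format, of "x + of_int i * (2*pi)" y]
      by (simp add: algebra_simps)
  next
    case (step2 i)
    then show ?case using assms[unfolded biperiodic_def, rule_format, of "x + of_int (i - 1) * (2*pi)" y]
      by (simp add: algebra_simps)
  qed simp
  have 2: "f (x, y + of_int i * (2*pi)) = f (x, y)" for x y i
  proof (induction i rule: int_induct[where k=0])
    case (step1 i)
    then show ?case using assms[unfolded biperiodic_def, rule_format, of x "y + of_int i * (2*pi)"]
      by (simp add: algebra_simps)
  next
    case (step2 i)
    then show ?case using assms[unfolded biperiodic_def, rule_format, of x "y + of_int (i - 1) * (2*pi)"]
      by (simp add: algebra_simps)
  qed simp
  show ?thesis by (cases z) (simp add: period_def 1 2)
qed

text \<open>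
  The half-open square: its lattice translates tile the plane without overlap, while it differs from
  the closed square by a null set.
\<close>
definition cell :: "(real \<times> real) set" where
  "cell = {0..<2*pi} \<times> {0..<2*pi}"

text \<open>
  The integer coordinates are determined by the floors of the coordinates of \<open>u / (2 \<pi>)\<close>.
\<close>
lemma cell_tiling: "\<exists>!k. u + period k \<in> cell"
proof -
  have one: "\<exists>!i::int. 0 \<le> x + of_int i * (2*pi) \<and> x + of_int i * (2*pi) < 2*pi" for x :: real
  proof -
    have "(0 \<le> x + of_int i * (2*pi) \<and> x + of_int i * (2*pi) < 2*pi) \<longleftrightarrow> i = - \<lfloor>x / (2*pi)\<rfloor>" for i :: int
    proof -
      have "(0 \<le> x + of_int i * (2*pi) \<and> x + of_int i * (2*pi) < 2*pi)
         \<longleftrightarrow> of_int (- i) \<le> x / (2*pi) \<and> x / (2*pi) < of_int (- i) + 1"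
        by (simp add: field_simps) linarith
      also have "\<dots> \<longleftrightarrow> \<lfloor>x / (2*pi)\<rfloor> = - i" using floor_eq_iff[of "x / (2*pi)" "- i"] by simp
      finally show ?thesis by auto
    qed
    then show ?thesis by auto
  qed
  from one[of "fst u"] one[of "snd u"] obtain i j where
    i: "0 \<le> fst u + of_int i * (2*pi) \<and> fst u + of_int i * (2*pi) < 2*pi" and
    j: "0 \<le> snd u + of_int j * (2*pi) \<and> snd u + of_int j * (2*pi) < 2*pi" by auto
  show ?thesis
  proof (rule ex1I[of _ "(i, j)"])
    show "u + period (i, j) \<in> cell" using i j by (cases u) (auto simp: cell_def period_def)
    fix k assume "u + period k \<in> cell"
    then show "k = (i, j)" using i j one[of "fst u"] one[of "snd u"]
      by (cases u; cases k) (auto simp: cell_def period_def)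
  qed
qed

lemma cell_sets [measurable]: "cell \<in> sets borel" "cell \<in> sets lebesgue"
proof -
  show "cell \<in> sets borel" by (auto simp: cell_def intro!: borel_Times)
  then show "cell \<in> sets lebesgue" using sets_completionI_sets[of cell lborel] by simp
qed

lemma AE_torus_square_cell: "AE z in lebesgue. z \<in> torus_square \<longleftrightarrow> z \<in> cell"
proof -
  have "torus_square - box (0, 0) (2*pi, 2*pi) \<in> null_sets lebesgue"
    unfolding torus_square_cbox using negligible_frontier_interval by (simp add: negligible_iff_null_sets)
  from AE_not_in[OF this] show ?thesis
  proof eventually_elim
    case (elim z)
    then show ?case
      by (cases z) (auto simp: cell_def torus_square_def mem_box Basis_prod_def)
  qed
qed

lemma nn_integral_torus_cell:
  "(\<integral>\<^sup>+z. F z \<partial>torus) = (\<integral>\<^sup>+z. F z * indicator cell z \<partial>lebesgue)"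
proof -
  have "(\<integral>\<^sup>+z. F z \<partial>torus) = (\<integral>\<^sup>+z. F z * indicator torus_square z \<partial>lebesgue)"
    unfolding torus_def by (subst nn_integral_restrict_space) auto
  also have "\<dots> = (\<integral>\<^sup>+z. F z * indicator cell z \<partial>lebesgue)"
    by (rule nn_integral_cong_AE) (use AE_torus_square_cell in eventually_elim, simp add: indicator_def)
  finally show ?thesis .
qed

text \<open>
  Unfolding: the integrand is cut into pieces by the lattice translates of the cell, each piece is moved back
  by its period, and the pieces reassemble to the integral over one cell.
\<close>
lemma nn_integral_torus_translation:
  fixes F :: "real \<times> real \<Rightarrow> ennreal"
  assumes F: "F \<in> borel_measurable lebesgue" and per: "biperiodic F"
  shows "(\<integral>\<^sup>+z. F (z + v) \<partial>torus) = (\<integral>\<^sup>+z. F z \<partial>torus)"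
proof -
  have tile: "(\<integral>\<^sup>+k. indicator cell (u + period k) \<partial>count_space UNIV) = 1" for u
  proof -
    obtain k0 where "\<And>k. u + period k \<in> cell \<longleftrightarrow> k = k0" using cell_tiling by metis
    then have "(\<integral>\<^sup>+k. indicator cell (u + period k) \<partial>count_space UNIV) = (\<integral>\<^sup>+k. indicator {k0} k \<partial>count_space UNIV)"
      by (intro nn_integral_cong) (auto simp: indicator_def)
    then show ?thesis by simp
  qed
  note [measurable] = F
  have tr [measurable]: "(\<lambda>z. z + w) \<in> lebesgue \<rightarrow>\<^sub>M lebesgue" for w :: "real \<times> real"
    by (rule lebesgue_translation)
  have ind [measurable]: "(\<lambda>z. indicator cell (z + w) :: ennreal) \<in> borel_measurable lebesgue" for w :: "real \<times> real"
    by (rule measurable_compose[OF tr]) (auto intro: borel_measurable_indicator)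
  have "(\<integral>\<^sup>+z. F (z + v) \<partial>torus) = (\<integral>\<^sup>+z. F (z + v) * indicator cell ((z + v) + (- v)) \<partial>lebesgue)"
    by (simp add: nn_integral_torus_cell)
  also have "\<dots> = (\<integral>\<^sup>+z. F z * indicator cell (z + (- v)) \<partial>lebesgue)"
    by (rule nn_integral_lebesgue_translation[where G="\<lambda>z. F z * indicator cell (z + (- v))"]) measurable
  also have "\<dots> = (\<integral>\<^sup>+z. (\<integral>\<^sup>+k. F z * indicator cell (z + (- v)) * indicator cell (z + period k) \<partial>count_space UNIV) \<partial>lebesgue)"
    by (simp add: nn_integral_cmult tile)
  also have "\<dots> = (\<integral>\<^sup>+k. (\<integral>\<^sup>+z. F z * indicator cell (z + (- v)) * indicator cell (z + period k) \<partial>lebesgue) \<partial>count_space UNIV)"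
  proof (rule nn_integral_count_space_nn_integral)
    fix k show "(\<lambda>z. F z * indicator cell (z + (- v)) * indicator cell (z + period k)) \<in> borel_measurable lebesgue"
      by measurable
  qed auto
  also have "\<dots> = (\<integral>\<^sup>+k. (\<integral>\<^sup>+z. F z * indicator cell z * indicator cell (z + (- v) + period (- k)) \<partial>lebesgue) \<partial>count_space UNIV)"
  proof (rule nn_integral_cong)
    fix k :: "int \<times> int"
    have pk: "period (- k) = - period k" by (simp add: period_def)
    have "(\<integral>\<^sup>+z. F z * indicator cell z * indicator cell (z + ((- v) + period (- k))) \<partial>lebesgue)
      = (\<integral>\<^sup>+z. F (z + period k) * indicator cell (z + period k) * indicator cell (z + period k + ((- v) + period (- k))) \<partial>lebesgue)"
      by (rule nn_integral_lebesgue_translation[symmetric, where G="\<lambda>z. F z * indicator cell z * indicator cell (z + ((- v) + period (- k)))"])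
        measurable
    then show "(\<integral>\<^sup>+z. F z * indicator cell (z + (- v)) * indicator cell (z + period k) \<partial>lebesgue)
      = (\<integral>\<^sup>+z. F z * indicator cell z * indicator cell (z + (- v) + period (- k)) \<partial>lebesgue)"
      by (simp add: biperiodic_period[OF per] pk algebra_simps)
  qed
  also have "\<dots> = (\<integral>\<^sup>+k. (\<integral>\<^sup>+z. F z * indicator cell z * indicator cell (z + (- v) + period k) \<partial>lebesgue) \<partial>count_space UNIV)"
  proof -
    have "bij_betw uminus (UNIV :: (int \<times> int) set) UNIV" by (rule bij_betw_byWitness[where f'=uminus]) auto
    then show ?thesis by (rule nn_integral_bij_count_space)
  qed
  also have "\<dots> = (\<integral>\<^sup>+z. (\<integral>\<^sup>+k. F z * indicator cell z * indicator cell (z + (- v) + period k) \<partial>count_space UNIV) \<partial>lebesgue)"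
  proof (rule nn_integral_count_space_nn_integral[symmetric])
    fix k show "(\<lambda>z. F z * indicator cell z * indicator cell (z + (- v) + period k)) \<in> borel_measurable lebesgue"
      using ind[of "- v + period k"] unfolding add.assoc by measurable
  qed auto
  also have "\<dots> = (\<integral>\<^sup>+z. F z * indicator cell z \<partial>lebesgue)"
    by (simp add: nn_integral_cmult tile)
  finally show ?thesis by (simp add: nn_integral_torus_cell)
qed

lemma integral_torus_translation:
  fixes F :: "real \<times> real \<Rightarrow> real"
  assumes F: "F \<in> borel_measurable lebesgue" and per: "biperiodic F"
  shows "integrable torus (\<lambda>z. F (z + v)) \<longleftrightarrow> integrable torus F"
    and "(\<integral>z. F (z + v) \<partial>torus) = (\<integral>z. F z \<partial>torus)"
    and "(\<lambda>z. F (z + v)) \<in> borel_measurable lebesgue"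
proof -
  show Fv: "(\<lambda>z. F (z + v)) \<in> borel_measurable lebesgue"
    by (rule measurable_compose[OF lebesgue_translation(1) F])
  note [measurable] = F Fv measurable_torus[OF F] measurable_torus[OF Fv]
  have nn: "(\<integral>\<^sup>+z. ennreal (h (F (z + v))) \<partial>torus) = (\<integral>\<^sup>+z. ennreal (h (F z)) \<partial>torus)"
    if [measurable]: "h \<in> borel_measurable borel" for h
    by (rule nn_integral_torus_translation) (use per in \<open>auto simp: biperiodic_def\<close>)
  show int: "integrable torus (\<lambda>z. F (z + v)) \<longleftrightarrow> integrable torus F"
    using nn[of norm] by (simp add: integrable_iff_bounded)
  show "(\<integral>z. F (z + v) \<partial>torus) = (\<integral>z. F z \<partial>torus)"
  proof (cases "integrable torus F")
    case True
    then show ?thesis using int nn[of "\<lambda>x. x"] nn[of uminus] by (simp add: real_lebesgue_integral_def)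
  next
    case False
    then show ?thesis using int by (simp add: not_integrable_integral_eq)
  qed
qed

text \<open>
  The pointwise series \<open>\<Sum>j. b j * f (z + v j)\<close> of translates, with value the default of the infinite sum
  where the series diverges.  Fractional differences in either variable are of this form.
\<close>
definition shift_series :: "(nat \<Rightarrow> real) \<Rightarrow> (nat \<Rightarrow> real \<times> real) \<Rightarrow> (real \<times> real \<Rightarrow> real) \<Rightarrow> real \<times> real \<Rightarrow> real" where
  "shift_series b v f z = (\<Sum>j. b j * f (z + v j))"

text \<open>
  For absolutely summable coefficients and integrable periodic \<open>f\<close> the series converges absolutely
  almost everywhere, and may be integrated term by term against bounded periodic functions.
\<close>
locale absolutely_summable_translates =
  fixes b :: "nat \<Rightarrow> real" and v :: "nat \<Rightarrow> real \<times> real" and f :: "real \<times> real \<Rightarrow> real"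
  assumes b: "summable (\<lambda>j. \<bar>b j\<bar>)" and f: "f \<in> borel_measurable lebesgue" "biperiodic f" "integrable torus f"
begin

lemma shift_measurable: "shift_series b v f \<in> borel_measurable lebesgue"
proof -
  have [measurable]: "(\<lambda>z. f (z + v j)) \<in> borel_measurable lebesgue" for j
    by (rule integral_torus_translation[OF f(1,2)])
  show ?thesis unfolding shift_series_def[abs_def] by measurable
qed

lemma shift_biperiodic: "biperiodic (shift_series b v f)"
proof -
  have "f (z + v j + (2*pi, 0)) = f (z + v j)" "f (z + v j + (0, 2*pi)) = f (z + v j)" for z j
    using f(2) by (cases "z + v j", simp add: biperiodic_def)+
  then have "f (z + (2*pi, 0) + v j) = f (z + v j)" "f (z + (0, 2*pi) + v j) = f (z + v j)" for z j
    by (metis add.commute add.left_commute)+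
  then show ?thesis unfolding biperiodic_def shift_series_def
    by (metis (no_types, lifting) add_Pair add.right_neutral suminf_cong)
qed

lemma shift_integral:
  assumes \<phi>: "\<phi> \<in> borel_measurable borel" "\<And>z. \<bar>\<phi> z\<bar> \<le> 1" "biperiodic \<phi>"
  shows "integrable torus (\<lambda>z. shift_series b v f z * \<phi> z)"
    and "(\<lambda>j. b j * (\<integral>z. f z * \<phi> (z - v j) \<partial>torus)) sums (\<integral>z. shift_series b v f z * \<phi> z \<partial>torus)"
proof -
  have fv: "(\<lambda>z. f (z + v j)) \<in> borel_measurable lebesgue" "integrable torus (\<lambda>z. f (z + v j))"
     "(\<integral>z. \<bar>f (z + v j)\<bar> \<partial>torus) = (\<integral>z. \<bar>f z\<bar> \<partial>torus)" for j
  proof -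
    show "(\<lambda>z. f (z + v j)) \<in> borel_measurable lebesgue" "integrable torus (\<lambda>z. f (z + v j))"
      using integral_torus_translation[OF f(1,2), of "v j"] f(3) by auto
    show "(\<integral>z. \<bar>f (z + v j)\<bar> \<partial>torus) = (\<integral>z. \<bar>f z\<bar> \<partial>torus)"
      by (rule integral_torus_translation) (use f in \<open>auto simp: biperiodic_def\<close>)
  qed
  note [measurable] = measurable_torus[OF fv(1)] borel_measurable_torus[OF \<phi>(1)] measurable_torus[OF f(1)]
      measurable_torus[OF shift_measurable]
  have gj: "integrable torus (\<lambda>z. b j * f (z + v j))" for j
    by (intro integrable_mult_right fv)
  have ae: "AE z in torus. summable (\<lambda>j. \<bar>b j * f (z + v j)\<bar>)"
  proof -
    have "(\<integral>\<^sup>+z. (\<Sum>j. ennreal \<bar>b j * f (z + v j)\<bar>) \<partial>torus) = (\<Sum>j. (\<integral>\<^sup>+z. ennreal \<bar>b j * f (z + v j)\<bar> \<partial>torus))"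
      by (rule nn_integral_suminf) measurable
    also have "\<dots> = (\<Sum>j. ennreal (\<bar>b j\<bar> * (\<integral>z. \<bar>f z\<bar> \<partial>torus)))"
    proof (rule suminf_cong)
      fix j
      show "(\<integral>\<^sup>+z. ennreal \<bar>b j * f (z + v j)\<bar> \<partial>torus) = ennreal (\<bar>b j\<bar> * (\<integral>z. \<bar>f z\<bar> \<partial>torus))"
        using gj[of j] by (subst nn_integral_eq_integral) (auto simp: abs_mult fv(3))
    qed
    also have "\<dots> = ennreal (\<Sum>j. \<bar>b j\<bar> * (\<integral>z. \<bar>f z\<bar> \<partial>torus))"
      by (intro suminf_ennreal2 summable_mult2 b) auto
    finally have "(\<integral>\<^sup>+z. (\<Sum>j. ennreal \<bar>b j * f (z + v j)\<bar>) \<partial>torus) \<noteq> \<infinity>" by simp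
    then have "AE z in torus. (\<Sum>j. ennreal \<bar>b j * f (z + v j)\<bar>) \<noteq> \<infinity>"
      by (intro nn_integral_PInf_AE) measurable
    then show ?thesis
      by eventually_elim (auto intro!: summable_suminf_not_top)
  qed
  have gp: "integrable torus (\<lambda>z. b j * f (z + v j) * \<phi> z)" for j
    by (rule integrable_torus_mult_bounded[OF gj \<phi>(1,2)])
  have ae2: "AE z in torus. summable (\<lambda>j. norm (b j * f (z + v j) * \<phi> z))"
    using ae
  proof eventually_elim
    case (elim z)
    then have "summable (\<lambda>j. \<bar>b j * f (z + v j)\<bar> * \<bar>\<phi> z\<bar>)" by (rule summable_mult2)
    then show ?case by (simp add: abs_mult)
  qed
  have sm: "summable (\<lambda>j. \<integral>z. norm (b j * f (z + v j) * \<phi> z) \<partial>torus)"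
  proof (rule summable_comparison_test'[where N=0])
    show "summable (\<lambda>j. \<bar>b j\<bar> * (\<integral>z. \<bar>f z\<bar> \<partial>torus))" by (intro summable_mult2 b)
    fix j
    have "(\<integral>z. norm (b j * f (z + v j) * \<phi> z) \<partial>torus) \<le> (\<integral>z. \<bar>b j\<bar> * \<bar>f (z + v j)\<bar> \<partial>torus)"
      using fv(2)[of j] \<phi>(2)
      by (intro integral_mono[OF integrable_norm[OF gp]]) (auto simp: abs_mult mult_left_le)
    then show "norm (\<integral>z. norm (b j * f (z + v j) * \<phi> z) \<partial>torus) \<le> \<bar>b j\<bar> * (\<integral>z. \<bar>f z\<bar> \<partial>torus)"
      using fv(2)[of j] by (simp add: fv(3))
  qed
  have eq: "AE z in torus. (\<Sum>j. b j * f (z + v j) * \<phi> z) = shift_series b v f z * \<phi> z"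
    using ae by eventually_elim (auto simp: shift_series_def intro!: suminf_mult2[symmetric] summable_rabs_cancel)
  have "integrable torus (\<lambda>z. \<Sum>j. b j * f (z + v j) * \<phi> z)"
    by (rule integrable_suminf[OF gp ae2 sm])
  moreover have "(\<lambda>z. \<Sum>j. b j * f (z + v j) * \<phi> z) \<in> borel_measurable torus"
     "(\<lambda>z. shift_series b v f z * \<phi> z) \<in> borel_measurable torus" by measurable
  ultimately show "integrable torus (\<lambda>z. shift_series b v f z * \<phi> z)"
    using integrable_cong_AE[OF _ _ eq] by blast
  have "(\<lambda>j. \<integral>z. b j * f (z + v j) * \<phi> z \<partial>torus) sums (\<integral>z. (\<Sum>j. b j * f (z + v j) * \<phi> z) \<partial>torus)"
    by (rule sums_integral[OF gp ae2 sm])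
  also have "(\<integral>z. (\<Sum>j. b j * f (z + v j) * \<phi> z) \<partial>torus) = (\<integral>z. shift_series b v f z * \<phi> z \<partial>torus)"
    by (rule integral_cong_AE[OF _ _ eq]) measurable
  also have "(\<lambda>j. \<integral>z. b j * f (z + v j) * \<phi> z \<partial>torus) = (\<lambda>j. b j * (\<integral>z. f z * \<phi> (z - v j) \<partial>torus))"
  proof
    fix j
    have "(\<lambda>z. \<phi> (z - v j)) \<in> borel_measurable lebesgue"
      using measurable_compose[OF lebesgue_translation(1)[of "- v j"], of \<phi> borel] \<phi>(1)
      by (simp add: measurable_completion)
    then have m: "(\<lambda>z. f z * \<phi> (z - v j)) \<in> borel_measurable lebesgue" using f(1) by measurable
    have "\<phi> (x + 2*pi - c, y) = \<phi> (x - c, y)" "\<phi> (x, y + 2*pi - c) = \<phi> (x, y - c)" for x y c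
      using \<phi>(3)[unfolded biperiodic_def, rule_format, of "x - c" y] \<phi>(3)[unfolded biperiodic_def, rule_format, of x "y - c"]
      by (simp_all add: algebra_simps)
    then have "biperiodic (\<lambda>z. \<phi> (z - v j))" by (cases "v j") (simp add: biperiodic_def)
    then have "biperiodic (\<lambda>z. f z * \<phi> (z - v j))" using f(2) by (simp add: biperiodic_def)
    from integral_torus_translation(2)[OF m this, of "v j"]
    show "(\<integral>z. b j * f (z + v j) * \<phi> z \<partial>torus) = b j * (\<integral>z. f z * \<phi> (z - v j) \<partial>torus)"
      by (simp add: mult.assoc)
  qed
  finally show "(\<lambda>j. b j * (\<integral>z. f z * \<phi> (z - v j) \<partial>torus)) sums (\<integral>z. shift_series b v f z * \<phi> z \<partial>torus)" .
qed

lemma shift_integrable: "integrable torus (shift_series b v f)"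
  using shift_integral(1)[of "\<lambda>_. 1"] by (simp add: biperiodic_def)

text \<open>
  Fourier coefficients of a sum of translates: each translation becomes a change of phase.
\<close>
lemma shift_coefficient:
  "(\<lambda>j. b j * (\<integral>z. f z * (cos (real m * fst z + (s - real m * fst (v j))) * cos (real n * snd z + (t - real n * snd (v j)))) \<partial>torus))
     sums (\<integral>z. shift_series b v f z * (cos (real m * fst z + s) * cos (real n * snd z + t)) \<partial>torus)"
proof -
  have per: "cos (real k * (x + 2*pi) + u) = cos (real k * x + u)" for k x u
    using sin_npi[of "2*k"] cos_npi[of "2*k"]
    by (simp add: distrib_left add.commute add.left_commute cos_add mult_ac sin_add)
  have "(\<lambda>j. b j * (\<integral>z. f z * (cos (real m * fst (z - v j) + s) * cos (real n * snd (z - v j) + t)) \<partial>torus))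
     sums (\<integral>z. shift_series b v f z * (cos (real m * fst z + s) * cos (real n * snd z + t)) \<partial>torus)"
    by (rule shift_integral(2))
      (auto intro!: borel_measurable_continuous_onI continuous_intros simp: biperiodic_def per abs_mult mult_le_one)
  then show ?thesis by (simp add: algebra_simps)
qed

end

section \<open>Norms of lacunary series\<close>

text \<open>
  The Fourier series of \<open>G\<close> is \<open>\<Sum>\<mu> \<nu>. a \<mu> \<nu> cos (2^\<mu> x + \<theta> \<mu>) cos (2^\<nu> y + \<eta> \<nu>)\<close>, expressed through the
  integrals of \<open>G\<close> against all products of shifted cosines.  Using arbitrary shifts \<open>s\<close>, \<open>t\<close> treats sines
  and cosines together; frequencies that are not powers of two, zero included, do not occur.
\<close>
definition phase_series :: "(real \<times> real \<Rightarrow> real) \<Rightarrow> (nat \<Rightarrow> nat \<Rightarrow> real) \<Rightarrow> (nat \<Rightarrow> real) \<Rightarrow> (nat \<Rightarrow> real) \<Rightarrow> bool" where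
  "phase_series G a \<theta> \<eta> \<longleftrightarrow>
    (\<forall>\<mu> \<nu> s t. (\<integral>z. G z * (cos (real (2^\<mu>) * fst z + s) * cos (real (2^\<nu>) * snd z + t)) \<partial>torus)
        = pi\<^sup>2 * a \<mu> \<nu> * (cos (s - \<theta> \<mu>) * cos (t - \<eta> \<nu>))) \<and>
    (\<forall>m n s t. \<not> (m \<in> range (\<lambda>\<mu>. 2^\<mu>) \<and> n \<in> range (\<lambda>\<nu>. 2^\<nu>)) \<longrightarrow>
        (\<integral>z. G z * (cos (real m * fst z + s) * cos (real n * snd z + t)) \<partial>torus) = 0)"

lemma integral_circle_cos_cos:
  assumes "0 < k"
  shows "(\<integral>x. cos (real k * x + u) * cos (real m * x + s) \<partial>circle) = (if m = k then pi * cos (s - u) else 0)"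
proof -
  have "cos (real k * x + u) * cos (real m * x + s) =
    cos (real (if m \<le> k then k - m else m - k) * x + (if m \<le> k then u - s else s - u)) / 2 + cos (real (k + m) * x + (u + s)) / 2" for x
  proof (cases "m \<le> k")
    case True
    then show ?thesis by (subst cos_times_cos) (simp add: of_nat_diff algebra_simps add_divide_distrib)
  next
    case False
    then show ?thesis by (subst mult.commute, subst cos_times_cos) (simp add: of_nat_diff algebra_simps add_divide_distrib)
  qed
  moreover have "integrable circle (\<lambda>x. cos (real j * x + w) / 2)" for j w
    by (intro integrable_circle continuous_intros) auto
  ultimately have "(\<integral>x. cos (real k * x + u) * cos (real m * x + s) \<partial>circle)
     = (\<integral>x. cos (real (if m \<le> k then k - m else m - k) * x + (if m \<le> k then u - s else s - u)) \<partial>circle) / 2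
       + (\<integral>x. cos (real (k + m) * x + (u + s)) \<partial>circle) / 2"
    by (simp del: of_nat_add)
  then show ?thesis using assms cos_minus[of "u - s"]
    unfolding integral_circle_cos by (auto simp del: cos_minus split: if_splits)
qed

lemma integral_lac_poly:
  "(\<integral>z. lac_poly a \<theta> \<eta> M z * (cos (real m * fst z + s) * cos (real n * snd z + t)) \<partial>torus)
    = (\<Sum>\<mu><M. \<Sum>\<nu><M. a \<mu> \<nu> * ((if m = 2^\<mu> then pi * cos (s - \<theta> \<mu>) else 0) * (if n = 2^\<nu> then pi * cos (t - \<eta> \<nu>) else 0)))"
proof -
  let ?T = "\<lambda>\<mu> \<nu> z. (cos (real (2^\<mu>) * fst z + \<theta> \<mu>) * cos (real m * fst z + s)) * (cos (real (2^\<nu>) * snd z + \<eta> \<nu>) * cos (real n * snd z + t))"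
  have "lac_poly a \<theta> \<eta> M z * (cos (real m * fst z + s) * cos (real n * snd z + t)) = (\<Sum>\<mu><M. \<Sum>\<nu><M. a \<mu> \<nu> * ?T \<mu> \<nu> z)" for z
    unfolding lac_poly_def sum_distrib_right by (intro sum.cong refl) (simp add: mult_ac)
  moreover have "integrable torus (\<lambda>z. a \<mu> \<nu> * ?T \<mu> \<nu> z)" for \<mu> \<nu>
    by (intro integrable_torus continuous_intros)
  moreover have "(\<integral>z. ?T \<mu> \<nu> z \<partial>torus) = (if m = 2^\<mu> then pi * cos (s - \<theta> \<mu>) else 0) * (if n = 2^\<nu> then pi * cos (t - \<eta> \<nu>) else 0)" for \<mu> \<nu>
  proof -
    have "(\<integral>z. ?T \<mu> \<nu> z \<partial>torus) = (\<integral>x. cos (real (2^\<mu>) * x + \<theta> \<mu>) * cos (real m * x + s) \<partial>circle) * (\<integral>x. cos (real (2^\<nu>) * x + \<eta> \<nu>) * cos (real n * x + t) \<partial>circle)"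
      by (rule integral_torus_product[where u="\<lambda>x. cos (real (2^\<mu>) * x + \<theta> \<mu>) * cos (real m * x + s)"]) (intro continuous_intros)+
    then show ?thesis by (simp only: integral_circle_cos_cos zero_less_power zero_less_numeral)
  qed
  ultimately show ?thesis by (simp del: of_nat_power of_nat_numeral)
qed

text \<open>
  Each Fourier coefficient of the partial sums is eventually equal to that of \<open>G\<close>.
\<close>
lemma integral_lac_poly_eq:
  assumes "phase_series G a \<theta> \<eta>"
  obtains M0 where "\<And>M. M \<ge> M0 \<Longrightarrow>
    (\<integral>z. lac_poly a \<theta> \<eta> M z * (cos (real m * fst z + s) * cos (real n * snd z + t)) \<partial>torus)
      = (\<integral>z. G z * (cos (real m * fst z + s) * cos (real n * snd z + t)) \<partial>torus)"
proof (cases "m \<in> range (\<lambda>\<mu>. 2^\<mu>) \<and> n \<in> range (\<lambda>\<nu>. 2^\<nu>)")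
  case True
  then obtain \<mu>0 \<nu>0 where mn: "m = 2^\<mu>0" "n = 2^\<nu>0" by auto
  show thesis
  proof (rule that[of "Suc (max \<mu>0 \<nu>0)"])
    fix M assume M: "Suc (max \<mu>0 \<nu>0) \<le> M"
    have "(\<Sum>\<mu><M. \<Sum>\<nu><M. a \<mu> \<nu> * ((if m = 2^\<mu> then pi * cos (s - \<theta> \<mu>) else 0) * (if n = 2^\<nu> then pi * cos (t - \<eta> \<nu>) else 0)))
      = (\<Sum>\<mu><M. \<Sum>\<nu><M. if \<mu> = \<mu>0 \<and> \<nu> = \<nu>0 then pi\<^sup>2 * a \<mu>0 \<nu>0 * (cos (s - \<theta> \<mu>0) * cos (t - \<eta> \<nu>0)) else 0)"
      unfolding mn by (intro sum.cong refl) (auto simp: power2_eq_square)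
    also have "\<dots> = (\<Sum>\<mu><M. if \<mu> = \<mu>0 then pi\<^sup>2 * a \<mu>0 \<nu>0 * (cos (s - \<theta> \<mu>0) * cos (t - \<eta> \<nu>0)) else 0)"
    proof (intro sum.cong refl)
      fix \<mu>
      show "(\<Sum>\<nu><M. if \<mu> = \<mu>0 \<and> \<nu> = \<nu>0 then pi\<^sup>2 * a \<mu>0 \<nu>0 * (cos (s - \<theta> \<mu>0) * cos (t - \<eta> \<nu>0)) else 0)
          = (if \<mu> = \<mu>0 then pi\<^sup>2 * a \<mu>0 \<nu>0 * (cos (s - \<theta> \<mu>0) * cos (t - \<eta> \<nu>0)) else 0)"
        using M by (cases "\<mu> = \<mu>0") auto
    qed
    also have "\<dots> = pi\<^sup>2 * a \<mu>0 \<nu>0 * (cos (s - \<theta> \<mu>0) * cos (t - \<eta> \<nu>0))"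
      using M by simp
    also have "\<dots> = (\<integral>z. G z * (cos (real m * fst z + s) * cos (real n * snd z + t)) \<partial>torus)"
      using assms unfolding phase_series_def mn by simp
    finally show "(\<integral>z. lac_poly a \<theta> \<eta> M z * (cos (real m * fst z + s) * cos (real n * snd z + t)) \<partial>torus)
      = (\<integral>z. G z * (cos (real m * fst z + s) * cos (real n * snd z + t)) \<partial>torus)"
      unfolding integral_lac_poly .
  qed
next
  case False
  have "(\<integral>z. G z * (cos (real m * fst z + s) * cos (real n * snd z + t)) \<partial>torus) = 0"
    using assms False unfolding phase_series_def by blast
  moreover have "(\<integral>z. lac_poly a \<theta> \<eta> M z * (cos (real m * fst z + s) * cos (real n * snd z + t)) \<partial>torus) = 0" for M
    unfolding integral_lac_poly using False by (intro sum.neutral ballI) auto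
  ultimately show thesis by (intro that[of 0]) simp
qed

text \<open>
  Lower bound by duality.  With \<open>\<sigma>\<close> the \<open>\<ell>\<^sub>2\<close> norm of the coefficients with indices below \<open>N\<close>, orthogonality gives
  \<open>\<integral> G S = \<pi>\<^sup>2 \<sigma>\<^sup>2\<close> for the partial sum \<open>S\<close>, and Young's inequality together with the Khintchine bound on
  \<open>\<bar>S\<bar> powr q\<close> isolates \<open>\<integral> \<bar>G\<bar> powr p\<close>.
\<close>
lemma lacunary_norm_lower:
  fixes p :: real assumes p: "1 < p"
  obtains c where "c > 0" "\<And>G a \<theta> \<eta> N. integrable torus G \<Longrightarrow> phase_series G a \<theta> \<eta> \<Longrightarrow>
     ennreal (c * (\<Sum>\<mu><N. \<Sum>\<nu><N. (a \<mu> \<nu>)\<^sup>2) powr (p/2)) \<le> (\<integral>\<^sup>+z. ennreal (\<bar>G z\<bar> powr p) \<partial>torus)"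
proof -
  define q where "q = p / (p - 1)"
  have q: "1 < q" "1/p + 1/q = 1" using p by (auto simp: q_def field_simps)
  obtain K where K: "K > 0" and Kh: "\<And>a \<theta> \<eta> N. (\<integral>\<^sup>+z. ennreal (\<bar>lac_poly a \<theta> \<eta> N z\<bar> powr q) \<partial>torus)
       \<le> ennreal (K * (\<Sum>\<mu><N. \<Sum>\<nu><N. (a \<mu> \<nu>)\<^sup>2) powr (q/2))"
    using lacunary_Khintchine_torus[of q] q by auto
  \<comment> \<open>Chosen so that the term of Young's inequality containing \<open>S\<close> is half of \<open>\<pi>\<^sup>2\<close>.\<close>
  define l where "l = (2 * K / (q * pi\<^sup>2)) powr (1/q)"
  have l: "0 < l" using K q by (simp add: l_def)
  have l_powr: "l powr q = 2 * K / (q * pi\<^sup>2)" using K q by (simp add: l_def powr_powr)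
  define c where "c = pi\<^sup>2 * p / (2 * l powr p)"
  have c: "0 < c" using p l by (simp add: c_def)
  have "ennreal (c * (\<Sum>\<mu><N. \<Sum>\<nu><N. (a \<mu> \<nu>)\<^sup>2) powr (p/2)) \<le> (\<integral>\<^sup>+z. ennreal (\<bar>G z\<bar> powr p) \<partial>torus)"
    if G: "integrable torus G" and ph: "phase_series G a \<theta> \<eta>" for G a \<theta> \<eta> N
  proof -
    define \<sigma> where "\<sigma> = sqrt (\<Sum>\<mu><N. \<Sum>\<nu><N. (a \<mu> \<nu>)\<^sup>2)"
    have \<sigma>0: "0 \<le> \<sigma>" and \<sigma>2: "\<sigma>\<^sup>2 = (\<Sum>\<mu><N. \<Sum>\<nu><N. (a \<mu> \<nu>)\<^sup>2)"
      by (auto simp: \<sigma>_def intro!: sum_nonneg)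
    have \<sigma>r: "(\<Sum>\<mu><N. \<Sum>\<nu><N. (a \<mu> \<nu>)\<^sup>2) powr (r/2) = \<sigma> powr r" for r
      using \<sigma>0 unfolding \<sigma>2[symmetric] by (cases "\<sigma> = 0") (auto simp: powr_powr simp flip: powr_numeral)
    let ?S = "lac_poly a \<theta> \<eta> N"
    have [measurable]: "G \<in> borel_measurable torus" using G by auto
    have contS: "continuous_on UNIV ?S" by (rule continuous_lac_poly)
    note [measurable] = borel_measurable_torus[OF borel_measurable_continuous_onI[OF contS]]
    show ?thesis
    proof (cases "\<sigma> = 0 \<or> (\<integral>\<^sup>+z. ennreal (\<bar>G z\<bar> powr p) \<partial>torus) = \<infinity>")
      case True
      then show ?thesis using p unfolding \<sigma>r by auto
    next
      case False
      then have \<sigma>: "0 < \<sigma>" using \<sigma>0 by simp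
      define x where "x = (\<integral>z. \<bar>G z\<bar> powr p \<partial>torus)"
      have iG: "integrable torus (\<lambda>z. \<bar>G z\<bar> powr p)"
        using False by (intro integrableI_bounded) (auto simp: less_top)
      have nx: "(\<integral>\<^sup>+z. ennreal (\<bar>G z\<bar> powr p) \<partial>torus) = ennreal x"
        unfolding x_def by (rule nn_integral_eq_integral[OF iG]) auto
      have iS: "integrable torus (\<lambda>z. \<bar>?S z\<bar> powr q)"
        by (intro integrable_torus continuous_on_powr' continuous_intros contS) (use q in auto)
      have "ennreal (\<integral>z. \<bar>?S z\<bar> powr q \<partial>torus) \<le> ennreal (K * \<sigma> powr q)"
        using Kh[where a=a and \<theta>=\<theta> and \<eta>=\<eta> and N=N] unfolding \<sigma>r by (subst nn_integral_eq_integral[OF iS, symmetric]) auto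
      then have Sq: "(\<integral>z. \<bar>?S z\<bar> powr q \<partial>torus) \<le> K * \<sigma> powr q" using K by simp
      have iT: "integrable torus (\<lambda>z. G z * (cos (2^\<mu> * fst z + \<theta> \<mu>) * cos (2^\<nu> * snd z + \<eta> \<nu>)))" for \<mu> \<nu>
        by (rule integrable_torus_mult_bounded[OF G, where B=1])
          (auto intro!: borel_measurable_continuous_onI continuous_intros simp: abs_mult mult_le_one)
      have GS: "G z * ?S z = (\<Sum>\<mu><N. \<Sum>\<nu><N. a \<mu> \<nu> * (G z * (cos (2^\<mu> * fst z + \<theta> \<mu>) * cos (2^\<nu> * snd z + \<eta> \<nu>))))" for z
        unfolding lac_poly_def sum_distrib_left by (intro sum.cong refl) (simp add: mult_ac)
      have iGS: "integrable torus (\<lambda>z. G z * ?S z)"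
        unfolding GS using iT by simp
      have "(\<integral>z. G z * ?S z \<partial>torus) = (\<Sum>\<mu><N. \<Sum>\<nu><N. a \<mu> \<nu> * (\<integral>z. G z * (cos (2^\<mu> * fst z + \<theta> \<mu>) * cos (2^\<nu> * snd z + \<eta> \<nu>)) \<partial>torus))"
        unfolding GS using iT by simp
      also have "\<dots> = (\<Sum>\<mu><N. \<Sum>\<nu><N. a \<mu> \<nu> * (pi\<^sup>2 * a \<mu> \<nu>))"
      proof (intro sum.cong refl)
        fix \<mu> \<nu>
        have "(\<integral>z. G z * (cos (real (2^\<mu>) * fst z + \<theta> \<mu>) * cos (real (2^\<nu>) * snd z + \<eta> \<nu>)) \<partial>torus) = pi\<^sup>2 * a \<mu> \<nu> * (cos (\<theta> \<mu> - \<theta> \<mu>) * cos (\<eta> \<nu> - \<eta> \<nu>))"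
          using ph unfolding phase_series_def by blast
        then show "a \<mu> \<nu> * (\<integral>z. G z * (cos (2^\<mu> * fst z + \<theta> \<mu>) * cos (2^\<nu> * snd z + \<eta> \<nu>)) \<partial>torus) = a \<mu> \<nu> * (pi\<^sup>2 * a \<mu> \<nu>)"
          by simp
      qed
      also have "\<dots> = pi\<^sup>2 * \<sigma>\<^sup>2"
        unfolding \<sigma>2 sum_distrib_left by (simp add: power2_eq_square mult_ac)
      finally have int: "(\<integral>z. G z * ?S z \<partial>torus) = pi\<^sup>2 * \<sigma>\<^sup>2" .
      have young: "G z * ?S z / \<sigma>\<^sup>2 \<le> (l / \<sigma>) powr p / p * \<bar>G z\<bar> powr p + 1 / (q * (l * \<sigma>) powr q) * \<bar>?S z\<bar> powr q" for z
      proof -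
        have "G z * ?S z / \<sigma>\<^sup>2 \<le> \<bar>G z * ?S z / \<sigma>\<^sup>2\<bar>" by (rule abs_ge_self)
        also have "\<dots> = (l / \<sigma> * \<bar>G z\<bar>) * (\<bar>?S z\<bar> / (l * \<sigma>))"
          using \<sigma> l by (simp add: abs_mult power2_eq_square)
        also have "\<dots> \<le> (l / \<sigma> * \<bar>G z\<bar>) powr p / p + (\<bar>?S z\<bar> / (l * \<sigma>)) powr q / q"
          by (rule Youngs_inequality) (use p q \<sigma> l in auto)
        also have "\<dots> = (l / \<sigma>) powr p / p * \<bar>G z\<bar> powr p + 1 / (q * (l * \<sigma>) powr q) * \<bar>?S z\<bar> powr q"
          using \<sigma> l by (simp add: powr_mult powr_divide)
        finally show ?thesis .
      qed
      have "pi\<^sup>2 = (\<integral>z. G z * ?S z / \<sigma>\<^sup>2 \<partial>torus)" using \<sigma> int by simp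
      also have "\<dots> \<le> (\<integral>z. (l / \<sigma>) powr p / p * \<bar>G z\<bar> powr p + 1 / (q * (l * \<sigma>) powr q) * \<bar>?S z\<bar> powr q \<partial>torus)"
        using iGS iG iS young by (intro integral_mono) auto
      also have "\<dots> = (l / \<sigma>) powr p / p * x + 1 / (q * (l * \<sigma>) powr q) * (\<integral>z. \<bar>?S z\<bar> powr q \<partial>torus)"
        using iG iS by (simp add: x_def)
      also have "\<dots> \<le> (l / \<sigma>) powr p / p * x + 1 / (q * (l * \<sigma>) powr q) * (K * \<sigma> powr q)"
        using Sq q by (intro add_left_mono mult_left_mono) auto
      also have "1 / (q * (l * \<sigma>) powr q) * (K * \<sigma> powr q) = pi\<^sup>2 / 2"
        using \<sigma> l K q by (simp add: powr_mult l_powr)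
      finally have "pi\<^sup>2 / 2 \<le> (l / \<sigma>) powr p / p * x" by linarith
      then have "c * \<sigma> powr p \<le> x"
        using \<sigma> l p by (simp add: c_def powr_divide field_simps)
      then show ?thesis unfolding nx \<sigma>r by (rule ennreal_leI)
    qed
  qed
  then show thesis using that c by blast
qed

text \<open>
  Upper bound for square summable coefficients; \<open>B\<close> bounds the sums of their squares.
\<close>
lemma lacunary_norm_upper:
  fixes p :: real assumes p: "0 < p"
  obtains K where "K > 0" "\<And>G a \<theta> \<eta> B. integrable torus G \<Longrightarrow> phase_series G a \<theta> \<eta> \<Longrightarrow>
     (\<And>N. (\<Sum>\<mu><N. \<Sum>\<nu><N. (a \<mu> \<nu>)\<^sup>2) \<le> B) \<Longrightarrow>
     (\<integral>\<^sup>+z. ennreal (\<bar>G z\<bar> powr p) \<partial>torus) \<le> ennreal (K * B powr (p/2))"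
proof -
  obtain K where K: "K > 0" and Kh: "\<And>a \<theta> \<eta> N. (\<integral>\<^sup>+z. ennreal (\<bar>lac_poly a \<theta> \<eta> N z\<bar> powr p) \<partial>torus)
       \<le> ennreal (K * (\<Sum>\<mu><N. \<Sum>\<nu><N. (a \<mu> \<nu>)\<^sup>2) powr (p/2))"
    using lacunary_Khintchine_torus[OF p] by blast
  obtain K1 where K1: "K1 > 0" and Kh1: "\<And>a \<theta> \<eta> N. (\<integral>\<^sup>+z. ennreal (\<bar>lac_poly a \<theta> \<eta> N z\<bar> powr 1) \<partial>torus)
       \<le> ennreal (K1 * (\<Sum>\<mu><N. \<Sum>\<nu><N. (a \<mu> \<nu>)\<^sup>2) powr (1/2))"
    using lacunary_Khintchine_torus[of 1] by auto
  have "(\<integral>\<^sup>+z. ennreal (\<bar>G z\<bar> powr p) \<partial>torus) \<le> ennreal (K * B powr (p/2))"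
    if G: "integrable torus G" and ph: "phase_series G a \<theta> \<eta>"
      and B: "\<And>N. (\<Sum>\<mu><N. \<Sum>\<nu><N. (a \<mu> \<nu>)\<^sup>2) \<le> B" for G a \<theta> \<eta> B
  proof -
    define S where "S N = lac_poly a \<theta> \<eta> N" for N
    define Q where "Q N = (\<Sum>\<mu><N. \<Sum>\<nu><N. (a \<mu> \<nu>)\<^sup>2)" for N
    have contS: "continuous_on UNIV (S N)" for N unfolding S_def by (rule continuous_lac_poly)
    have iS: "integrable torus (S N)" for N by (intro integrable_torus contS)
    note [measurable] = borel_measurable_torus[OF borel_measurable_continuous_onI[OF contS]]
    have Q0: "0 \<le> Q N" for N unfolding Q_def by (intro sum_nonneg) auto
    have B0: "0 \<le> B" using Q0[of 0] B[of 0] by (simp add: Q_def)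
    have diff: "(\<integral>\<^sup>+z. ennreal \<bar>S N z - S M z\<bar> \<partial>torus) \<le> ennreal (K1 * sqrt (Q N - Q M)) \<and> Q M \<le> Q N" if MN: "M \<le> N" for M N
    proof -
      \<comment> \<open>A difference of partial sums is a lacunary polynomial with the inner block of coefficients removed.\<close>
      define a' where "a' \<mu> \<nu> = (if \<mu> < M \<and> \<nu> < M then 0 else a \<mu> \<nu>)" for \<mu> \<nu>
      have restrict: "(\<Sum>\<mu><N. \<Sum>\<nu><N. if \<mu> < M \<and> \<nu> < M then h \<mu> \<nu> else 0) = (\<Sum>\<mu><M. \<Sum>\<nu><M. h \<mu> \<nu>)" for h :: "nat \<Rightarrow> nat \<Rightarrow> real"
      proof -
        have "(\<Sum>\<mu><N. \<Sum>\<nu><N. if \<mu> < M \<and> \<nu> < M then h \<mu> \<nu> else 0) = (\<Sum>\<mu><M. \<Sum>\<nu><N. if \<mu> < M \<and> \<nu> < M then h \<mu> \<nu> else 0)"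
          using MN by (intro sum.mono_neutral_right) auto
        also have "\<dots> = (\<Sum>\<mu><M. \<Sum>\<nu><M. if \<mu> < M \<and> \<nu> < M then h \<mu> \<nu> else 0)"
          using MN by (intro sum.cong refl sum.mono_neutral_right) auto
        finally show ?thesis by simp
      qed
      have "S N z - S M z = lac_poly a' \<theta> \<eta> N z" for z
        unfolding S_def lac_poly_def restrict[symmetric] sum_subtractf[symmetric]
        by (intro sum.cong refl) (simp add: a'_def)
      moreover have Qd: "Q N - Q M = (\<Sum>\<mu><N. \<Sum>\<nu><N. (a' \<mu> \<nu>)\<^sup>2)"
        unfolding Q_def restrict[symmetric] sum_subtractf[symmetric]
        by (intro sum.cong refl) (simp add: a'_def)
      ultimately have "(\<integral>\<^sup>+z. ennreal \<bar>S N z - S M z\<bar> \<partial>torus) \<le> ennreal (K1 * (Q N - Q M) powr (1/2))"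
        using Kh1[where a=a' and \<theta>=\<theta> and \<eta>=\<eta> and N=N] by simp
      moreover have "0 \<le> Q N - Q M" unfolding Qd by (intro sum_nonneg) auto
      ultimately show ?thesis by (simp add: powr_half_sqrt)
    qed
    have "incseq Q" using diff by (simp add: incseq_def)
    then have "convergent Q" using incseq_convergent[of Q B] B unfolding Q_def convergent_def by metis
    then have QC: "Cauchy Q" by (rule convergent_Cauchy)
    have small: "\<exists>M0. \<forall>M\<ge>M0. \<forall>N\<ge>M0. (\<integral>\<^sup>+z. ennreal \<bar>S N z - S M z\<bar> \<partial>torus) \<le> ennreal e" if e: "e > 0" for e
    proof -
      have "(e / K1)\<^sup>2 > 0" using e K1 by simp
      with QC obtain M0 where M0: "\<And>M N. M \<ge> M0 \<Longrightarrow> N \<ge> M0 \<Longrightarrow> dist (Q M) (Q N) < (e / K1)\<^sup>2"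
        unfolding Cauchy_def by metis
      have *: "(\<integral>\<^sup>+z. ennreal \<bar>S N z - S M z\<bar> \<partial>torus) \<le> ennreal e" if "M0 \<le> M" "M \<le> N" for M N
      proof -
        have "Q N - Q M \<le> (e / K1)\<^sup>2" using M0[of M N] that by (simp add: dist_real_def)
        then have "sqrt (Q N - Q M) \<le> sqrt ((e / K1)\<^sup>2)" by (rule real_sqrt_le_mono)
        also have "\<dots> = e / K1" using e K1 by (simp add: real_sqrt_abs)
        finally have "K1 * sqrt (Q N - Q M) \<le> e" using K1 by (simp add: pos_le_divide_eq mult.commute)
        then show ?thesis using diff[OF that(2)] by (meson ennreal_leI order_trans)
      qed
      have "(\<integral>\<^sup>+z. ennreal \<bar>S N z - S M z\<bar> \<partial>torus) \<le> ennreal e" if "M0 \<le> M" "M0 \<le> N" for M N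
        using *[of M N] *[of N M] that by (cases "M \<le> N") (auto simp: abs_minus_commute)
      then show ?thesis by blast
    qed
    obtain r where r: "strict_mono r" and rC: "AE z in torus. Cauchy (\<lambda>i. S (r i) z)"
    proof (rule cauchy_L1_AE_cauchy_subseq[of torus S])
      show "integrable torus (S n)" for n by (rule iS)
      fix e :: real assume e: "0 < e"
      obtain M0 where M0: "\<And>M N. M \<ge> M0 \<Longrightarrow> N \<ge> M0 \<Longrightarrow> (\<integral>\<^sup>+z. ennreal \<bar>S N z - S M z\<bar> \<partial>torus) \<le> ennreal (e/2)"
        using small[of "e/2"] e by auto
      have "(LINT z|torus. norm (S i z - S j z)) < e" if "i \<ge> M0" "j \<ge> M0" for i j
      proof -
        have "ennreal (LINT z|torus. \<bar>S i z - S j z\<bar>) \<le> ennreal (e/2)"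
          using M0[OF that(2,1)] iS by (subst nn_integral_eq_integral[symmetric]) auto
        then show ?thesis using e by simp
      qed
      then show "\<exists>N. \<forall>i\<ge>N. \<forall>j\<ge>N. (LINT z|torus. norm (S i z - S j z)) < e" by blast
    qed
    define L where "L z = lim (\<lambda>i. S (r i) z)" for z
    have Lm [measurable]: "L \<in> borel_measurable torus"
      unfolding L_def by (rule borel_measurable_lim_metric) measurable
    have Llim: "AE z in torus. (\<lambda>i. S (r i) z) \<longlonglongrightarrow> L z"
      using rC by eventually_elim (auto simp: L_def real_Cauchy_convergent convergent_LIMSEQ_iff[symmetric])
    \<comment> \<open>Fatou's lemma along the subsequence, for continuous functions of its limit.\<close>
    have fatou: "(\<integral>\<^sup>+z. ennreal (h (L z) z) \<partial>torus) \<le> C"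
      if h: "\<And>z. continuous_on UNIV (\<lambda>x. h x z)" and hm: "\<And>i. (\<lambda>z. h (S (r i) z) z) \<in> borel_measurable torus"
        and C: "eventually (\<lambda>i. (\<integral>\<^sup>+z. ennreal (h (S (r i) z) z) \<partial>torus) \<le> C) sequentially" for h C
    proof -
      have "(\<integral>\<^sup>+z. ennreal (h (L z) z) \<partial>torus) = (\<integral>\<^sup>+z. liminf (\<lambda>i. ennreal (h (S (r i) z) z)) \<partial>torus)"
      proof (rule nn_integral_cong_AE)
        show "AE z in torus. ennreal (h (L z) z) = liminf (\<lambda>i. ennreal (h (S (r i) z) z))"
          using Llim
        proof eventually_elim
          case (elim z)
          have "(\<lambda>i. h (S (r i) z) z) \<longlonglongrightarrow> h (L z) z"
            by (rule continuous_on_tendsto_compose[OF h elim]) auto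
          then have "(\<lambda>i. ennreal (h (S (r i) z) z)) \<longlonglongrightarrow> ennreal (h (L z) z)" by (rule tendsto_ennrealI)
          then show ?case using lim_imp_Liminf[of sequentially] by (metis trivial_limit_sequentially)
        qed
      qed
      also have "\<dots> \<le> liminf (\<lambda>i. \<integral>\<^sup>+z. ennreal (h (S (r i) z) z) \<partial>torus)"
        by (rule nn_integral_liminf) (use hm in measurable)
      also have "\<dots> \<le> C"
        using Liminf_mono[OF C] by (simp add: Liminf_const)
      finally show ?thesis .
    qed
    have Lp: "(\<integral>\<^sup>+z. ennreal (\<bar>L z\<bar> powr p) \<partial>torus) \<le> ennreal (K * B powr (p/2))"
    proof (rule fatou)
      show "continuous_on UNIV (\<lambda>x::real. \<bar>x\<bar> powr p)"
        by (intro continuous_on_powr' continuous_intros) (use p in auto)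
      show "\<forall>\<^sub>F i in sequentially. (\<integral>\<^sup>+z. ennreal (\<bar>S (r i) z\<bar> powr p) \<partial>torus) \<le> ennreal (K * B powr (p/2))"
      proof (rule always_eventually, rule allI)
        fix i
        have "(\<integral>\<^sup>+z. ennreal (\<bar>S (r i) z\<bar> powr p) \<partial>torus) \<le> ennreal (K * Q (r i) powr (p/2))"
          unfolding S_def Q_def by (rule Kh)
        also have "\<dots> \<le> ennreal (K * B powr (p/2))"
          using K Q0 B p by (intro ennreal_leI mult_left_mono powr_mono2) (auto simp: Q_def)
        finally show "(\<integral>\<^sup>+z. ennreal (\<bar>S (r i) z\<bar> powr p) \<partial>torus) \<le> ennreal (K * B powr (p/2))" .
      qed
    qed measurable
    have LS: "\<exists>M0. \<forall>M\<ge>M0. (\<integral>\<^sup>+z. ennreal \<bar>L z - S M z\<bar> \<partial>torus) \<le> ennreal e" if e: "e > 0" for e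
    proof -
      obtain M0 where M0: "\<And>M N. M \<ge> M0 \<Longrightarrow> N \<ge> M0 \<Longrightarrow> (\<integral>\<^sup>+z. ennreal \<bar>S N z - S M z\<bar> \<partial>torus) \<le> ennreal e"
        using small[OF e] by auto
      have "(\<integral>\<^sup>+z. ennreal \<bar>L z - S M z\<bar> \<partial>torus) \<le> ennreal e" if "M \<ge> M0" for M
      proof (rule fatou[where h="\<lambda>x z. \<bar>x - S M z\<bar>"])
        show "\<And>z. continuous_on UNIV (\<lambda>x. \<bar>x - S M z\<bar>)" by (intro continuous_intros)
        have "r i \<ge> M0" if "i \<ge> M0" for i using seq_suble[OF r, of i] that by linarith
        then show "\<forall>\<^sub>F i in sequentially. (\<integral>\<^sup>+z. ennreal \<bar>S (r i) z - S M z\<bar> \<partial>torus) \<le> ennreal e"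
          using M0[OF \<open>M \<ge> M0\<close>] by (auto simp: eventually_sequentially)
      qed measurable
      then show ?thesis by blast
    qed
    have iLS: "integrable torus (\<lambda>z. L z - S M z)" if "(\<integral>\<^sup>+z. ennreal \<bar>L z - S M z\<bar> \<partial>torus) \<le> ennreal e" for M e
      using that by (intro integrableI_bounded) (auto intro: le_less_trans)
    have iL: "integrable torus L"
    proof -
      obtain M where "integrable torus (\<lambda>z. L z - S M z)" using LS[of 1] iLS by (meson order_refl zero_less_one)
      from Bochner_Integration.integrable_add[OF this iS[of M]] show ?thesis by simp
    qed
    have "AE z in torus. G z - L z = 0"
    proof (rule torus_Fourier_uniqueness)
      show "integrable torus (\<lambda>z. G z - L z)" using G iL by simp
      fix m n s t
      let ?\<phi> = "\<lambda>z. cos (real m * fst z + s) * cos (real n * snd z + t)"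
      have i\<phi>: "integrable torus (\<lambda>z. F z * ?\<phi> z)" if "integrable torus F" for F
        by (rule integrable_torus_mult_bounded[OF that, where B=1])
          (auto intro!: borel_measurable_continuous_onI continuous_intros simp: abs_mult mult_le_one)
      obtain M1 where M1: "\<And>M. M \<ge> M1 \<Longrightarrow> (\<integral>z. S M z * ?\<phi> z \<partial>torus) = (\<integral>z. G z * ?\<phi> z \<partial>torus)"
        using integral_lac_poly_eq[OF ph, of m s n t] unfolding S_def by blast
      have "\<bar>\<integral>z. (G z - L z) * ?\<phi> z \<partial>torus\<bar> \<le> 0 + e" if e: "e > 0" for e
      proof -
        obtain M0 where M0: "\<And>M. M \<ge> M0 \<Longrightarrow> (\<integral>\<^sup>+z. ennreal \<bar>L z - S M z\<bar> \<partial>torus) \<le> ennreal e"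
          using LS[OF e] by auto
        define M where "M = max M0 M1"
        note LSM = M0[of M, unfolded M_def, simplified, folded M_def]
        note iLSM = iLS[OF LSM]
        have "(\<integral>z. (G z - L z) * ?\<phi> z \<partial>torus) = (\<integral>z. G z * ?\<phi> z \<partial>torus) - (\<integral>z. L z * ?\<phi> z \<partial>torus)"
          using i\<phi>[OF G] i\<phi>[OF iL] by (simp add: left_diff_distrib)
        also have "\<dots> = - (\<integral>z. (L z - S M z) * ?\<phi> z \<partial>torus)"
          using i\<phi>[OF iS] i\<phi>[OF iL] M1[of M] by (simp add: left_diff_distrib M_def)
        finally have "\<bar>\<integral>z. (G z - L z) * ?\<phi> z \<partial>torus\<bar> \<le> (\<integral>z. \<bar>(L z - S M z) * ?\<phi> z\<bar> \<partial>torus)"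
          using integral_norm_bound[of torus "\<lambda>z. (L z - S M z) * ?\<phi> z"] by simp
        also have "\<dots> \<le> (\<integral>z. \<bar>L z - S M z\<bar> \<partial>torus)"
        proof (rule integral_mono)
          show "\<bar>(L z - S M z) * ?\<phi> z\<bar> \<le> \<bar>L z - S M z\<bar>" for z
            unfolding abs_mult by (intro mult_left_le mult_le_one) auto
        qed (use i\<phi>[OF iLSM] iLSM in auto)
        also have "\<dots> \<le> e"
        proof -
          have "ennreal (\<integral>z. \<bar>L z - S M z\<bar> \<partial>torus) \<le> ennreal e"
            using LSM iLSM by (subst nn_integral_eq_integral[symmetric]) auto
          then show ?thesis using e by simp
        qed
        finally show ?thesis by simp
      qed
      then show "(\<integral>z. (G z - L z) * ?\<phi> z \<partial>torus) = 0"
        using field_le_epsilon[of "\<bar>\<integral>z. (G z - L z) * ?\<phi> z \<partial>torus\<bar>" 0] by simp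
    qed
    then have "AE z in torus. ennreal (\<bar>G z\<bar> powr p) = ennreal (\<bar>L z\<bar> powr p)"
      by eventually_elim simp
    then have "(\<integral>\<^sup>+z. ennreal (\<bar>G z\<bar> powr p) \<partial>torus) = (\<integral>\<^sup>+z. ennreal (\<bar>L z\<bar> powr p) \<partial>torus)"
      by (rule nn_integral_cong_AE)
    with Lp show ?thesis by simp
  qed
  then show thesis using that K by blast
qed

lemma ennpowr_ennreal: "0 \<le> x \<Longrightarrow> ennpowr (ennreal x) a = ennreal (x powr a)"
  by (simp add: ennpowr_def)

lemma ennpowr_top [simp]: "ennpowr \<infinity> a = \<infinity>" "ennpowr top a = top"
  by (simp_all add: ennpowr_def)

lemma ennpowr_mono:
  assumes "0 \<le> a" "x \<le> y" shows "ennpowr x a \<le> ennpowr y a"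
proof (cases y)
  case (real r)
  then obtain s where "x = ennreal s" "0 \<le> s" "s \<le> r"
    using assms(2) by (cases x) (auto simp: top_unique)
  then show ?thesis using real assms by (simp add: ennpowr_ennreal powr_mono2)
qed simp

lemma ennpowr_half_scale:
  assumes k: "0 < k" shows "ennpowr (ennreal (k\<^sup>2) * x) (1/2) = ennreal k * ennpowr x (1/2)"
proof (cases x)
  case (real r)
  have "ennreal (k\<^sup>2) * x = ennreal (k\<^sup>2 * r)"
    unfolding real(2) by (rule ennreal_mult[symmetric]) (use real in auto)
  then have "ennpowr (ennreal (k\<^sup>2) * x) (1/2) = ennreal ((k\<^sup>2 * r) powr (1/2))"
    using real by (simp only: ennpowr_ennreal mult_nonneg_nonneg zero_le_power2)
  also have "(k\<^sup>2 * r) powr (1/2) = k * r powr (1/2)"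
    using k real by (simp add: powr_mult powr_half_sqrt)
  also have "ennreal (k * r powr (1/2)) = ennreal k * ennpowr x (1/2)"
    using k real by (simp add: ennpowr_ennreal ennreal_mult)
  finally show ?thesis .
next
  case top
  then show ?thesis using k by (simp add: ennreal_mult_top)
qed

lemma ennpowr_half_add: "ennpowr (x + y) (1/2) \<le> ennpowr x (1/2) + ennpowr y (1/2)"
proof (cases "x = \<infinity> \<or> y = \<infinity>")
  case False
  then obtain r s where "x = ennreal r" "0 \<le> r" "y = ennreal s" "0 \<le> s"
    by (metis ennreal_cases infinity_ennreal_def)
  then show ?thesis
    by (simp add: ennpowr_ennreal powr_half_sqrt sqrt_add_le_add_sqrt ennreal_leI flip: ennreal_plus)
qed auto

text \<open>
  The sum of the squares of all coefficients, as an extended nonnegative real.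
\<close>
definition square_sum :: "(nat \<Rightarrow> nat \<Rightarrow> real) \<Rightarrow> ennreal" where
  "square_sum a = (\<Sum>\<mu>. \<Sum>\<nu>. ennreal ((a \<mu> \<nu>)\<^sup>2))"

lemma square_sum_ge:
  "ennreal (\<Sum>\<mu><N. \<Sum>\<nu><N. (a \<mu> \<nu>)\<^sup>2) \<le> square_sum a"
proof -
  have "ennreal (\<Sum>\<mu><N. \<Sum>\<nu><N. (a \<mu> \<nu>)\<^sup>2) = (\<Sum>\<mu><N. \<Sum>\<nu><N. ennreal ((a \<mu> \<nu>)\<^sup>2))"
    by (simp add: sum_ennreal sum_nonneg)
  also have "\<dots> \<le> (\<Sum>\<mu><N. \<Sum>\<nu>. ennreal ((a \<mu> \<nu>)\<^sup>2))"
    by (intro sum_mono sum_le_suminf) auto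
  also have "\<dots> \<le> square_sum a"
    unfolding square_sum_def by (intro sum_le_suminf) auto
  finally show ?thesis .
qed

lemma square_sum_le:
  assumes "\<And>N. ennreal (\<Sum>\<mu><N. \<Sum>\<nu><N. (a \<mu> \<nu>)\<^sup>2) \<le> B"
  shows "square_sum a \<le> B"
  unfolding square_sum_def
proof (rule suminf_le_const)
  fix N
  have "(\<Sum>\<mu><N. \<Sum>\<nu>. ennreal ((a \<mu> \<nu>)\<^sup>2)) = (\<Sum>\<nu>. \<Sum>\<mu><N. ennreal ((a \<mu> \<nu>)\<^sup>2))"
    by (rule suminf_sum[symmetric]) auto
  also have "\<dots> \<le> B"
  proof (rule suminf_le_const)
    fix M
    let ?L = "max M N"
    have "(\<Sum>\<nu><M. \<Sum>\<mu><N. ennreal ((a \<mu> \<nu>)\<^sup>2)) \<le> (\<Sum>\<nu><?L. \<Sum>\<mu><N. ennreal ((a \<mu> \<nu>)\<^sup>2))"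
      by (intro sum_mono2) auto
    also have "\<dots> \<le> (\<Sum>\<nu><?L. \<Sum>\<mu><?L. ennreal ((a \<mu> \<nu>)\<^sup>2))"
      by (intro sum_mono sum_mono2) auto
    also have "\<dots> = ennreal (\<Sum>\<mu><?L. \<Sum>\<nu><?L. (a \<mu> \<nu>)\<^sup>2)"
      by (subst sum.swap) (simp add: sum_ennreal sum_nonneg)
    also have "\<dots> \<le> B" by (rule assms)
    finally show "(\<Sum>\<nu><M. \<Sum>\<mu><N. ennreal ((a \<mu> \<nu>)\<^sup>2)) \<le> B" .
  qed auto
  finally show "(\<Sum>\<mu><N. \<Sum>\<nu>. ennreal ((a \<mu> \<nu>)\<^sup>2)) \<le> B" .
qed auto

lemma square_sum_mono:
  assumes "\<And>\<mu> \<nu>. \<bar>a \<mu> \<nu>\<bar> \<le> k * \<bar>b \<mu> \<nu>\<bar>"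
  shows "square_sum a \<le> ennreal (k\<^sup>2) * square_sum b"
proof -
  have "ennreal ((a \<mu> \<nu>)\<^sup>2) \<le> ennreal (k\<^sup>2) * ennreal ((b \<mu> \<nu>)\<^sup>2)" for \<mu> \<nu>
  proof -
    have "\<bar>a \<mu> \<nu>\<bar>\<^sup>2 \<le> (k * \<bar>b \<mu> \<nu>\<bar>)\<^sup>2" using assms by (intro power_mono) auto
    then show ?thesis by (simp add: power_mult_distrib ennreal_leI flip: ennreal_mult)
  qed
  then show ?thesis
    unfolding square_sum_def ennreal_suminf_cmult[symmetric] by (intro suminf_le) auto
qed

lemma Lp_norm_eq: "Lp_norm p G = ennpowr (\<integral>\<^sup>+z. ennreal (\<bar>G z\<bar> powr p) \<partial>torus) (1/p)"
  by (simp add: Lp_norm_def torus_def nn_integral_restrict_space)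

text \<open>
  For integrable functions with a lacunary series, both sides may be infinite, and then they are so
  simultaneously.
\<close>
theorem lacunary_Lp_norm_equivalence:
  fixes p :: real assumes p: "1 < p"
  obtains C where "C > 0"
    "\<And>G a \<theta> \<eta>. integrable torus G \<Longrightarrow> phase_series G a \<theta> \<eta> \<Longrightarrow> ennpowr (square_sum a) (1/2) \<le> ennreal C * Lp_norm p G"
    "\<And>G a \<theta> \<eta>. integrable torus G \<Longrightarrow> phase_series G a \<theta> \<eta> \<Longrightarrow> Lp_norm p G \<le> ennreal C * ennpowr (square_sum a) (1/2)"
proof -
  obtain c where c: "c > 0" and lower: "\<And>G a \<theta> \<eta> N. integrable torus G \<Longrightarrow> phase_series G a \<theta> \<eta> \<Longrightarrow>
     ennreal (c * (\<Sum>\<mu><N. \<Sum>\<nu><N. (a \<mu> \<nu>)\<^sup>2) powr (p/2)) \<le> (\<integral>\<^sup>+z. ennreal (\<bar>G z\<bar> powr p) \<partial>torus)"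
    using lacunary_norm_lower[OF p] by blast
  obtain K where K: "K > 0" and upper: "\<And>G a \<theta> \<eta> B. integrable torus G \<Longrightarrow> phase_series G a \<theta> \<eta> \<Longrightarrow>
     (\<And>N. (\<Sum>\<mu><N. \<Sum>\<nu><N. (a \<mu> \<nu>)\<^sup>2) \<le> B) \<Longrightarrow>
     (\<integral>\<^sup>+z. ennreal (\<bar>G z\<bar> powr p) \<partial>torus) \<le> ennreal (K * B powr (p/2))"
    using lacunary_norm_upper[of p] p by auto
  define C where "C = max ((1/c) powr (1/p)) (K powr (1/p))"
  have C: "C > 0" "(1/c) powr (1/p) \<le> C" "K powr (1/p) \<le> C" using c K by (auto simp: C_def less_max_iff_disj)
  show thesis
  proof (rule that[OF C(1)])
    fix G a \<theta> \<eta> assume G: "integrable torus G" "phase_series G a \<theta> \<eta>"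
    show "ennpowr (square_sum a) (1/2) \<le> ennreal C * Lp_norm p G"
    proof (cases "\<integral>\<^sup>+z. ennreal (\<bar>G z\<bar> powr p) \<partial>torus")
      case (real x)
      have "square_sum a \<le> ennreal ((x/c) powr (2/p))"
      proof (rule square_sum_le, rule ennreal_leI)
        fix N
        let ?Q = "\<Sum>\<mu><N. \<Sum>\<nu><N. (a \<mu> \<nu>)\<^sup>2"
        have Q: "0 \<le> ?Q" by (intro sum_nonneg) auto
        have "c * ?Q powr (p/2) \<le> x" using lower[OF G, of N] real by simp
        then have "?Q powr (p/2) \<le> x / c" using c by (simp add: field_simps)
        then have "(?Q powr (p/2)) powr (2/p) \<le> (x / c) powr (2/p)"
          using p by (intro powr_mono2) auto
        then show "?Q \<le> (x / c) powr (2/p)" using p Q by (simp add: powr_powr)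
      qed
      then have "ennpowr (square_sum a) (1/2) \<le> ennpowr (ennreal ((x/c) powr (2/p))) (1/2)"
        by (intro ennpowr_mono) auto
      also have "\<dots> = ennreal ((1/c) powr (1/p) * x powr (1/p))"
        using c real by (simp add: ennpowr_ennreal powr_powr flip: powr_mult)
      also have "\<dots> \<le> ennreal (C * x powr (1/p))"
        by (intro ennreal_leI mult_right_mono C) auto
      also have "\<dots> = ennreal C * Lp_norm p G"
        using real C by (simp add: Lp_norm_eq ennpowr_ennreal ennreal_mult)
      finally show ?thesis .
    next
      case top
      then show ?thesis using C by (simp add: Lp_norm_eq ennreal_mult_top)
    qed
    show "Lp_norm p G \<le> ennreal C * ennpowr (square_sum a) (1/2)"
    proof (cases "square_sum a")
      case (real B)
      have "(\<Sum>\<mu><N. \<Sum>\<nu><N. (a \<mu> \<nu>)\<^sup>2) \<le> B" for N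
        using square_sum_ge[of a N] real by simp
      from upper[OF G this]
      have "Lp_norm p G \<le> ennpowr (ennreal (K * B powr (p/2))) (1/p)"
        unfolding Lp_norm_eq using p by (intro ennpowr_mono) auto
      also have "\<dots> = ennreal (K powr (1/p) * B powr (1/2))"
        using K p real by (simp add: ennpowr_ennreal powr_mult powr_powr)
      also have "\<dots> \<le> ennreal (C * B powr (1/2))"
        by (intro ennreal_leI mult_right_mono C) auto
      also have "\<dots> = ennreal C * ennpowr (square_sum a) (1/2)"
        using real C by (simp add: ennpowr_ennreal ennreal_mult)
      finally show ?thesis .
    next
      case top
      then show ?thesis using C by (simp add: ennreal_mult_top)
    qed
  qed
qed

section \<open>Fractional differences as Fourier multipliers\<close>

text \<open>
  The absolute values of the binomial coefficients are of order at most \<open>\<nu> powr (- \<alpha> - 1)\<close>.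
\<close>
lemma summable_abs_gchoose:
  fixes \<alpha> :: real assumes "0 < \<alpha>" shows "summable (\<lambda>\<nu>. \<bar>(-1) ^ \<nu> * (\<alpha> gchoose \<nu>)\<bar>)"
proof -
  have "(\<lambda>n. (\<alpha> gchoose n) / ((-1)^n / exp ((\<alpha>+1) * of_real (ln (real n))))) \<longlonglongrightarrow> inverse (Gamma (- \<alpha>))"
    by (rule gbinomial_asymptotic)
  then have "Bseq (\<lambda>n. (\<alpha> gchoose n) / ((-1)^n / exp ((\<alpha>+1) * ln (real n))))"
    by (intro convergent_imp_Bseq) (auto simp: convergent_def)
  then obtain C where C: "\<And>n. \<bar>(\<alpha> gchoose n) / ((-1)^n / exp ((\<alpha>+1) * ln (real n)))\<bar> \<le> C"
    unfolding Bseq_def by auto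
  have "summable (\<lambda>n. C * real n powr (- (\<alpha> + 1)))"
    using assms by (intro summable_mult) (simp add: summable_real_powr_iff)
  then show ?thesis
  proof (rule summable_comparison_test'[where N=1])
    fix n :: nat assume n: "1 \<le> n"
    have "\<bar>\<alpha> gchoose n\<bar> * exp ((\<alpha>+1) * ln (real n)) \<le> C"
      using C[of n] by (simp add: abs_mult power_abs)
    then have "\<bar>\<alpha> gchoose n\<bar> \<le> C / exp ((\<alpha>+1) * ln (real n))"
      by (simp add: pos_le_divide_eq)
    also have "\<dots> = C * real n powr (- (\<alpha> + 1))"
      using n unfolding powr_minus by (simp add: powr_def divide_inverse)
    finally show "norm \<bar>(-1) ^ n * (\<alpha> gchoose n)\<bar> \<le> C * real n powr (- (\<alpha> + 1))"
      by (simp add: abs_mult power_abs)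
  qed
qed

text \<open>
  The binomial series of \<open>(1 - z) powr \<alpha>\<close> on the boundary of its disc of convergence.  It converges
  uniformly on the closed disc, so the identity extends from the interior along a radius; taking
  norms avoids the choice of a branch.
\<close>
lemma norm_binomial_series_unit_circle:
  fixes \<alpha> :: real and z :: complex
  assumes \<alpha>: "0 < \<alpha>" and z: "norm z = 1"
  shows "norm (\<Sum>\<nu>. complex_of_real ((-1) ^ \<nu> * (\<alpha> gchoose \<nu>)) * z ^ \<nu>) = norm (1 - z) powr \<alpha>"
proof -
  define b where "b \<nu> = (-1) ^ \<nu> * (\<alpha> gchoose \<nu>)" for \<nu>
  have sb: "summable (\<lambda>\<nu>. \<bar>b \<nu>\<bar>)" unfolding b_def by (rule summable_abs_gchoose[OF \<alpha>])
  define F where "F w = (\<Sum>\<nu>. complex_of_real (b \<nu>) * w ^ \<nu>)" for w :: complex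
  have ul: "uniform_limit (cball 0 1) (\<lambda>n w. \<Sum>\<nu><n. complex_of_real (b \<nu>) * w ^ \<nu>) F sequentially"
    unfolding F_def
  proof (rule Weierstrass_m_test[OF _ sb])
    fix n and w :: complex assume "w \<in> cball 0 1"
    then show "norm (complex_of_real (b n) * w ^ n) \<le> \<bar>b n\<bar>"
      by (simp add: norm_mult norm_power mult_left_le power_le_one)
  qed
  have cF: "continuous_on (cball 0 1) F"
    by (rule uniform_limit_theorem[OF _ ul]) (auto intro!: always_eventually continuous_intros)
  have inside: "norm (F w) = norm (1 - w) powr \<alpha>" if w: "norm w < 1" for w
  proof -
    have "(\<lambda>n. (complex_of_real \<alpha> gchoose n) * (- w)^n) sums (1 + (- w)) powr complex_of_real \<alpha>"
      by (rule gen_binomial_complex) (use w in simp)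
    moreover have "(complex_of_real \<alpha> gchoose n) * (- w)^n = complex_of_real (b n) * w ^ n" for n
      by (simp add: b_def power_minus[of w] gbinomial_prod_rev)
    ultimately have "F w = (1 - w) powr complex_of_real \<alpha>" by (simp add: F_def sums_iff)
    moreover have "1 - w \<noteq> 0" using w by auto
    ultimately show ?thesis by (simp add: norm_powr_real_powr')
  qed
  define w where "w n = complex_of_real (1 - inverse (real (Suc n))) * z" for n
  have wn: "norm (w n) < 1" for n
  proof -
    have "norm (w n) = \<bar>1 - inverse (real (Suc n))\<bar>"
      unfolding w_def norm_mult z norm_of_real by simp
    also have "\<dots> < 1" by (simp add: abs_less_iff divide_simps)
    finally show ?thesis .
  qed
  have "(\<lambda>n. complex_of_real (1 - inverse (real (Suc n))) * z) \<longlonglongrightarrow> complex_of_real (1 - 0) * z"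
    by (intro tendsto_intros LIMSEQ_inverse_real_of_nat)
  then have wz: "w \<longlonglongrightarrow> z" by (simp add: w_def[abs_def])
  have "(\<lambda>n. norm (F (w n))) \<longlonglongrightarrow> norm (F z)"
    by (intro tendsto_norm continuous_on_tendsto_compose[OF cF wz]) (use z wn in \<open>auto intro!: always_eventually less_imp_le\<close>)
  moreover have "(\<lambda>n. norm (F (w n))) \<longlonglongrightarrow> norm (1 - z) powr \<alpha>"
    unfolding inside[OF wn] by (intro tendsto_powr2 tendsto_intros wz) (use \<alpha> in auto)
  ultimately show ?thesis unfolding F_def b_def using LIMSEQ_unique by blast
qed

text \<open>
  The coefficients of the difference of order \<open>\<alpha>\<close>.
\<close>
definition diff_coeff :: "real \<Rightarrow> nat \<Rightarrow> real" where
  "diff_coeff \<alpha> \<nu> = (-1) ^ \<nu> * (\<alpha> gchoose \<nu>)"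

text \<open>
  The factor by which the difference of order \<open>\<alpha>\<close> and step \<open>h\<close> multiplies the exponential of frequency \<open>k\<close>.
\<close>
definition diff_symbol :: "real \<Rightarrow> real \<Rightarrow> nat \<Rightarrow> complex" where
  "diff_symbol \<alpha> h k = (\<Sum>\<nu>. complex_of_real (diff_coeff \<alpha> \<nu>) * cis (real k * ((\<alpha> - real \<nu>) * h)))"

lemma norm_diff_symbol:
  assumes "0 < \<alpha>" shows "norm (diff_symbol \<alpha> h k) = \<bar>2 * sin (real k * h / 2)\<bar> powr \<alpha>"
proof -
  define z where "z = cis (- (real k * h))"
  have nz: "norm z = 1" by (simp add: z_def)
  have s: "summable (\<lambda>\<nu>. complex_of_real (diff_coeff \<alpha> \<nu>) * z ^ \<nu>)"
    by (rule summable_norm_cancel)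
      (use summable_abs_gchoose[OF assms] nz in \<open>simp add: diff_coeff_def norm_mult norm_power abs_mult power_abs\<close>)
  have "diff_symbol \<alpha> h k = (\<Sum>\<nu>. cis (real k * \<alpha> * h) * (complex_of_real (diff_coeff \<alpha> \<nu>) * z ^ \<nu>))"
    unfolding diff_symbol_def z_def
    by (intro suminf_cong) (simp add: Complex.DeMoivre cis_mult algebra_simps)
  also have "\<dots> = cis (real k * \<alpha> * h) * (\<Sum>\<nu>. complex_of_real (diff_coeff \<alpha> \<nu>) * z ^ \<nu>)"
    by (rule suminf_mult[OF s])
  finally have "norm (diff_symbol \<alpha> h k) = norm (1 - z) powr \<alpha>"
    using norm_binomial_series_unit_circle[OF assms nz] by (simp add: norm_mult diff_coeff_def)
  also have "norm (1 - z) = \<bar>2 * sin (real k * h / 2)\<bar>"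
  proof -
    have "(norm (1 - z))\<^sup>2 = (1 - cos (real k * h))\<^sup>2 + (sin (real k * h))\<^sup>2"
      by (simp add: cmod_power2 z_def)
    also have "\<dots> = 2 - 2 * cos (2 * (real k * h / 2))"
      using sin_cos_squared_add[of "real k * h"] by (simp add: power2_eq_square algebra_simps)
    also have "\<dots> = (2 * sin (real k * h / 2))\<^sup>2"
      unfolding cos_double_sin by (simp add: power_mult_distrib)
    finally have "(norm (1 - z))\<^sup>2 = \<bar>2 * sin (real k * h / 2)\<bar>\<^sup>2" by simp
    then show ?thesis by (rule power2_eq_imp_eq) auto
  qed
  finally show ?thesis .
qed

text \<open>
  Applied to a cosine, the difference multiplies the amplitude by the modulus of the symbol and shifts
  the phase by its argument.
\<close>
lemma phase_sum:
  assumes "0 < \<alpha>"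
  shows "(\<lambda>\<nu>. diff_coeff \<alpha> \<nu> * cos (u - real k * ((\<alpha> - real \<nu>) * h)))
    sums (norm (diff_symbol \<alpha> h k) * cos (u - Arg (diff_symbol \<alpha> h k)))"
proof -
  let ?Z = "diff_symbol \<alpha> h k"
  have "summable (\<lambda>\<nu>. complex_of_real (diff_coeff \<alpha> \<nu>) * cis (real k * ((\<alpha> - real \<nu>) * h)))"
    by (rule summable_norm_cancel)
      (use summable_abs_gchoose[OF assms] in \<open>simp add: diff_coeff_def norm_mult norm_power abs_mult power_abs\<close>)
  then have "(\<lambda>\<nu>. complex_of_real (diff_coeff \<alpha> \<nu>) * cis (real k * ((\<alpha> - real \<nu>) * h))) sums ?Z"
    unfolding diff_symbol_def by (rule summable_sums)
  from sums_mult[OF this, of "cis (- u)"]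
  have "(\<lambda>\<nu>. Re (cis (- u) * (complex_of_real (diff_coeff \<alpha> \<nu>) * cis (real k * ((\<alpha> - real \<nu>) * h))))) sums Re (cis (- u) * ?Z)"
    by (rule sums_Re)
  moreover have "Re (cis (- u) * (complex_of_real c * cis w)) = c * cos (u - w)" for c w
    by (simp add: cos_diff algebra_simps)
  moreover have "Re (cis (- u) * ?Z) = norm ?Z * cos (u - Arg ?Z)"
  proof -
    have "Re (cis (- u) * (complex_of_real (norm ?Z) * cis (Arg ?Z))) = norm ?Z * cos (u - Arg ?Z)"
      by (simp add: cos_diff algebra_simps)
    then show ?thesis using rcis_cmod_Arg[of ?Z] unfolding rcis_def by metis
  qed
  ultimately show ?thesis by simp
qed

lemma frac_diff1_eq: "frac_diff1 \<alpha> h f = shift_series (diff_coeff \<alpha>) (\<lambda>j. ((\<alpha> - real j) * h, 0)) f"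
  by (auto simp: frac_diff1_def shift_series_def diff_coeff_def)

lemma frac_diff2_eq: "frac_diff2 \<alpha> h f = shift_series (diff_coeff \<alpha>) (\<lambda>j. (0, (\<alpha> - real j) * h)) f"
  by (auto simp: frac_diff2_def shift_series_def diff_coeff_def)

text \<open>
  Measurable periodic functions that are integrable over a period.
\<close>
definition torus_function :: "(real \<times> real \<Rightarrow> real) \<Rightarrow> bool" where
  "torus_function f \<longleftrightarrow> f \<in> borel_measurable lebesgue \<and> biperiodic f \<and> integrable torus f"

lemma shift_series_torus_function:
  assumes "torus_function f" "0 < \<alpha>"
  shows "torus_function (shift_series (diff_coeff \<alpha>) v f)"
proof -
  interpret absolutely_summable_translates "diff_coeff \<alpha>" v f
    by standard (use assms summable_abs_gchoose in \<open>auto simp: torus_function_def diff_coeff_def\<close>)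
  show ?thesis
    using shift_measurable shift_biperiodic shift_integrable by (simp add: torus_function_def)
qed

lemma phase_series_frac_diff1:
  assumes f: "torus_function f" and \<alpha>: "0 < \<alpha>" and ph: "phase_series f a \<theta> \<eta>"
  shows "phase_series (frac_diff1 \<alpha> h f) (\<lambda>\<mu> \<nu>. norm (diff_symbol \<alpha> h (2^\<mu>)) * a \<mu> \<nu>)
           (\<lambda>\<mu>. \<theta> \<mu> + Arg (diff_symbol \<alpha> h (2^\<mu>))) \<eta>"
proof -
  interpret absolutely_summable_translates "diff_coeff \<alpha>" "\<lambda>j. ((\<alpha> - real j) * h, 0)" f
    by standard (use f \<alpha> summable_abs_gchoose in \<open>auto simp: torus_function_def diff_coeff_def\<close>)
  note co = shift_coefficient[folded frac_diff1_eq, simplified fst_conv snd_conv mult_zero_right diff_zero]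
  show ?thesis unfolding phase_series_def
  proof (intro conjI allI impI)
    fix \<mu> \<nu> s t
    let ?Z = "diff_symbol \<alpha> h (2^\<mu>)"
    have "(\<lambda>j. diff_coeff \<alpha> j * (pi\<^sup>2 * a \<mu> \<nu> * (cos (s - real (2^\<mu>) * ((\<alpha> - real j) * h) - \<theta> \<mu>) * cos (t - \<eta> \<nu>))))
      sums (\<integral>z. frac_diff1 \<alpha> h f z * (cos (real (2^\<mu>) * fst z + s) * cos (real (2^\<nu>) * snd z + t)) \<partial>torus)"
      using co[of "2^\<mu>" s "2^\<nu>" t] ph unfolding phase_series_def by (simp only:)
    moreover have "(\<lambda>j. pi\<^sup>2 * a \<mu> \<nu> * cos (t - \<eta> \<nu>) * (diff_coeff \<alpha> j * cos (s - \<theta> \<mu> - real (2^\<mu>) * ((\<alpha> - real j) * h))))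
       sums (pi\<^sup>2 * a \<mu> \<nu> * cos (t - \<eta> \<nu>) * (norm ?Z * cos (s - \<theta> \<mu> - Arg ?Z)))"
      by (intro sums_mult phase_sum \<alpha>)
    moreover have "s - real (2^\<mu>) * ((\<alpha> - real j) * h) - \<theta> \<mu> = s - \<theta> \<mu> - real (2^\<mu>) * ((\<alpha> - real j) * h)" for j by simp
    ultimately show "(\<integral>z. frac_diff1 \<alpha> h f z * (cos (real (2^\<mu>) * fst z + s) * cos (real (2^\<nu>) * snd z + t)) \<partial>torus)
      = pi\<^sup>2 * (norm ?Z * a \<mu> \<nu>) * (cos (s - (\<theta> \<mu> + Arg ?Z)) * cos (t - \<eta> \<nu>))"
      by (simp add: sums_iff mult_ac diff_diff_eq add_ac)
  next
    fix m n :: nat and s t :: real assume nl: "\<not> (m \<in> range (\<lambda>\<mu>. 2^\<mu>) \<and> n \<in> range (\<lambda>\<nu>. 2^\<nu>))"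
    have "(\<integral>z. f z * (cos (real m * fst z + s') * cos (real n * snd z + t')) \<partial>torus) = 0" for s' t'
      using ph nl unfolding phase_series_def by blast
    then show "(\<integral>z. frac_diff1 \<alpha> h f z * (cos (real m * fst z + s) * cos (real n * snd z + t)) \<partial>torus) = 0"
      using co[of m s n t] by (simp add: sums_iff)
  qed
qed

lemma phase_series_frac_diff2:
  assumes f: "torus_function f" and \<alpha>: "0 < \<alpha>" and ph: "phase_series f a \<theta> \<eta>"
  shows "phase_series (frac_diff2 \<alpha> h f) (\<lambda>\<mu> \<nu>. norm (diff_symbol \<alpha> h (2^\<nu>)) * a \<mu> \<nu>)
           \<theta> (\<lambda>\<nu>. \<eta> \<nu> + Arg (diff_symbol \<alpha> h (2^\<nu>)))"
proof -
  interpret absolutely_summable_translates "diff_coeff \<alpha>" "\<lambda>j. (0, (\<alpha> - real j) * h)" f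
    by standard (use f \<alpha> summable_abs_gchoose in \<open>auto simp: torus_function_def diff_coeff_def\<close>)
  note co = shift_coefficient[folded frac_diff2_eq, simplified fst_conv snd_conv mult_zero_right diff_zero]
  show ?thesis unfolding phase_series_def
  proof (intro conjI allI impI)
    fix \<mu> \<nu> s t
    let ?Z = "diff_symbol \<alpha> h (2^\<nu>)"
    have "(\<lambda>j. diff_coeff \<alpha> j * (pi\<^sup>2 * a \<mu> \<nu> * (cos (s - \<theta> \<mu>) * cos (t - real (2^\<nu>) * ((\<alpha> - real j) * h) - \<eta> \<nu>))))
      sums (\<integral>z. frac_diff2 \<alpha> h f z * (cos (real (2^\<mu>) * fst z + s) * cos (real (2^\<nu>) * snd z + t)) \<partial>torus)"
      using co[of "2^\<mu>" s "2^\<nu>" t] ph unfolding phase_series_def by (simp only:)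
    moreover have "(\<lambda>j. pi\<^sup>2 * a \<mu> \<nu> * cos (s - \<theta> \<mu>) * (diff_coeff \<alpha> j * cos (t - \<eta> \<nu> - real (2^\<nu>) * ((\<alpha> - real j) * h))))
       sums (pi\<^sup>2 * a \<mu> \<nu> * cos (s - \<theta> \<mu>) * (norm ?Z * cos (t - \<eta> \<nu> - Arg ?Z)))"
      by (intro sums_mult phase_sum \<alpha>)
    moreover have "t - real (2^\<nu>) * ((\<alpha> - real j) * h) - \<eta> \<nu> = t - \<eta> \<nu> - real (2^\<nu>) * ((\<alpha> - real j) * h)" for j by simp
    ultimately show "(\<integral>z. frac_diff2 \<alpha> h f z * (cos (real (2^\<mu>) * fst z + s) * cos (real (2^\<nu>) * snd z + t)) \<partial>torus)
      = pi\<^sup>2 * (norm ?Z * a \<mu> \<nu>) * (cos (s - \<theta> \<mu>) * cos (t - (\<eta> \<nu> + Arg ?Z)))"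
      by (simp add: sums_iff mult_ac diff_diff_eq add_ac)
  next
    fix m n :: nat and s t :: real assume nl: "\<not> (m \<in> range (\<lambda>\<mu>. 2^\<mu>) \<and> n \<in> range (\<lambda>\<nu>. 2^\<nu>))"
    have "(\<integral>z. f z * (cos (real m * fst z + s') * cos (real n * snd z + t')) \<partial>torus) = 0" for s' t'
      using ph nl unfolding phase_series_def by blast
    then show "(\<integral>z. frac_diff2 \<alpha> h f z * (cos (real m * fst z + s) * cos (real n * snd z + t)) \<partial>torus) = 0"
      using co[of m s n t] by (simp add: sums_iff)
  qed
qed

lemma Lp_torus_imp_torus_function:
  assumes p: "1 \<le> p" and f: "f \<in> Lp_torus p" shows "torus_function f"
proof -
  have fm: "f \<in> borel_measurable lebesgue" using f by (simp add: Lp_torus_def)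
  note [measurable] = measurable_torus[OF fm]
  have "(\<integral>\<^sup>+z\<in>torus_square. ennreal (\<bar>f z\<bar> powr p) \<partial>lebesgue) \<noteq> \<infinity>"
    using f by (auto simp: Lp_torus_def Lp_norm_def ennpowr_def)
  then have "(\<integral>\<^sup>+z. ennreal (\<bar>f z\<bar> powr p) \<partial>torus) < \<infinity>"
    by (simp add: torus_def nn_integral_restrict_space less_top)
  then have i: "integrable torus (\<lambda>z. \<bar>f z\<bar> powr p)" by (intro integrableI_bounded) auto
  have "\<bar>f z\<bar> \<le> 1 + \<bar>f z\<bar> powr p" for z
  proof (cases "\<bar>f z\<bar> \<le> 1")
    case True
    then show ?thesis by (simp add: add_increasing2)
  next
    case False
    then have "\<bar>f z\<bar> powr 1 \<le> \<bar>f z\<bar> powr p" using p by (intro powr_mono) auto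
    then show ?thesis using False by simp
  qed
  then have "integrable torus f"
    by (intro Bochner_Integration.integrable_bound[OF Bochner_Integration.integrable_add[OF torus.integrable_const[of 1] i]])
       (auto intro!: AE_I2)
  then show ?thesis using f fm by (simp add: torus_function_def biperiodic_def Lp_torus_def)
qed

text \<open>
  Passage from the four families of sine and cosine coefficients to integrals against shifted cosines,
  by the addition formula.
\<close>
lemma lacunary_phase_series:
  assumes f: "torus_function f" and c: "has_lacunary_series f c"
  shows "phase_series f c (\<lambda>_. 0) (\<lambda>_. 0)"
proof -
  have int: "integrable torus f" using f by (simp add: torus_function_def)
  define I where "I u v m n = (\<integral>z. f z * (u (real m * fst z) * v (real n * snd z)) \<partial>torus)" for u v m n
  have fc: "fourier_coeff u v f m n = (if m = 0 then 1/2 else 1) * (if n = 0 then 1/2 else 1) / pi\<^sup>2 * I u v m n" for u v m n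
    unfolding fourier_coeff_def I_def torus_def
    by (simp add: set_lebesgue_integral_def integral_restrict_space mult.assoc)
  have i: "integrable torus (\<lambda>z. f z * (u (real m * fst z) * v (real n * snd z)))"
    if "u = cos \<or> u = sin" "v = cos \<or> v = sin" for u v :: "real \<Rightarrow> real" and m n
    by (rule integrable_torus_mult_bounded[OF int, where B=1])
      (use that in \<open>auto intro!: borel_measurable_continuous_onI continuous_intros simp: abs_mult mult_le_one\<close>)
  have expand: "(\<integral>z. f z * (cos (real m * fst z + s) * cos (real n * snd z + t)) \<partial>torus)
    = cos s * cos t * I cos cos m n - cos s * sin t * I cos sin m n - sin s * cos t * I sin cos m n + sin s * sin t * I sin sin m n" for m n s t
  proof -
    have "f z * (cos (real m * fst z + s) * cos (real n * snd z + t)) =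
      cos s * cos t * (f z * (cos (real m * fst z) * cos (real n * snd z))) - cos s * sin t * (f z * (cos (real m * fst z) * sin (real n * snd z)))
      - sin s * cos t * (f z * (sin (real m * fst z) * cos (real n * snd z))) + sin s * sin t * (f z * (sin (real m * fst z) * sin (real n * snd z)))" for z
      unfolding cos_add by (simp add: algebra_simps)
    then show ?thesis unfolding I_def using i by simp
  qed
  have zero: "I u v m n = 0 \<longleftrightarrow> fourier_coeff u v f m n = 0" for u v m n by (simp add: fc)
  have z: "I cos sin m n = 0" "I sin cos m n = 0" "I sin sin m n = 0" for m n
    using c by (simp_all add: zero has_lacunary_series_def)
  have cc: "I cos cos (2^\<mu>) (2^\<nu>) = pi\<^sup>2 * c \<mu> \<nu>" for \<mu> \<nu>
  proof -
    have "fourier_coeff cos cos f (2^\<mu>) (2^\<nu>) = c \<mu> \<nu>" using c by (simp add: has_lacunary_series_def)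
    then show ?thesis unfolding fc by (simp add: field_simps)
  qed
  have nl: "I cos cos m n = 0" if "\<not> (m \<in> range (\<lambda>\<mu>. 2^\<mu>) \<and> n \<in> range (\<lambda>\<nu>. 2^\<nu>))" for m n
    using c that unfolding zero has_lacunary_series_def by blast
  show ?thesis unfolding phase_series_def expand
    by (auto simp: z cc nl simp del: of_nat_power)
qed

section \<open>The weights and the four-term expression\<close>

lemma infsum_ennreal_tail:
  fixes F :: "nat \<Rightarrow> ennreal"
  shows "(\<Sum>\<^sub>\<infinity>\<nu>\<in>{n+1..}. F \<nu>) = (\<Sum>\<nu>. if \<nu> \<le> n then 0 else F \<nu>)"
proof -
  have "(\<Sum>\<^sub>\<infinity>\<nu>\<in>{n+1..}. F \<nu>) = (\<Sum>\<^sub>\<infinity>\<nu>. if \<nu> \<le> n then 0 else F \<nu>)"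
    by (rule infsum_cong_neutral) auto
  also have "((\<lambda>\<nu>. if \<nu> \<le> n then 0 else F \<nu>) has_sum \<dots>) UNIV" by (rule has_sum_infsum) (rule nonneg_summable_on_complete, simp)
  from sums_unique[OF has_sum_imp_sums[OF this]] show ?thesis using calculation by simp
qed

lemma suminf_ennreal_split:
  fixes F :: "nat \<Rightarrow> ennreal"
  shows "(\<Sum>\<nu>. F \<nu>) = (\<Sum>\<nu>=0..n. F \<nu>) + (\<Sum>\<^sub>\<infinity>\<nu>\<in>{n+1..}. F \<nu>)"
proof -
  have "(\<Sum>\<nu>. F \<nu>) = (\<Sum>\<nu>. (if \<nu> \<le> n then F \<nu> else 0) + (if \<nu> \<le> n then 0 else F \<nu>))"
    by (intro suminf_cong) auto
  also have "\<dots> = (\<Sum>\<nu>. if \<nu> \<le> n then F \<nu> else 0) + (\<Sum>\<nu>. if \<nu> \<le> n then 0 else F \<nu>)"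
    by (rule suminf_add[symmetric]) auto
  also have "(\<Sum>\<nu>. if \<nu> \<le> n then F \<nu> else 0) = (\<Sum>\<nu>=0..n. if \<nu> \<le> n then F \<nu> else 0)"
    by (rule suminf_finite) auto
  also have "(\<Sum>\<nu>=0..n. if \<nu> \<le> n then F \<nu> else 0) = (\<Sum>\<nu>=0..n. F \<nu>)" by simp
  finally show ?thesis unfolding infsum_ennreal_tail .
qed

lemma infsum_ennreal_tail_cmult:
  fixes F :: "nat \<Rightarrow> ennreal"
  shows "k * (\<Sum>\<^sub>\<infinity>\<nu>\<in>{n+1..}. F \<nu>) = (\<Sum>\<^sub>\<infinity>\<nu>\<in>{n+1..}. k * F \<nu>)"
  unfolding infsum_ennreal_tail ennreal_suminf_cmult[symmetric] by (intro suminf_cong) auto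

text \<open>
  Up to constants, the largest modulus of the symbol at frequency \<open>2^\<mu>\<close> over steps \<open>\<bar>h\<bar> \<le> 1 / 2^n\<close>.
\<close>
definition weight :: "real \<Rightarrow> nat \<Rightarrow> nat \<Rightarrow> real" where
  "weight \<alpha> n \<mu> = (if \<mu> \<le> n then 2 powr ((real \<mu> - real n) * \<alpha>) else 1)"

lemma weight_pos: "0 < weight \<alpha> n \<mu>" by (simp add: weight_def)

text \<open>
  The four terms come from splitting the weighted square sum according to \<open>\<mu> \<le> n1\<close> and \<open>\<nu> \<le> n2\<close>.  The
  square root of a sum is at most the sum of the roots, and each of the four roots is at most the
  root of the total.
\<close>
lemma lacunary_expression_equivalence:
  fixes c :: "nat \<Rightarrow> nat \<Rightarrow> real" and \<alpha>1 \<alpha>2 :: real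
  defines "a \<equiv> \<lambda>n1 n2 \<mu> \<nu>. weight \<alpha>1 n1 \<mu> * weight \<alpha>2 n2 \<nu> * c \<mu> \<nu>"
  shows "ennpowr (square_sum (a n1 n2)) (1/2) \<le> lacunary_expression \<alpha>1 \<alpha>2 c n1 n2"
    and "lacunary_expression \<alpha>1 \<alpha>2 c n1 n2 \<le> 4 * ennpowr (square_sum (a n1 n2)) (1/2)"
proof -
  define F where "F \<mu> \<nu> = ennreal ((a n1 n2 \<mu> \<nu>)\<^sup>2)" for \<mu> \<nu>
  define R1 where "R1 = (\<Sum>\<mu>=0..n1. \<Sum>\<nu>=0..n2. F \<mu> \<nu>)"
  define R2 where "R2 = (\<Sum>\<mu>=0..n1. \<Sum>\<^sub>\<infinity>\<nu>\<in>{n2+1..}. F \<mu> \<nu>)"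
  define R3 where "R3 = (\<Sum>\<^sub>\<infinity>\<mu>\<in>{n1+1..}. \<Sum>\<nu>=0..n2. F \<mu> \<nu>)"
  define R4 where "R4 = (\<Sum>\<^sub>\<infinity>\<mu>\<in>{n1+1..}. \<Sum>\<^sub>\<infinity>\<nu>\<in>{n2+1..}. F \<mu> \<nu>)"
  have total: "square_sum (a n1 n2) = R1 + R2 + R3 + R4"
  proof -
    have "square_sum (a n1 n2) = (\<Sum>\<mu>. (\<Sum>\<nu>=0..n2. F \<mu> \<nu>) + (\<Sum>\<^sub>\<infinity>\<nu>\<in>{n2+1..}. F \<mu> \<nu>))"
      unfolding square_sum_def F_def by (intro suminf_cong suminf_ennreal_split)
    also have "\<dots> = R1 + R2 + R3 + R4"
      unfolding suminf_ennreal_split[of _ n1] R1_def R2_def R3_def R4_def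
      by (subst infsum_add) (auto intro!: nonneg_summable_on_complete simp: sum.distrib add.assoc)
    finally show ?thesis .
  qed
  have sq: "(2 powr x)\<^sup>2 = 2 powr (2 * x)" for x :: real
    by (simp add: power2_eq_square flip: powr_add)
  have scale: "ennreal ((1 / D)\<^sup>2) * ennreal (x\<^sup>2 * P2) = ennreal ((P / D * x)\<^sup>2)" if "P2 = P\<^sup>2" for D P P2 x :: real
    unfolding that by (subst ennreal_mult[symmetric]) (simp_all add: power_mult_distrib power_divide mult.commute)
  have R1: "ennreal ((1 / 2 powr (n1 * \<alpha>1 + n2 * \<alpha>2))\<^sup>2) * (\<Sum>\<mu>1=0..n1. \<Sum>\<mu>2=0..n2. ennreal ((c \<mu>1 \<mu>2)\<^sup>2 * 2 powr (2 * (\<mu>1 * \<alpha>1 + \<mu>2 * \<alpha>2)))) = R1"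
    unfolding R1_def sum_distrib_left
  proof (intro sum.cong refl)
    fix \<mu> \<nu> assume "\<mu> \<in> {0..n1}" "\<nu> \<in> {0..n2}"
    then have "weight \<alpha>1 n1 \<mu> * weight \<alpha>2 n2 \<nu> = 2 powr (\<mu> * \<alpha>1 + \<nu> * \<alpha>2) / 2 powr (n1 * \<alpha>1 + n2 * \<alpha>2)"
      by (simp add: weight_def left_diff_distrib powr_diff powr_add)
    then show "ennreal ((1 / 2 powr (n1 * \<alpha>1 + n2 * \<alpha>2))\<^sup>2) * ennreal ((c \<mu> \<nu>)\<^sup>2 * 2 powr (2 * (\<mu> * \<alpha>1 + \<nu> * \<alpha>2))) = F \<mu> \<nu>"
      unfolding F_def a_def by (simp only: scale[OF sq[symmetric]])
  qed
  have R2: "ennreal ((1 / 2 powr (n1 * \<alpha>1))\<^sup>2) * (\<Sum>\<mu>1=0..n1. \<Sum>\<^sub>\<infinity>\<mu>2\<in>{n2+1..}. ennreal ((c \<mu>1 \<mu>2)\<^sup>2 * 2 powr (2 * real \<mu>1 * \<alpha>1))) = R2"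
    unfolding R2_def sum_distrib_left infsum_ennreal_tail_cmult
  proof (intro sum.cong infsum_cong refl)
    fix \<mu> \<nu> assume "\<mu> \<in> {0..n1}" "\<nu> \<in> {n2+1..}"
    then have "weight \<alpha>1 n1 \<mu> * weight \<alpha>2 n2 \<nu> = 2 powr (\<mu> * \<alpha>1) / 2 powr (n1 * \<alpha>1)"
      by (simp add: weight_def left_diff_distrib powr_diff)
    then show "ennreal ((1 / 2 powr (n1 * \<alpha>1))\<^sup>2) * ennreal ((c \<mu> \<nu>)\<^sup>2 * 2 powr (2 * real \<mu> * \<alpha>1)) = F \<mu> \<nu>"
      unfolding F_def a_def by (simp only: mult.assoc[of 2] scale[OF sq[symmetric]])
  qed
  have R3: "ennreal ((1 / 2 powr (n2 * \<alpha>2))\<^sup>2) * (\<Sum>\<^sub>\<infinity>\<mu>1\<in>{n1+1..}. \<Sum>\<mu>2=0..n2. ennreal ((c \<mu>1 \<mu>2)\<^sup>2 * 2 powr (2 * real \<mu>2 * \<alpha>2))) = R3"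
    unfolding R3_def infsum_ennreal_tail_cmult sum_distrib_left
  proof (intro sum.cong infsum_cong refl)
    fix \<mu> \<nu> assume "\<mu> \<in> {n1+1..}" "\<nu> \<in> {0..n2}"
    then have "weight \<alpha>1 n1 \<mu> * weight \<alpha>2 n2 \<nu> = 2 powr (\<nu> * \<alpha>2) / 2 powr (n2 * \<alpha>2)"
      by (simp add: weight_def left_diff_distrib powr_diff)
    then show "ennreal ((1 / 2 powr (n2 * \<alpha>2))\<^sup>2) * ennreal ((c \<mu> \<nu>)\<^sup>2 * 2 powr (2 * real \<nu> * \<alpha>2)) = F \<mu> \<nu>"
      unfolding F_def a_def by (simp only: mult.assoc[of 2] scale[OF sq[symmetric]])
  qed
  have R4: "(\<Sum>\<^sub>\<infinity>\<mu>1\<in>{n1+1..}. \<Sum>\<^sub>\<infinity>\<mu>2\<in>{n2+1..}. ennreal ((c \<mu>1 \<mu>2)\<^sup>2)) = R4"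
    unfolding R4_def F_def a_def by (intro infsum_cong) (simp add: weight_def)
  have expr: "lacunary_expression \<alpha>1 \<alpha>2 c n1 n2
      = ennpowr R1 (1/2) + ennpowr R2 (1/2) + ennpowr R3 (1/2) + ennpowr R4 (1/2)"
    unfolding lacunary_expression_def R4 R1[symmetric] R2[symmetric] R3[symmetric]
    by (simp only: ennpowr_half_scale zero_less_divide_iff powr_gt_zero zero_less_one zero_neq_numeral[symmetric] simp_thms not_False_eq_True)
  show "ennpowr (square_sum (a n1 n2)) (1/2) \<le> lacunary_expression \<alpha>1 \<alpha>2 c n1 n2"
    unfolding total expr by (intro order_trans[OF ennpowr_half_add] add_right_mono order_refl)
  have "ennpowr R (1/2) \<le> ennpowr (square_sum (a n1 n2)) (1/2)" if "R \<in> {R1, R2, R3, R4}" for R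
    using that unfolding total by (intro ennpowr_mono) (auto simp: add_increasing add_increasing2)
  then have "lacunary_expression \<alpha>1 \<alpha>2 c n1 n2 \<le> ennpowr (square_sum (a n1 n2)) (1/2) + ennpowr (square_sum (a n1 n2)) (1/2)
      + ennpowr (square_sum (a n1 n2)) (1/2) + ennpowr (square_sum (a n1 n2)) (1/2)"
    unfolding expr by (intro add_mono) auto
  also have "\<dots> = 4 * ennpowr (square_sum (a n1 n2)) (1/2)"
  proof -
    have "(4::ennreal) = 1 + 1 + 1 + 1" by simp
    then show ?thesis by (simp only: distrib_right mult_1)
  qed
  finally show "lacunary_expression \<alpha>1 \<alpha>2 c n1 n2 \<le> 4 * ennpowr (square_sum (a n1 n2)) (1/2)" .
qed

lemma symbol_le_weight:
  assumes \<alpha>: "0 < \<alpha>" and h: "\<bar>h\<bar> \<le> 1 / 2^n"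
  shows "\<bar>2 * sin (real (2^\<mu>) * h / 2)\<bar> powr \<alpha> \<le> 2 powr \<alpha> * weight \<alpha> n \<mu>"
proof (cases "\<mu> \<le> n")
  case True
  have "\<bar>2 * sin (real (2^\<mu>) * h / 2)\<bar> \<le> 2 * \<bar>real (2^\<mu>) * h / 2\<bar>"
    unfolding abs_mult[of 2] using abs_sin_x_le_abs_x[of "real (2^\<mu>) * h / 2"] by simp
  also have "\<dots> = 2^\<mu> * \<bar>h\<bar>" by (simp add: abs_mult)
  also have "\<dots> \<le> 2^\<mu> * (1 / 2^n)" by (intro mult_left_mono h) auto
  also have "\<dots> = 2 powr (real \<mu> - real n)" by (simp add: powr_diff powr_realpow)
  finally have "\<bar>2 * sin (real (2^\<mu>) * h / 2)\<bar> powr \<alpha> \<le> (2 powr (real \<mu> - real n)) powr \<alpha>"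
    using \<alpha> by (intro powr_mono2) auto
  also have "\<dots> = weight \<alpha> n \<mu>" using True by (simp add: weight_def powr_powr)
  also have "\<dots> \<le> 2 powr \<alpha> * weight \<alpha> n \<mu>"
    using weight_pos[of \<alpha> n \<mu>] \<alpha> mult_right_mono[of 1 "2 powr \<alpha>" "weight \<alpha> n \<mu>"] by (simp add: ge_one_powr_ge_zero)
  finally show ?thesis .
next
  case False
  have "\<bar>2 * sin (real (2^\<mu>) * h / 2)\<bar> \<le> 2" by (simp add: abs_mult)
  then have "\<bar>2 * sin (real (2^\<mu>) * h / 2)\<bar> powr \<alpha> \<le> 2 powr \<alpha>" using \<alpha> by (intro powr_mono2) auto
  then show ?thesis using False by (simp add: weight_def)
qed

text \<open>
  One step that is good for every \<open>\<mu>\<close>.  For \<open>\<mu> \<le> n\<close> the argument of the sine is at most \<open>\<pi> / 12\<close>, where the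
  sine is bounded below by a linear function; for \<open>\<mu> = n + 1\<close> it is \<open>\<pi> / 6\<close>, and from then on a dyadic
  multiple of \<open>\<pi> / 3\<close>.
\<close>
lemma weight_le_symbol:
  assumes \<alpha>: "0 < \<alpha>" and h: "h = pi / 6 / 2^n"
  shows "weight \<alpha> n \<mu> \<le> 4 powr \<alpha> * \<bar>2 * sin (real (2^\<mu>) * h / 2)\<bar> powr \<alpha>"
proof (cases "\<mu> \<le> n")
  case True
  define u where "u = 2 powr (real \<mu> - real n)"
  have u: "0 < u" "u \<le> 1" using True powr_mono[of "real \<mu> - real n" 0 2] by (auto simp: u_def)
  define x where "x = u * pi / 12"
  have xeq: "real (2^\<mu>) * h / 2 = x" by (simp add: h x_def u_def powr_diff powr_realpow)
  have x: "0 < x" "x \<le> pi / 3" using u by (auto simp: x_def intro: order_trans[of _ "1 * pi / 12"])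
  have "\<exists>z. 0 < z \<and> z < x \<and> sin x - sin 0 = (x - 0) * cos z"
    by (rule MVT2[OF x(1)]) (auto intro!: derivative_eq_intros)
  then obtain z where z: "0 < z" "z < x" "sin x = x * cos z" by auto
  have "cos (pi/3) \<le> cos z" using z x by (intro cos_monotone_0_pi_le) auto
  then have "x * (1/2) \<le> sin x" unfolding z(3) using x by (intro mult_left_mono) (auto simp: cos_60)
  moreover have "u / 4 \<le> x" using u pi_gt3 by (simp add: x_def)
  ultimately have "u \<le> 4 * \<bar>2 * sin x\<bar>" using x by linarith
  then have "u powr \<alpha> \<le> (4 * \<bar>2 * sin x\<bar>) powr \<alpha>" using \<alpha> u by (intro powr_mono2) auto
  then show ?thesis using True unfolding xeq by (simp add: powr_mult weight_def u_def powr_powr)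
next
  case False
  \<comment> \<open>Doubling preserves \<open>sin\<^sup>2 = 3/4\<close>, as \<open>4 \<cdot> (3/4) \<cdot> (1/4) = 3/4\<close>.\<close>
  have sin3: "(sin (2^i * (pi/3)))\<^sup>2 = 3/4" for i :: nat
  proof (induction i)
    case 0 then show ?case by (simp add: sin_60 power_divide)
  next
    case (Suc i)
    have "sin (2^Suc i * (pi/3)) = 2 * sin (2^i * (pi/3)) * cos (2^i * (pi/3))"
      using sin_double[of "2^i * (pi/3)"] by (simp add: mult.assoc)
    moreover have "(cos (2^i * (pi/3)))\<^sup>2 = 1/4" using Suc sin_cos_squared_add[of "2^i * (pi/3)"] by linarith
    ultimately have "(sin (2^Suc i * (pi/3)))\<^sup>2 = 2\<^sup>2 * (3/4) * (1/4)"
      using Suc by (simp only: power_mult_distrib)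
    then show ?case by simp
  qed
  obtain i where i: "\<mu> = n + 1 + i" using False by (metis Suc_eq_plus1 le_Suc_ex not_less_eq_eq)
  have arg: "real (2^\<mu>) * h / 2 = 2^i * (pi / 6)" by (simp add: i h power_add)
  have "1/2 \<le> \<bar>sin (2^i * (pi / 6))\<bar>"
  proof (cases i)
    case 0 then show ?thesis by (simp add: sin_30)
  next
    case (Suc j)
    then have "2^i * (pi / 6) = 2^j * (pi/3)" by simp
    then have "(1/2)\<^sup>2 \<le> \<bar>sin (2^i * (pi / 6))\<bar>\<^sup>2" unfolding power2_abs by (simp only: sin3) (simp add: power_divide)
    then show ?thesis by (rule power2_le_imp_le) simp
  qed
  then have "1 \<le> 4 * \<bar>2 * sin (real (2^\<mu>) * h / 2)\<bar>" unfolding arg by (simp add: abs_mult)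
  then have "1 powr \<alpha> \<le> (4 * \<bar>2 * sin (real (2^\<mu>) * h / 2)\<bar>) powr \<alpha>" using \<alpha> by (intro powr_mono2) auto
  then show ?thesis using False by (simp add: powr_mult weight_def)
qed

section \<open>Equivalence for the mixed modulus of smoothness\<close>

theorem theorem7p3:
  fixes p \<alpha>1 \<alpha>2 :: real
  assumes "1 < p" and "0 < \<alpha>1" and "0 < \<alpha>2"
  shows "\<exists>C::real. C > 0 \<and>
    (\<forall>f \<in> Lambda_class p. \<forall>c :: nat \<Rightarrow> nat \<Rightarrow> real. has_lacunary_series f c \<longrightarrow>
      (\<forall>n1 n2 :: nat.
         ennreal (1 / C) * lacunary_expression \<alpha>1 \<alpha>2 c n1 n2
           \<le> mixed_modulus p \<alpha>1 \<alpha>2 f (1 / 2 ^ n1) (1 / 2 ^ n2) \<and>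
         mixed_modulus p \<alpha>1 \<alpha>2 f (1 / 2 ^ n1) (1 / 2 ^ n2)
           \<le> ennreal C * lacunary_expression \<alpha>1 \<alpha>2 c n1 n2))"
proof -
  obtain K where K: "K > 0" and
    lower: "\<And>G a \<theta> \<eta>. integrable torus G \<Longrightarrow> phase_series G a \<theta> \<eta> \<Longrightarrow> ennpowr (square_sum a) (1/2) \<le> ennreal K * Lp_norm p G" and
    upper: "\<And>G a \<theta> \<eta>. integrable torus G \<Longrightarrow> phase_series G a \<theta> \<eta> \<Longrightarrow> Lp_norm p G \<le> ennreal K * ennpowr (square_sum a) (1/2)"
    using lacunary_Lp_norm_equivalence[OF assms(1)] by blast
  define k2 where "k2 = 2 powr \<alpha>1 * 2 powr \<alpha>2"
  define k4 where "k4 = 4 powr \<alpha>1 * 4 powr \<alpha>2"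
  have k: "0 < k2" "0 < k4" by (auto simp: k2_def k4_def)
  define C where "C = max (K * k2) (4 * k4 * K)"
  have C: "0 < C" "K * k2 \<le> C" "4 * k4 * K \<le> C" using K k by (auto simp: C_def less_max_iff_disj)
  have main: "ennreal (1 / C) * lacunary_expression \<alpha>1 \<alpha>2 c n1 n2 \<le> mixed_modulus p \<alpha>1 \<alpha>2 f (1 / 2 ^ n1) (1 / 2 ^ n2) \<and>
      mixed_modulus p \<alpha>1 \<alpha>2 f (1 / 2 ^ n1) (1 / 2 ^ n2) \<le> ennreal C * lacunary_expression \<alpha>1 \<alpha>2 c n1 n2"
    if f: "f \<in> Lambda_class p" and c: "has_lacunary_series f c" for f c n1 n2
  proof -
    define X where "X = lacunary_expression \<alpha>1 \<alpha>2 c n1 n2"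
    define W where "W \<mu> \<nu> = weight \<alpha>1 n1 \<mu> * weight \<alpha>2 n2 \<nu> * c \<mu> \<nu>" for \<mu> \<nu>
    define E where "E = ennpowr (square_sum W) (1/2)"
    have EX: "E \<le> X" "X \<le> 4 * E"
      unfolding X_def E_def W_def[abs_def] by (rule lacunary_expression_equivalence)+
    have tf: "torus_function f"
      using f assms(1) by (intro Lp_torus_imp_torus_function[of p]) (auto simp: Lambda_class_def Lp0_torus_def)
    note ph = lacunary_phase_series[OF tf c]
    define g where "g h1 h2 = frac_diff1 \<alpha>1 h1 (frac_diff2 \<alpha>2 h2 f)" for h1 h2
    define s1 where "s1 h1 \<mu> = \<bar>2 * sin (real (2^\<mu>) * h1 / 2)\<bar> powr \<alpha>1" for h1 and \<mu> :: nat
    define s2 where "s2 h2 \<nu> = \<bar>2 * sin (real (2^\<nu>) * h2 / 2)\<bar> powr \<alpha>2" for h2 and \<nu> :: nat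
    have s0: "0 \<le> s1 h \<mu>" "0 \<le> s2 h \<nu>" for h \<mu> \<nu> by (auto simp: s1_def s2_def)
    define A where "A h1 h2 \<mu> \<nu> = s1 h1 \<mu> * (s2 h2 \<nu> * c \<mu> \<nu>)" for h1 h2 \<mu> \<nu>
    have g: "integrable torus (g h1 h2)" "\<exists>\<theta> \<eta>. phase_series (g h1 h2) (A h1 h2) \<theta> \<eta>" for h1 h2
    proof -
      have tf2: "torus_function (frac_diff2 \<alpha>2 h2 f)"
        unfolding frac_diff2_eq by (rule shift_series_torus_function[OF tf assms(3)])
      have "torus_function (g h1 h2)"
        unfolding g_def frac_diff1_eq by (rule shift_series_torus_function[OF tf2 assms(2)])
      then show "integrable torus (g h1 h2)" by (simp add: torus_function_def)
      show "\<exists>\<theta> \<eta>. phase_series (g h1 h2) (A h1 h2) \<theta> \<eta>"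
        using phase_series_frac_diff1[OF tf2 assms(2) phase_series_frac_diff2[OF tf assms(3) ph]]
        unfolding g_def A_def[abs_def] s1_def s2_def norm_diff_symbol[OF assms(2)] norm_diff_symbol[OF assms(3)] by blast
    qed
    have absA: "\<bar>A h1 h2 \<mu> \<nu>\<bar> = s1 h1 \<mu> * s2 h2 \<nu> * \<bar>c \<mu> \<nu>\<bar>" for h1 h2 \<mu> \<nu>
      using s0 by (simp add: A_def abs_mult)
    have absW: "\<bar>W \<mu> \<nu>\<bar> = weight \<alpha>1 n1 \<mu> * weight \<alpha>2 n2 \<nu> * \<bar>c \<mu> \<nu>\<bar>" for \<mu> \<nu>
      using weight_pos by (simp add: W_def abs_mult less_imp_le)
    \<comment> \<open>\<open>A h1 h2\<close> are the coefficients of the difference \<open>g h1 h2\<close>; \<open>W\<close> are the weighted coefficients.\<close>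
    have up: "Lp_norm p (g h1 h2) \<le> ennreal C * X" if h: "\<bar>h1\<bar> \<le> 1 / 2^n1" "\<bar>h2\<bar> \<le> 1 / 2^n2" for h1 h2
    proof -
      have "\<bar>A h1 h2 \<mu> \<nu>\<bar> \<le> k2 * \<bar>W \<mu> \<nu>\<bar>" for \<mu> \<nu>
      proof -
        have "s1 h1 \<mu> * s2 h2 \<nu> * \<bar>c \<mu> \<nu>\<bar> \<le> (2 powr \<alpha>1 * weight \<alpha>1 n1 \<mu>) * (2 powr \<alpha>2 * weight \<alpha>2 n2 \<nu>) * \<bar>c \<mu> \<nu>\<bar>"
          unfolding s1_def s2_def
          by (intro mult_right_mono mult_mono symbol_le_weight assms h) (auto simp: weight_pos less_imp_le)
        then show ?thesis unfolding absA absW k2_def by (simp add: mult_ac)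
      qed
      then have "square_sum (A h1 h2) \<le> ennreal (k2\<^sup>2) * square_sum W" by (rule square_sum_mono)
      then have AE: "ennpowr (square_sum (A h1 h2)) (1/2) \<le> ennreal k2 * E"
        unfolding E_def ennpowr_half_scale[OF k(1), symmetric] by (rule ennpowr_mono[rotated]) simp
      have "Lp_norm p (g h1 h2) \<le> ennreal K * ennpowr (square_sum (A h1 h2)) (1/2)"
        using g[of h1 h2] upper by blast
      also have "\<dots> \<le> ennreal K * (ennreal k2 * E)" by (rule mult_left_mono[OF AE]) simp
      also have "\<dots> = ennreal (K * k2) * E" using K k by (simp add: ennreal_mult mult.assoc)
      also have "\<dots> \<le> ennreal C * X" by (intro mult_mono ennreal_leI C EX) auto
      finally show ?thesis .
    qed
    have "mixed_modulus p \<alpha>1 \<alpha>2 f (1 / 2 ^ n1) (1 / 2 ^ n2) \<le> ennreal C * X"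
      unfolding mixed_modulus_def by (rule SUP_least) (use up in \<open>auto simp: g_def\<close>)
    moreover have "ennreal (1 / C) * X \<le> mixed_modulus p \<alpha>1 \<alpha>2 f (1 / 2 ^ n1) (1 / 2 ^ n2)"
    proof -
      define h1 where "h1 = pi / 6 / 2^n1"
      define h2 where "h2 = pi / 6 / 2^n2"
      have "pi / 6 \<le> 1" using pi_less_4 by simp
      then have h: "\<bar>h1\<bar> \<le> 1 / 2^n1" "\<bar>h2\<bar> \<le> 1 / 2^n2"
        by (auto simp: h1_def h2_def field_simps)
      have "\<bar>W \<mu> \<nu>\<bar> \<le> k4 * \<bar>A h1 h2 \<mu> \<nu>\<bar>" for \<mu> \<nu>
      proof -
        have "weight \<alpha>1 n1 \<mu> * weight \<alpha>2 n2 \<nu> * \<bar>c \<mu> \<nu>\<bar> \<le> (4 powr \<alpha>1 * s1 h1 \<mu>) * (4 powr \<alpha>2 * s2 h2 \<nu>) * \<bar>c \<mu> \<nu>\<bar>"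
          unfolding s1_def s2_def
          by (intro mult_right_mono mult_mono weight_le_symbol assms h1_def h2_def) (auto simp: weight_pos less_imp_le)
        then show ?thesis unfolding absA absW k4_def by (simp add: mult_ac)
      qed
      then have "square_sum W \<le> ennreal (k4\<^sup>2) * square_sum (A h1 h2)" by (rule square_sum_mono)
      then have "E \<le> ennpowr (ennreal (k4\<^sup>2) * square_sum (A h1 h2)) (1/2)"
        unfolding E_def by (rule ennpowr_mono[rotated]) simp
      also have "\<dots> = ennreal k4 * ennpowr (square_sum (A h1 h2)) (1/2)"
        by (rule ennpowr_half_scale[OF k(2)])
      also have "\<dots> \<le> ennreal k4 * (ennreal K * Lp_norm p (g h1 h2))"
      proof (rule mult_left_mono)
        obtain \<theta> \<eta> where "phase_series (g h1 h2) (A h1 h2) \<theta> \<eta>" using g(2) by blast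
        then show "ennpowr (square_sum (A h1 h2)) (1/2) \<le> ennreal K * Lp_norm p (g h1 h2)"
          by (rule lower[OF g(1)])
      qed simp
      finally have E: "E \<le> ennreal k4 * (ennreal K * Lp_norm p (g h1 h2))" .
      have "X \<le> ennreal 4 * (ennreal k4 * (ennreal K * Lp_norm p (g h1 h2)))"
        using EX(2) mult_left_mono[OF E, of 4] by simp
      also have "\<dots> = ennreal (4 * k4 * K) * Lp_norm p (g h1 h2)"
        using K k by (simp add: ennreal_mult mult.assoc)
      also have "\<dots> \<le> ennreal C * Lp_norm p (g h1 h2)"
        by (intro mult_right_mono ennreal_leI C) auto
      finally have "ennreal (1 / C) * X \<le> ennreal (1 / C) * (ennreal C * Lp_norm p (g h1 h2))"
        by (rule mult_left_mono) simp
      also have "\<dots> = Lp_norm p (g h1 h2)"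
        using C(1) by (simp add: mult.assoc[symmetric] flip: ennreal_mult)
      also have "\<dots> \<le> mixed_modulus p \<alpha>1 \<alpha>2 f (1 / 2 ^ n1) (1 / 2 ^ n2)"
        unfolding mixed_modulus_def by (rule SUP_upper2[of "(h1, h2)"]) (use h in \<open>auto simp: g_def\<close>)
      finally show ?thesis .
    qed
    ultimately show ?thesis by (simp add: X_def)
  qed
  show ?thesis using C(1) main by blast
qed

end
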